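(* Assume the small data condition $$\eta^{-2}M\left(2(Ri\,C_P^2\kappa^{-1}\|\gamma\|_{-1}+\|f\|_{-1})+\kappa^{-2}M\|\gamma\|_{-1}^2\right)<1,\qquad \eta^{-1}Ri\,C_P^2<1.$$ Then the Boussinesq solution operator $G:V_h\times W_h\to V_h\times W_h$ is Lipschitz Fréchet differentiable: $G$ is Fréchet differentiable on $V_h\times W_h$ with derivative at $(u,\theta)$ given by $(h,s)\mapsto G'(u,\theta;h,s)$, and there exists a constant $\hat C_G$ such that for all $(u,\theta),(w,z),(h,s)\in V_h\times W_h$, $$\|G'(u,\theta;h,s)\|_B\le C_G\|(h,s)\|_B$$ and $$\|G'(u+h,\theta+s;w,z)-G'(u,\theta;w,z)\|_B\le\hat C_G\|(h,s)\|_B\|(w,z)\|_B,$$ where $C_G=\nu^{-1/2}\eta^{-1/2}M\sqrt{2K_1^2+3K_2^2}$.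
   Context: Setting. $\Omega\subset\mathbb{R}^d$ ($d=2$ or $3$) is a bounded simply connected domain that is either a convex polytope or has smooth boundary. $(\cdot,\cdot)$ and $\|\cdot\|$ are the $L^2(\Omega)$ inner product (also used for duality pairings) and norm. $X=H_0^1(\Omega)^d$, $Q=L_0^2(\Omega)$ (mean-zero $L^2$ functions), $W=H_0^1(\Omega)$. $\|\cdot\|_{-1}$ is the norm dual to $v\mapsto\|\nabla v\|$. $C_P>0$ is a Poincaré constant: $\|v\|\le C_P\|\nabla v\|$ for $v\in X$ or $v\in W$. Define $b(u,v,w)=\frac12((u\cdot\nabla v,w)-(u\cdot\nabla w,v))$ on $X\times X\times X$ and $b^*(v,\phi,\psi)=\frac12((v\cdot\nabla\phi,\psi)-(v\cdot\nabla\psi,\phi))$ on $X\times W\times W$. $M>0$ is a constant depending only on $\Omega$ with $b(u,v,w)\le M\|\nabla u\|\|\nabla v\|\|\nabla w\|$ and $b^*(v,\phi,\psi)\le M\|\nabla v\|\|\nabla\phi\|\|\nabla\psi\|$. $X_h\subset X$, $Q_h\subset Q$, $W_h\subset W$ are finite-dimensional (finite element) subspaces with $(X_h,Q_h)$ satisfying the discrete inf-sup condition, and $V_h=\{v\in X_h:(\nabla\cdot v,q)=0\ \forall q\in Q_h\}$. The parameters $\nu,\kappa,Ri$ are positive, $\eta=\min\{\nu,\kappa\}$, $f\in H^{-1}(\Omega)^d$, $\gamma\in H^{-1}(\Omega)$. $\langle 0,\theta\rangle^T$ is the vector field whose last component is $\theta$ and whose other components are zero. Constants: $K_1=Ri\,C_P^2\nu^{-1}\kappa^{-1}\|\gamma\|_{-1}+\nu^{-1}\|f\|_{-1}$,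 $K_2=\kappa^{-1}\|\gamma\|_{-1}$. Norm: $\|(v,w)\|_B=\sqrt{\nu\|\nabla v\|^2+\kappa\|\nabla w\|^2}$ on $V_h\times W_h$. Operator $G$. For $(u,\theta)\in V_h\times W_h$, $G(u,\theta)=(G_1(u,\theta),G_2(u,\theta)):=(\tilde u,\tilde\theta)\in V_h\times W_h$ is the (unique) solution of $$b(u,\tilde u,v)+\nu(\nabla\tilde u,\nabla v)=Ri(\langle 0,\tilde\theta\rangle^T,v)+(f,v),\qquad b^*(u,\tilde\theta,\chi)+\kappa(\nabla\tilde\theta,\nabla\chi)=(\gamma,\chi)$$ for all $(v,\chi)\in V_h\times W_h$. Operator $G'$. For $(u,\theta),(h,s)\in V_h\times W_h$, $G'(u,\theta;h,s)=(G_1'(u,\theta;h,s),G_2'(u,\theta;h,s))\in V_h\times W_h$ is defined by requiring, for all $(v,\chi)\in V_h\times W_h$, $$b(h,G_1(u,\theta),v)+b(u,G_1'(u,\theta;h,s),v)+\nu(\nabla G_1'(u,\theta;h,s),\nabla v)=Ri(\langle 0,G_2'(u,\theta;h,s)\rangle^T,v),$$ $$b^*(h,G_2(u,\theta),\chi)+b^*(u,G_2'(u,\theta;h,s),\chi)+\kappa(\nabla G_2'(u,\theta;h,s),\nabla\chi)=0.$$ *)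

theory Defs
  imports "HOL-Analysis.Analysis"
begin

section \<open>Square-integrable functions modulo null sets\<close>

definition sq_integrable :: "('a::euclidean_space \<Rightarrow> real) \<Rightarrow> bool" where
  "sq_integrable f \<longleftrightarrow> f \<in> borel_measurable lborel \<and> integrable lborel (\<lambda>x. (f x)\<^sup>2)"

lemma sq_integrable_mult:
  assumes "sq_integrable f" "sq_integrable g"
  shows "integrable lborel (\<lambda>x. f x * g x)"
proof (rule Bochner_Integration.integrable_bound)
  show "integrable lborel (\<lambda>x. (f x)\<^sup>2 + (g x)\<^sup>2)"
    using assms by (auto simp: sq_integrable_def)
  show "(\<lambda>x. f x * g x) \<in> borel_measurable lborel"
    using assms by (auto simp: sq_integrable_def)
  have "\<bar>a * b\<bar> \<le> a\<^sup>2 + b\<^sup>2" for a b :: real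
  proof -
    have "0 \<le> (\<bar>a\<bar> - \<bar>b\<bar>)\<^sup>2" by simp
    then have "2 * (\<bar>a\<bar> * \<bar>b\<bar>) \<le> a\<^sup>2 + b\<^sup>2" by (simp add: power2_diff)
    moreover have "0 \<le> \<bar>a\<bar> * \<bar>b\<bar>" by simp
    ultimately show ?thesis unfolding abs_mult by linarith
  qed
  then show "AE x in lborel. norm (f x * g x) \<le> norm ((f x)\<^sup>2 + (g x)\<^sup>2)"
    by (intro AE_I2) simp
qed

lemma sq_integrable_zero: "sq_integrable (\<lambda>x. 0)"
  by (simp add: sq_integrable_def)

lemma sq_integrable_add:
  assumes "sq_integrable f" "sq_integrable g"
  shows "sq_integrable (\<lambda>x. f x + g x)"
  using assms sq_integrable_mult[OF assms]
  by (auto simp: sq_integrable_def power2_sum mult.assoc)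

lemma sq_integrable_scale:
  assumes "sq_integrable f"
  shows "sq_integrable (\<lambda>x. c * f x)"
  using assms by (auto simp: sq_integrable_def power_mult_distrib)

quotient_type (overloaded) 'a L2 = "'a::euclidean_space \<Rightarrow> real" / partial:
  "\<lambda>f g. sq_integrable f \<and> sq_integrable g \<and> (AE x in lborel. f x = g x)"
proof (rule part_equivpI)
  show "\<exists>f :: 'a \<Rightarrow> real. sq_integrable f \<and> sq_integrable f \<and> (AE x in lborel. f x = f x)"
    using sq_integrable_zero by auto
  show "symp (\<lambda>f g :: 'a \<Rightarrow> real. sq_integrable f \<and> sq_integrable g \<and> (AE x in lborel. f x = g x))"
    by (auto intro!: sympI)
  show "transp (\<lambda>f g :: 'a \<Rightarrow> real. sq_integrable f \<and> sq_integrable g \<and> (AE x in lborel. f x = g x))"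
    by (rule transpI) (auto elim: AE_mp)
qed

instantiation L2 :: (euclidean_space) real_vector
begin

lift_definition zero_L2 :: "'a L2" is "\<lambda>x. 0"
  by (simp add: sq_integrable_zero)

lift_definition plus_L2 :: "'a L2 \<Rightarrow> 'a L2 \<Rightarrow> 'a L2" is "\<lambda>f g x. f x + g x"
  by (auto intro: sq_integrable_add)

lift_definition scaleR_L2 :: "real \<Rightarrow> 'a L2 \<Rightarrow> 'a L2" is "\<lambda>c f x. c * f x"
  by (auto intro: sq_integrable_scale)

definition uminus_L2 :: "'a L2 \<Rightarrow> 'a L2" where "uminus_L2 f = (-1) *\<^sub>R f"

definition minus_L2 :: "'a L2 \<Rightarrow> 'a L2 \<Rightarrow> 'a L2" where "minus_L2 f g = f + (-1) *\<^sub>R g"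

instance
proof
  fix a b c :: "'a L2" and r s :: real
  show "a + b + c = a + (b + c)"
    by transfer (auto intro!: sq_integrable_add simp: add.assoc)
  show "a + b = b + a"
    by transfer (auto intro!: sq_integrable_add simp: add.commute)
  show "0 + a = a"
    by transfer auto
  show "- a + a = 0"
    unfolding uminus_L2_def
    by transfer (auto simp: sq_integrable_zero)
  show "a - b = a + - b"
    by (simp add: minus_L2_def uminus_L2_def)
  show "r *\<^sub>R (a + b) = r *\<^sub>R a + r *\<^sub>R b"
    by transfer (auto intro!: sq_integrable_add sq_integrable_scale simp flip: distrib_left)
  show "(r + s) *\<^sub>R a = r *\<^sub>R a + s *\<^sub>R a"
    by transfer (auto intro!: sq_integrable_add sq_integrable_scale simp flip: distrib_right)
  show "r *\<^sub>R s *\<^sub>R a = (r * s) *\<^sub>R a"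
    by transfer (auto intro!: sq_integrable_scale simp: mult.assoc)
  show "1 *\<^sub>R a = a"
    by transfer auto
qed

end

instantiation L2 :: (euclidean_space) real_inner
begin

lift_definition inner_L2 :: "'a L2 \<Rightarrow> 'a L2 \<Rightarrow> real" is "\<lambda>f g. LINT x|lborel. f x * g x"
  by (intro integral_cong_AE) (auto simp: sq_integrable_def)

definition norm_L2 :: "'a L2 \<Rightarrow> real" where "norm_L2 f = sqrt (f \<bullet> f)"

definition sgn_L2 :: "'a L2 \<Rightarrow> 'a L2" where "sgn_L2 f = f /\<^sub>R norm f"

definition dist_L2 :: "'a L2 \<Rightarrow> 'a L2 \<Rightarrow> real" where "dist_L2 f g = norm (f - g)"

definition uniformity_L2 :: "('a L2 \<times> 'a L2) filter" where
  "uniformity_L2 = (INF e\<in>{0 <..}. principal {(f, g). dist f g < e})"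

definition open_L2 :: "'a L2 set \<Rightarrow> bool" where
  "open_L2 U = (\<forall>f\<in>U. eventually (\<lambda>(f', g). f' = f \<longrightarrow> g \<in> U) uniformity)"

instance
proof
  fix a b c :: "'a L2" and r :: real and U :: "'a L2 set"
  show "dist a b = norm (a - b)" by (rule dist_L2_def)
  show "sgn a = a /\<^sub>R norm a" by (rule sgn_L2_def)
  show "uniformity = (INF e\<in>{0 <..}. principal {(f, g :: 'a L2). dist f g < e})"
    by (rule uniformity_L2_def)
  show "open U = (\<forall>f\<in>U. eventually (\<lambda>(f', g). f' = f \<longrightarrow> g \<in> U) uniformity)"
    by (rule open_L2_def)
  show "a \<bullet> b = b \<bullet> a"
    by transfer (simp add: mult.commute)
  show "(a + b) \<bullet> c = a \<bullet> c + b \<bullet> c"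
    by transfer (simp add: distrib_right sq_integrable_mult)
  show "(r *\<^sub>R a) \<bullet> b = r * (a \<bullet> b)"
    by transfer (simp add: mult.assoc)
  show "0 \<le> a \<bullet> a"
    by transfer simp
  show "a \<bullet> a = 0 \<longleftrightarrow> a = 0"
  proof (transfer, goal_cases)
    case (1 f)
    then have f: "sq_integrable f" by simp
    have "(LINT x|lborel. f x * f x) = 0 \<longleftrightarrow> (AE x in lborel. f x * f x = 0)"
      by (rule integral_nonneg_eq_0_iff_AE) (auto intro: sq_integrable_mult f)
    then show ?case using f by (simp add: sq_integrable_zero)
  qed
  show "norm a = sqrt (a \<bullet> a)" by (rule norm_L2_def)
qed

end

text \<open>The representative \<open>fun_of u\<close> is determined up to a null set; it is only used where
  changing it on a null set is harmless.\<close>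

definition fun_of :: "'a::euclidean_space L2 \<Rightarrow> 'a \<Rightarrow> real" where
  "fun_of = rep_L2"

definition class_of :: "('a::euclidean_space \<Rightarrow> real) \<Rightarrow> 'a L2" where
  "class_of = abs_L2"


section \<open>Domains\<close>

primrec Ck_on :: "nat \<Rightarrow> 'a::euclidean_space set \<Rightarrow> ('a \<Rightarrow> real) \<Rightarrow> bool" where
  "Ck_on 0 U f \<longleftrightarrow> continuous_on U f"
| "Ck_on (Suc k) U f \<longleftrightarrow>
     (\<forall>x\<in>U. f differentiable (at x)) \<and> (\<forall>v. Ck_on k U (\<lambda>x. frechet_derivative f (at x) v))"

definition smooth_on :: "'a::euclidean_space set \<Rightarrow> ('a \<Rightarrow> real) \<Rightarrow> bool" where
  "smooth_on U f \<longleftrightarrow> (\<forall>k. Ck_on k U f)"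

text \<open>Near each boundary point the domain is a strict sublevel set of a smooth function without
  critical points, so it lies locally on one side of a smooth hypersurface.\<close>

definition smooth_boundary :: "'a::euclidean_space set \<Rightarrow> bool" where
  "smooth_boundary \<Omega> \<longleftrightarrow>
     (\<forall>x\<in>frontier \<Omega>. \<exists>U g. open U \<and> x \<in> U \<and> smooth_on U g \<and>
        (\<forall>y\<in>U. \<exists>v. frechet_derivative g (at y) v \<noteq> 0) \<and> \<Omega> \<inter> U = {y\<in>U. g y < 0})"

definition admissible_domain :: "'a::euclidean_space set \<Rightarrow> bool" where
  "admissible_domain \<Omega> \<longleftrightarrow>
     open \<Omega> \<and> connected \<Omega> \<and> \<Omega> \<noteq> {} \<and> bounded \<Omega> \<and> simply_connected \<Omega> \<and>
     ((\<exists>P. polytope P \<and> \<Omega> = interior P) \<or> smooth_boundary \<Omega>)"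


section \<open>Function spaces\<close>

text \<open>A function on \<open>\<Omega>\<close> is identified with its extension by zero, so that the inner product and
  norm of the type \<open>L2\<close> restrict to those of \<open>L\<^sup>2(\<Omega>)\<close>.  Vector fields are elements of
  \<open>L2 ^ 'n\<close>, gradients of vector fields elements of \<open>L2 ^ 'n ^ 'n\<close>; the inner product and norm of
  these types are the componentwise \<open>L\<^sup>2\<close> ones.\<close>

type_synonym 'n point = "real^'n"
type_synonym 'n sfield = "(real^'n) L2"
type_synonym 'n vfield = "((real^'n) L2)^'n"

definition L2_on :: "'a::euclidean_space set \<Rightarrow> 'a L2 set" where
  "L2_on \<Omega> = {u. AE x in lborel. x \<notin> \<Omega> \<longrightarrow> fun_of u x = 0}"

definition L2_mean_zero :: "'a::euclidean_space set \<Rightarrow> 'a L2 set" where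
  "L2_mean_zero \<Omega> = {q \<in> L2_on \<Omega>. (LINT x:\<Omega>|lborel. fun_of q x) = 0}"

definition test_functions :: "'a::euclidean_space set \<Rightarrow> ('a \<Rightarrow> real) set" where
  "test_functions \<Omega> =
     {\<phi>. smooth_on UNIV \<phi> \<and> (\<exists>K. compact K \<and> K \<subseteq> \<Omega> \<and> (\<forall>x. x \<notin> K \<longrightarrow> \<phi> x = 0))}"

definition partial_deriv :: "'n::finite \<Rightarrow> (real^'n \<Rightarrow> real) \<Rightarrow> real^'n \<Rightarrow> real" where
  "partial_deriv i \<phi> x = frechet_derivative \<phi> (at x) (axis i 1)"

definition is_weak_grad ::
    "'n::finite point set \<Rightarrow> 'n sfield \<Rightarrow> 'n vfield \<Rightarrow> bool" where
  "is_weak_grad \<Omega> u g \<longleftrightarrow>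
     (\<forall>i. g $ i \<in> L2_on \<Omega> \<and>
       (\<forall>\<phi>\<in>test_functions \<Omega>.
          (LINT x:\<Omega>|lborel. fun_of u x * partial_deriv i \<phi> x) =
          - (LINT x:\<Omega>|lborel. fun_of (g $ i) x * \<phi> x)))"

definition H1 :: "'n::finite point set \<Rightarrow> 'n sfield set" where
  "H1 \<Omega> = {u \<in> L2_on \<Omega>. \<exists>g. is_weak_grad \<Omega> u g}"

definition grad :: "'n::finite point set \<Rightarrow> 'n sfield \<Rightarrow> 'n vfield" where
  "grad \<Omega> u = (THE g. is_weak_grad \<Omega> u g)"

text \<open>\<open>H\<^sup>1\<^sub>0\<close>: the closure of the test functions in the \<open>H\<^sup>1\<close>-norm.\<close>

definition H10 :: "'n::finite point set \<Rightarrow> 'n sfield set" where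
  "H10 \<Omega> = {u \<in> H1 \<Omega>. \<forall>\<epsilon>>0. \<exists>\<phi>\<in>test_functions \<Omega>.
      norm (u - class_of \<phi>) < \<epsilon> \<and> norm (grad \<Omega> u - (\<chi> i. class_of (partial_deriv i \<phi>))) < \<epsilon>}"

definition H10_vec :: "'n::finite point set \<Rightarrow> 'n vfield set" where
  "H10_vec \<Omega> = {v. \<forall>i. v $ i \<in> H10 \<Omega>}"

definition vgrad :: "'n::finite point set \<Rightarrow> 'n vfield \<Rightarrow> ('n sfield)^'n^'n" where
  "vgrad \<Omega> v = (\<chi> i. grad \<Omega> (v $ i))"

definition divergence :: "'n::finite point set \<Rightarrow> 'n vfield \<Rightarrow> 'n sfield" where
  "divergence \<Omega> v = (\<Sum>i\<in>UNIV. grad \<Omega> (v $ i) $ i)"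


section \<open>Dual spaces\<close>

text \<open>Elements of the dual act on all of \<open>L2\<close> as HOL functions; only their values on \<open>H10 \<Omega>\<close> matter.\<close>

type_synonym 'n functional = "'n sfield \<Rightarrow> real"
type_synonym 'n vfunctional = "('n functional)^'n"

definition Hm1 :: "'n::finite point set \<Rightarrow> 'n functional set" where
  "Hm1 \<Omega> = {l. (\<forall>u\<in>H10 \<Omega>. \<forall>v\<in>H10 \<Omega>. l (u + v) = l u + l v) \<and>
                (\<forall>c. \<forall>u\<in>H10 \<Omega>. l (c *\<^sub>R u) = c * l u) \<and>
                (\<exists>C. \<forall>u\<in>H10 \<Omega>. \<bar>l u\<bar> \<le> C * norm (grad \<Omega> u))}"

definition Hm1_vec :: "'n::finite point set \<Rightarrow> 'n vfunctional set" where
  "Hm1_vec \<Omega> = {f. \<forall>i. f $ i \<in> Hm1 \<Omega>}"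

definition vpair :: "'n::finite vfunctional \<Rightarrow> 'n vfield \<Rightarrow> real" where
  "vpair f v = (\<Sum>i\<in>UNIV. (f $ i) (v $ i))"

text \<open>As for the operator norm \<open>onorm\<close>, the quotient at the zero vector is \<open>0 / 0 = 0\<close>.\<close>

definition Hm1_norm :: "'n::finite point set \<Rightarrow> 'n functional \<Rightarrow> real" where
  "Hm1_norm \<Omega> l = (SUP w\<in>H10 \<Omega>. l w / norm (grad \<Omega> w))"

definition Hm1_vec_norm :: "'n::finite point set \<Rightarrow> 'n vfunctional \<Rightarrow> real" where
  "Hm1_vec_norm \<Omega> f = (SUP v\<in>H10_vec \<Omega>. vpair f v / norm (vgrad \<Omega> v))"


section \<open>Trilinear forms\<close>

definition conv_form ::
    "'n::finite point set \<Rightarrow> 'n vfield \<Rightarrow> 'n sfield \<Rightarrow> 'n sfield \<Rightarrow> real" where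
  "conv_form \<Omega> v \<phi> \<psi> =
     (LINT x:\<Omega>|lborel. (\<Sum>j\<in>UNIV. fun_of (v $ j) x * fun_of (grad \<Omega> \<phi> $ j) x) * fun_of \<psi> x)"

definition vconv_form ::
    "'n::finite point set \<Rightarrow> 'n vfield \<Rightarrow> 'n vfield \<Rightarrow> 'n vfield \<Rightarrow> real"
  where
  "vconv_form \<Omega> u v w =
     (LINT x:\<Omega>|lborel. (\<Sum>i\<in>UNIV.
        (\<Sum>j\<in>UNIV. fun_of (u $ j) x * fun_of (grad \<Omega> (v $ i) $ j) x) * fun_of (w $ i) x))"

definition b_form ::
    "'n::finite point set \<Rightarrow> 'n vfield \<Rightarrow> 'n vfield \<Rightarrow> 'n vfield \<Rightarrow> real"
  where
  "b_form \<Omega> u v w = 1/2 * (vconv_form \<Omega> u v w - vconv_form \<Omega> u w v)"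

definition bstar_form ::
    "'n::finite point set \<Rightarrow> 'n vfield \<Rightarrow> 'n sfield \<Rightarrow> 'n sfield \<Rightarrow> real" where
  "bstar_form \<Omega> v \<phi> \<psi> = 1/2 * (conv_form \<Omega> v \<phi> \<psi> - conv_form \<Omega> v \<psi> \<phi>)"


section \<open>Discretization\<close>

definition fin_dim_subspace :: "'v::real_vector set \<Rightarrow> bool" where
  "fin_dim_subspace S \<longleftrightarrow> (\<exists>B. finite B \<and> S = span B)"

definition discrete_inf_sup ::
    "'n::finite point set \<Rightarrow> 'n vfield set \<Rightarrow> 'n sfield set \<Rightarrow> bool" where
  "discrete_inf_sup \<Omega> Xh Qh \<longleftrightarrow>
     (\<exists>\<beta>>0. \<forall>q\<in>Qh. \<beta> * norm q \<le> (SUP v\<in>Xh. (divergence \<Omega> v \<bullet> q) / norm (vgrad \<Omega> v)))"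

definition disc_div_free ::
    "'n::finite point set \<Rightarrow> 'n vfield set \<Rightarrow> 'n sfield set \<Rightarrow> 'n vfield set"
  where
  "disc_div_free \<Omega> Xh Qh = {v\<in>Xh. \<forall>q\<in>Qh. divergence \<Omega> v \<bullet> q = 0}"


section \<open>The Boussinesq solution operator\<close>

text \<open>The vector field \<open>\<langle>0, \<theta>\<rangle>\<^sup>T\<close>; the index type of the coordinates is linearly ordered in order
  to speak of the last one.\<close>

definition last_comp :: "'n::{finite,linorder} sfield \<Rightarrow> 'n vfield" where
  "last_comp \<theta> = axis (Max UNIV) \<theta>"

definition bouss_G ::
    "'n::{finite,linorder} point set \<Rightarrow> real \<Rightarrow> real \<Rightarrow> real \<Rightarrow>
     'n vfunctional \<Rightarrow> 'n functional \<Rightarrow>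
     'n vfield set \<Rightarrow> 'n sfield set \<Rightarrow>
     'n vfield \<times> 'n sfield \<Rightarrow> 'n vfield \<times> 'n sfield" where
  "bouss_G \<Omega> \<nu> \<kappa> Ri f \<gamma> Vh Wh = (\<lambda>(u, \<theta>). THE p. p \<in> Vh \<times> Wh \<and>
     (\<forall>v\<in>Vh. \<forall>\<zeta>\<in>Wh.
        b_form \<Omega> u (fst p) v + \<nu> * (vgrad \<Omega> (fst p) \<bullet> vgrad \<Omega> v)
          = Ri * (last_comp (snd p) \<bullet> v) + vpair f v \<and>
        bstar_form \<Omega> u (snd p) \<zeta> + \<kappa> * (grad \<Omega> (snd p) \<bullet> grad \<Omega> \<zeta>) = \<gamma> \<zeta>))"

definition bouss_G' ::
    "'n::{finite,linorder} point set \<Rightarrow> real \<Rightarrow> real \<Rightarrow> real \<Rightarrow>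
     'n vfunctional \<Rightarrow> 'n functional \<Rightarrow>
     'n vfield set \<Rightarrow> 'n sfield set \<Rightarrow>
     'n vfield \<times> 'n sfield \<Rightarrow> 'n vfield \<times> 'n sfield \<Rightarrow>
     'n vfield \<times> 'n sfield" where
  "bouss_G' \<Omega> \<nu> \<kappa> Ri f \<gamma> Vh Wh = (\<lambda>(u, \<theta>) (h, s).
     let G = bouss_G \<Omega> \<nu> \<kappa> Ri f \<gamma> Vh Wh (u, \<theta>) in
     THE p. p \<in> Vh \<times> Wh \<and>
     (\<forall>v\<in>Vh. \<forall>\<zeta>\<in>Wh.
        b_form \<Omega> h (fst G) v + b_form \<Omega> u (fst p) v + \<nu> * (vgrad \<Omega> (fst p) \<bullet> vgrad \<Omega> v)
          = Ri * (last_comp (snd p) \<bullet> v) \<and>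
        bstar_form \<Omega> h (snd G) \<zeta> + bstar_form \<Omega> u (snd p) \<zeta>
          + \<kappa> * (grad \<Omega> (snd p) \<bullet> grad \<Omega> \<zeta>) = 0))"

definition B_norm ::
    "'n::finite point set \<Rightarrow> real \<Rightarrow> real \<Rightarrow> 'n vfield \<times> 'n sfield \<Rightarrow> real" where
  "B_norm \<Omega> \<nu> \<kappa> = (\<lambda>(v, w). sqrt (\<nu> * (norm (vgrad \<Omega> v))\<^sup>2 + \<kappa> * (norm (grad \<Omega> w))\<^sup>2))"

text \<open>Frechet differentiability at \<open>p\<close> of a self-map \<open>F\<close> of the subspace \<open>D\<close>, normed by \<open>N\<close>.  The
  library's \<open>has_derivative\<close> is tied to the norm of the type and to maps on the whole type.\<close>

definition has_frechet_derivative_on ::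
    "('v::real_vector \<Rightarrow> real) \<Rightarrow> 'v set \<Rightarrow> ('v \<Rightarrow> 'v) \<Rightarrow> ('v \<Rightarrow> 'v) \<Rightarrow> 'v \<Rightarrow> bool" where
  "has_frechet_derivative_on N D F A p \<longleftrightarrow>
     (\<forall>h\<in>D. A h \<in> D) \<and>
     (\<forall>h\<in>D. \<forall>k\<in>D. A (h + k) = A h + A k) \<and>
     (\<forall>c. \<forall>h\<in>D. A (c *\<^sub>R h) = c *\<^sub>R A h) \<and>
     (\<exists>C. \<forall>h\<in>D. N (A h) \<le> C * N h) \<and>
     (\<forall>\<epsilon>>0. \<exists>\<delta>>0. \<forall>h\<in>D. N h < \<delta> \<longrightarrow> N (F (p + h) - F p - A h) \<le> \<epsilon> * N h)"

end

theory Submission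
  imports Defs
begin

text \<open>The discrete problem decouples: with the transporting velocity \<open>u\<close> frozen, the temperature and
  then the velocity solve linear equations whose forms are coercive because \<open>b\<close> and \<open>b\<^sup>*\<close> are skew in
  their last two arguments.  The differences \<open>G(p + h) - G(p)\<close>, the remainder
  \<open>G(p + h) - G(p) - G'(p; h)\<close> and \<open>G'(p + h; q) - G'(p; q)\<close> solve linear problems of the same kind,
  with right-hand sides that are bounded by the previous ones, so one a priori estimate yields all
  the bounds.

  The forms are trilinear only where their integrands are integrable.  This follows from
  \<open>H\<^sup>1\<^sub>0(\<Omega>) \<subseteq> L\<^sup>4\<close>, that is, from Ladyzhenskaya's inequality in dimension 2 or 3.  Linearity of the
  gradient, which is chosen by a definite description, rests on the fundamental lemma of the
  calculus of variations.\<close>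


section \<open>Representatives of square-integrable classes\<close>

text \<open>The integral of a non-integrable function is 0 in HOL, so a bound on the values of b and
  \<open>b\<^sup>*\<close> says nothing about integrability, and additivity of the forms cannot be
  read off from it; this is what forces an embedding theorem. As \<open>H10\<close> is a closure of
  test functions, it suffices to bound fourth powers of test functions by their H^1 norms and to
  pass to the limit with Fatou's lemma. Any finite constant will do there; the explicit C_G comes
  from the linear a priori estimate. The problems at p and p + h have different transporting
  velocities. Linearity of the forms in the first argument moves the difference to the right-hand
  side. Data of the form -b(h, x, .) result, where x is already estimated: x = G(p) gives first
  order in h, x = G(p + h) - G(p) gives second order, hence differentiability. G sees p only through
  its velocity, so only the velocity of the increments enters.\<close>

lemma sq_integrable_fun_of [simp, intro]: "sq_integrable (fun_of u)"
  using Quotient3_rep_reflp[OF Quotient3_L2, of u] by (simp add: fun_of_def)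

lemma fun_of_measurable [measurable]: "fun_of u \<in> borel_measurable lborel"
  using sq_integrable_fun_of[of u] by (simp add: sq_integrable_def)

lemma L2_eqI: "(AE x in lborel. fun_of u x = fun_of v x) \<Longrightarrow> u = v"
  using Quotient3_rel_rep[OF Quotient3_L2, of u v] sq_integrable_fun_of[of u] sq_integrable_fun_of[of v]
  by (simp add: fun_of_def)

lemma fun_of_class_of: "sq_integrable f \<Longrightarrow> AE x in lborel. fun_of (class_of f) x = f x"
  using rep_abs_rsp_left[OF Quotient3_L2, of f f] by (simp add: fun_of_def class_of_def)

lemma fun_of_zero: "AE x in lborel. fun_of 0 x = 0"
  using fun_of_class_of[OF sq_integrable_zero] by (simp add: zero_L2_def class_of_def)

text \<open>A choice of representatives need not respect sums pointwise, so identities between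
  representatives are used almost everywhere only.\<close>

lemma fun_of_add: "AE x in lborel. fun_of (u + v) x = fun_of u x + fun_of v x"
  using fun_of_class_of[OF sq_integrable_add[OF sq_integrable_fun_of sq_integrable_fun_of, of u v]]
  by (simp add: plus_L2_def class_of_def fun_of_def)

lemma fun_of_scaleR: "AE x in lborel. fun_of (c *\<^sub>R u) x = c * fun_of u x"
  using fun_of_class_of[OF sq_integrable_scale[OF sq_integrable_fun_of, of c u]]
  by (simp add: scaleR_L2_def class_of_def fun_of_def)

lemma fun_of_diff: "AE x in lborel. fun_of (u - v) x = fun_of u x - fun_of v x"
  using fun_of_add[of "u - v" v] by auto

lemma inner_L2_eq: "u \<bullet> v = (LINT x|lborel. fun_of u x * fun_of v x)"
  by (simp add: inner_L2_def fun_of_def)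

lemma norm_L2_sq: "(norm u)\<^sup>2 = (LINT x|lborel. (fun_of u x)\<^sup>2)"
  unfolding power2_norm_eq_inner inner_L2_eq by (simp add: power2_eq_square)


section \<open>The fundamental lemma of the calculus of variations\<close>

text \<open>For m = 0 this is the classical smooth, non-analytic function. The powers of t in the
  denominator make the family closed under differentiation up to linear combinations.\<close>

definition flat :: "nat \<Rightarrow> real \<Rightarrow> real" where
  "flat m t = (if t > 0 then exp (- 1 / t) / t ^ m else 0)"

text \<open>With s = 1 / t the limit from the right is that of s^m / exp s at infinity.\<close>

lemma flat_tendsto_0: "(flat m \<longlongrightarrow> 0) (at 0)"
proof (rule filterlim_split_at)
  have "\<forall>\<^sub>F t in at_left 0. flat m t = 0"
    by (auto simp: eventually_at_filter flat_def)
  then show "(flat m \<longlongrightarrow> 0) (at_left 0)" by (rule tendsto_eventually)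
  have "((\<lambda>t. inverse t ^ m / exp (inverse t)) \<longlongrightarrow> 0) (at_right (0::real))"
    by (rule filterlim_compose[OF tendsto_power_div_exp_0 filterlim_inverse_at_top_right])
  moreover have "\<forall>\<^sub>F t in at_right 0. inverse t ^ m / exp (inverse t) = flat m t"
    by (auto simp: eventually_at_filter flat_def exp_minus field_simps)
  ultimately show "(flat m \<longlongrightarrow> 0) (at_right 0)"
    by (simp add: tendsto_cong)
qed

lemma flat_has_derivative:
  "(flat m has_real_derivative flat (m + 2) t - real m * flat (m + 1) t) (at t)"
proof -
  consider "t > 0" | "t < 0" | "t = 0" by linarith
  then show ?thesis
  proof cases
    case 1
    have "((\<lambda>t. exp (- 1 / t) / t ^ m) has_real_derivative
        (exp (- 1 / t) * (1 / t\<^sup>2) * t ^ m - exp (- 1 / t) * (real m * t ^ (m - 1)))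
          / (t ^ m * t ^ m)) (at t)"
      using 1 by (auto intro!: derivative_eq_intros simp: power2_eq_square)
    also have "(exp (- 1 / t) * (1 / t\<^sup>2) * t ^ m - exp (- 1 / t) * (real m * t ^ (m - 1)))
          / (t ^ m * t ^ m) = flat (m + 2) t - real m * flat (m + 1) t"
      using 1 by (cases m) (auto simp: flat_def field_simps power2_eq_square)
    finally have "((\<lambda>t. exp (- 1 / t) / t ^ m) has_real_derivative
        flat (m + 2) t - real m * flat (m + 1) t) (at t)" .
    moreover have "\<forall>\<^sub>F s in nhds t. exp (- 1 / s) / s ^ m = flat m s"
      using 1 by (auto simp: flat_def eventually_nhds intro!: exI[of _ "{0<..}"])
    ultimately show ?thesis by (subst (asm) DERIV_cong_ev) auto
  next
    case 2
    have "\<forall>\<^sub>F s in nhds t. flat m s = 0"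
      using 2 by (auto simp: flat_def eventually_nhds intro!: exI[of _ "{..<0}"])
    then show ?thesis using 2 by (subst DERIV_cong_ev[OF refl _ refl]) (auto simp: flat_def)
  next
    case 3
    \<comment> \<open>The difference quotient of \<open>flat m\<close> at 0 is
      \<open>flat (m + 1)\<close>, so its limit is already known.\<close>
    have "((\<lambda>h. (flat m (0 + h) - flat m 0) / h) \<longlongrightarrow> 0) (at 0)"
      by (rule tendsto_cong[THEN iffD1, OF _ flat_tendsto_0[of "m + 1"]])
        (auto simp: flat_def eventually_at_filter)
    then show ?thesis using 3 by (simp add: DERIV_def flat_def)
  qed
qed

text \<open>An algebra closed under partial differentiation, so all its members are smooth.\<close>

inductive_set flat_algebra :: "(real^'n::finite \<Rightarrow> real) set" where
  const: "(\<lambda>x. c) \<in> flat_algebra"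
| flat: "(\<lambda>x. flat m (c * (x $ i) + d)) \<in> flat_algebra"
| add: "f \<in> flat_algebra \<Longrightarrow> g \<in> flat_algebra \<Longrightarrow> (\<lambda>x. f x + g x) \<in> flat_algebra"
| mult: "f \<in> flat_algebra \<Longrightarrow> g \<in> flat_algebra \<Longrightarrow> (\<lambda>x. f x * g x) \<in> flat_algebra"

lemma flat_algebra_derivative:
  fixes f :: "real^'n::finite \<Rightarrow> real"
  assumes "f \<in> flat_algebra"
  shows "\<exists>f'. (\<forall>x. (f has_derivative f' x) (at x)) \<and> (\<forall>v. (\<lambda>x. f' x v) \<in> flat_algebra)"
  using assms
proof induction
  case (const c)
  show ?case by (rule exI[of _ "\<lambda>x v. 0"]) (auto intro: flat_algebra.const)
next
  case (flat m c i d)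
  let ?D = "\<lambda>x :: real^'n. flat (m + 2) (c * (x $ i) + d) - real m * flat (m + 1) (c * (x $ i) + d)"
  show ?case
  proof (rule exI[of _ "\<lambda>x v. ?D x * (c * (v $ i))"], intro conjI allI)
    fix x :: "real^'n"
    have "((\<lambda>x :: real^'n. c * (x $ i) + d) has_derivative (\<lambda>v. c * (v $ i))) (at x)"
      by (auto intro!: derivative_eq_intros bounded_linear_imp_has_derivative bounded_linear_vec_nth)
    from has_derivative_compose[OF this flat_has_derivative[THEN has_field_derivative_imp_has_derivative]]
    show "((\<lambda>x. flat m (c * (x $ i) + d)) has_derivative (\<lambda>v. ?D x * (c * (v $ i)))) (at x)" .
  next
    fix v :: "real^'n"
    have "(\<lambda>x. (flat (m + 2) (c * (x $ i) + d) + (- real m) * flat (m + 1) (c * (x $ i) + d))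
        * (c * (v $ i))) \<in> flat_algebra"
      by (intro flat_algebra.intros)
    then show "(\<lambda>x. ?D x * (c * (v $ i))) \<in> flat_algebra" by simp
  qed
next
  case (add f g)
  then obtain f' g' where "\<And>x. (f has_derivative f' x) (at x)" "\<And>v. (\<lambda>x. f' x v) \<in> flat_algebra"
    "\<And>x. (g has_derivative g' x) (at x)" "\<And>v. (\<lambda>x. g' x v) \<in> flat_algebra" by blast
  then show ?case
    by (intro exI[of _ "\<lambda>x v. f' x v + g' x v"])
      (auto intro!: derivative_eq_intros flat_algebra.intros)
next
  case (mult f g)
  then obtain f' g' where "\<And>x. (f has_derivative f' x) (at x)" "\<And>v. (\<lambda>x. f' x v) \<in> flat_algebra"
    "\<And>x. (g has_derivative g' x) (at x)" "\<And>v. (\<lambda>x. g' x v) \<in> flat_algebra" by blast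
  then show ?case
    using mult.hyps
    by (intro exI[of _ "\<lambda>x v. f x * g' x v + f' x v * g x"])
      (auto intro!: has_derivative_mult flat_algebra.intros)
qed

text \<open>Induction on the order, for all members at once: directional derivatives stay in the
  algebra, so the hypothesis applies to them.\<close>

lemma flat_algebra_smooth:
  assumes "f \<in> flat_algebra" shows "smooth_on U f"
proof -
  have "Ck_on k U f" for k
    using assms
  proof (induction k arbitrary: f)
    case 0
    then obtain f' where "\<And>x. (f has_derivative f' x) (at x)"
      using flat_algebra_derivative by blast
    then have "continuous_on U f"
      by (intro continuous_at_imp_continuous_on ballI has_derivative_continuous)
    then show ?case by simp
  next
    case (Suc k)
    then obtain f' where f': "\<And>x. (f has_derivative f' x) (at x)" "\<And>v. (\<lambda>x. f' x v) \<in> flat_algebra"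
      using flat_algebra_derivative by blast
    then have "frechet_derivative f (at x) = f' x" for x
      by (metis frechet_derivative_at)
    then show ?case using f' Suc.IH by (auto simp: differentiable_def)
  qed
  then show ?thesis by (simp add: smooth_on_def)
qed

section \<open>Smooth bumps approximating the indicator of a box\<close>

lemma flat_algebra_prod:
  "finite I \<Longrightarrow> (\<And>i. i \<in> I \<Longrightarrow> f i \<in> flat_algebra) \<Longrightarrow> (\<lambda>x. \<Prod>i\<in>I. f i x) \<in> flat_algebra"
  by (induction rule: finite_induct) (auto intro: flat_algebra.intros)

text \<open>The factor n steepens the edges: inside the box every argument of \<open>flat 0\<close>
  tends to infinity and the product to 1, while outside one factor is 0 for every n.\<close>

definition box_bump :: "real^'n \<Rightarrow> real^'n \<Rightarrow> nat \<Rightarrow> real^'n::finite \<Rightarrow> real" where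
  "box_bump a b n x = (\<Prod>i\<in>UNIV. flat 0 (real n * (x $ i - a $ i)) * flat 0 (real n * (b $ i - x $ i)))"

lemma flat0_bounds: "0 \<le> flat 0 t" "flat 0 t \<le> 1"
  by (auto simp: flat_def)

lemma box_bump_bounds: "0 \<le> box_bump a b n x" "box_bump a b n x \<le> 1"
  unfolding box_bump_def
  by (auto intro!: prod_nonneg prod_le_1 mult_nonneg_nonneg mult_le_one simp: flat0_bounds)

lemma box_bump_outside:
  assumes "x \<notin> box a b" shows "box_bump a b n x = 0"
proof -
  from assms obtain i where "\<not> (a $ i < x $ i \<and> x $ i < b $ i)" by (auto simp: mem_box_cart)
  then have "real n * (x $ i - a $ i) \<le> 0 \<or> real n * (b $ i - x $ i) \<le> 0"
    by (auto simp: mult_le_0_iff)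
  then have "flat 0 (real n * (x $ i - a $ i)) * flat 0 (real n * (b $ i - x $ i)) = 0"
    by (auto simp: flat_def)
  then show ?thesis unfolding box_bump_def by (intro prod_zero) auto
qed

lemma box_bump_smooth: "smooth_on U (box_bump a b n)"
proof -
  have "(\<lambda>x. \<Prod>i\<in>UNIV. flat 0 (real n * (x $ i) + - real n * (a $ i))
      * flat 0 (- real n * (x $ i) + real n * (b $ i))) \<in> flat_algebra"
    by (intro flat_algebra_prod flat_algebra.mult flat_algebra.flat) auto
  also have "(\<lambda>x. \<Prod>i\<in>UNIV. flat 0 (real n * (x $ i) + - real n * (a $ i))
      * flat 0 (- real n * (x $ i) + real n * (b $ i))) = box_bump a b n"
    by (auto simp: box_bump_def fun_eq_iff algebra_simps)
  finally show ?thesis by (rule flat_algebra_smooth)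
qed

lemma box_bump_test: "cbox a b \<subseteq> \<Omega> \<Longrightarrow> box_bump a b n \<in> test_functions \<Omega>"
  unfolding test_functions_def
  using box_bump_smooth
  by (auto intro!: exI[of _ "cbox a b"] box_bump_outside dest: box_subset_cbox[THEN subsetD])

lemma flat0_tendsto: "t > 0 \<Longrightarrow> (\<lambda>n. flat 0 (real n * t)) \<longlonglongrightarrow> 1"
proof -
  assume t: "t > 0"
  have "(\<lambda>n. exp (- (1 / t) * (1 / real n))) \<longlonglongrightarrow> exp (- (1 / t) * 0)"
    by (intro tendsto_intros lim_1_over_n)
  \<comment> \<open>The two sides differ at n = 0, where 1 / 0 = 0 makes the left one 1 and the
    right one 0.\<close>
  moreover have "\<forall>\<^sub>F n in sequentially. exp (- (1 / t) * (1 / real n)) = flat 0 (real n * t)"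
    using eventually_gt_at_top[of 0] by eventually_elim (use t in \<open>auto simp: flat_def field_simps\<close>)
  ultimately show ?thesis by (simp add: tendsto_cong)
qed

lemma box_bump_tendsto: "(\<lambda>n. box_bump a b n x) \<longlonglongrightarrow> indicator (box a b) x"
proof (cases "x \<in> box a b")
  case True
  then have "(\<lambda>n. box_bump a b n x) \<longlonglongrightarrow> (\<Prod>i\<in>(UNIV::'a set). 1 * 1)"
    unfolding box_bump_def by (intro tendsto_intros flat0_tendsto) (auto simp: mem_box_cart)
  then show ?thesis using True by simp
qed (simp add: box_bump_outside)

lemma box_bump_measurable [measurable]: "box_bump a b n \<in> borel_measurable borel"
proof -
  have "Ck_on 0 UNIV (box_bump a b n)" using box_bump_smooth unfolding smooth_on_def by blast
  then show ?thesis by (auto intro: borel_measurable_continuous_onI)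
qed

section \<open>From vanishing integrals to vanishing almost everywhere\<close>

lemma sq_integrable_indicator_box: "sq_integrable (indicator (box a b))"
  by (auto simp: sq_integrable_def power2_eq_square simp flip: indicator_inter_arith
      intro!: integrable_real_indicator emeasure_bounded_finite bounded_box)

lemma integrable_on_box:
  assumes "sq_integrable d" shows "integrable lborel (\<lambda>x. indicator (box a b) x * d x)"
  using sq_integrable_mult[OF sq_integrable_indicator_box assms] .

text \<open>The indicator of a box is not a test function, but it is a limit of bumps that are.
  Dominated convergence applies with |d| cut off to the box as majorant.\<close>

lemma integral_box_eq_0:
  fixes d :: "real^'n::finite \<Rightarrow> real"
  assumes d: "sq_integrable d"
    and zero: "\<And>\<phi>. \<phi> \<in> test_functions \<Omega> \<Longrightarrow> (LINT x:\<Omega>|lborel. d x * \<phi> x) = 0"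
    and sub: "cbox a b \<subseteq> \<Omega>"
  shows "(LINT x|lborel. indicator (box a b) x * d x) = 0"
proof -
  have [measurable]: "d \<in> borel_measurable borel" using d by (simp add: sq_integrable_def)
  have "(\<lambda>n. LINT x|lborel. box_bump a b n x * d x) \<longlonglongrightarrow> (LINT x|lborel. indicator (box a b) x * d x)"
  proof (rule integral_dominated_convergence[where w="\<lambda>x. norm (indicator (box a b) x * d x)"])
    show "integrable lborel (\<lambda>x. norm (indicator (box a b) x * d x))"
      using integrable_on_box[OF d] by (rule integrable_norm)
    show "AE x in lborel. (\<lambda>n. box_bump a b n x * d x) \<longlonglongrightarrow> indicator (box a b) x * d x"
      by (intro AE_I2 tendsto_intros box_bump_tendsto)
    show "AE x in lborel. norm (box_bump a b n x * d x) \<le> norm (indicator (box a b) x * d x)" for n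
      using box_bump_bounds[of a b n] box_bump_outside[of _ a b n]
      by (intro AE_I2) (auto simp: abs_mult indicator_def intro: mult_left_le_one_le)
  qed measurable
  moreover have "(LINT x|lborel. box_bump a b n x * d x) = 0" for n
  proof -
    \<comment> \<open>The bump vanishes outside \<Omega>, so integrating over \<Omega> or over the
      whole space is the same.\<close>
    have eq: "indicator \<Omega> x * (d x * box_bump a b n x) = box_bump a b n x * d x" for x
      using box_bump_outside[of x a b n] sub box_subset_cbox[of a b] by (cases "x \<in> \<Omega>") auto
    show ?thesis
      using zero[OF box_bump_test[OF sub, of n]]
      unfolding set_lebesgue_integral_def real_scaleR_def eq .
  qed
  ultimately show ?thesis by (simp add: LIMSEQ_const_iff)
qed

text \<open>A Dynkin argument: boxes generate the Borel sets and are stable under intersection, so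
  the integral vanishes over every Borel set; the total integral handles complements. Then f and 0
  are densities of the same set function.\<close>

lemma AE_zero_if_box_integrals_zero:
  fixes f :: "'a::euclidean_space \<Rightarrow> real"
  assumes f: "integrable lborel f"
    and total: "(LINT x|lborel. f x) = 0"
    and boxes: "\<And>a b. (LINT x:box a b|lborel. f x) = 0"
  shows "AE x in lborel. f x = 0"
proof (rule density_unique_real[OF f])
  fix A :: "'a set" assume "A \<in> sets lborel"
  then have A: "A \<in> sigma_sets UNIV (range (\<lambda>(a, b). box a b))"
    by (simp add: borel_eq_box)
  have stable: "Int_stable (range (\<lambda>(a, b :: 'a). box a b))"
    by (auto simp: Int_stable_def box_Int_box)
  have "(LINT x:A|lborel. f x) = 0"
  proof (rule sigma_sets_induct_disjoint[OF stable _ A], goal_cases)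
    case (4 A)
    then have [measurable]: "A \<in> sets borel" by (simp add: borel_eq_box)
    have "set_integrable lborel B f" if "B \<in> sets borel" for B
      unfolding set_integrable_def using that f by (intro integrable_mult_indicator) auto
    from this[of A] this[of "- A"] have "(LINT x:A \<union> - A|lborel. f x) = (LINT x:A|lborel. f x) + (LINT x:- A|lborel. f x)"
      by (intro set_integral_Un) auto
    then show ?case
      using 4(2) total by (simp add: Compl_eq_Diff_UNIV set_lebesgue_integral_def)
  next
    case (5 A)
    then have [measurable]: "A i \<in> sets borel" for i by (auto simp: borel_eq_box)
    have "set_integrable lborel (\<Union>i. A i) f"
      unfolding set_integrable_def using f by (intro integrable_mult_indicator) auto
    then show ?case
      using 5 by (subst lebesgue_integral_countable_add) (auto simp: disjoint_family_on_def)
  qed (auto simp: boxes[unfolded set_lebesgue_integral_def real_scaleR_def] set_lebesgue_integral_def)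
  then show "(LINT x:A|lborel. f x) = (LINT x:A|lborel. 0)"
    by (simp add: set_lebesgue_integral_def)
qed simp

text \<open>An open set is a countable union of closed boxes, so it suffices to work on one box
  inside \<Omega>, where bumps are available.\<close>

lemma fundamental_lemma_of_variations:
  fixes d :: "real^'n::finite \<Rightarrow> real"
  assumes "open \<Omega>" and d: "sq_integrable d"
    and zero: "\<And>\<phi>. \<phi> \<in> test_functions \<Omega> \<Longrightarrow> (LINT x:\<Omega>|lborel. d x * \<phi> x) = 0"
  shows "AE x in lborel. x \<in> \<Omega> \<longrightarrow> d x = 0"
proof -
  have box0: "AE x in lborel. x \<in> box a b \<longrightarrow> d x = 0" if "cbox a b \<subseteq> \<Omega>" for a b
  proof -
    have eq: "indicator (box p q) x *\<^sub>R (indicator (box a b) x * d x)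
        = indicator (box p q \<inter> box a b) x * d x" for p q x
      by (simp add: indicator_inter_arith)
    \<comment> \<open>Cutting d off to the box makes it integrable. Integrals of the cut-off
      function over another box are integrals of d over the intersection, again a box inside
      \<Omega>.\<close>
    have "AE x in lborel. indicator (box a b) x * d x = 0"
    proof (rule AE_zero_if_box_integrals_zero)
      fix p q :: "real^'n"
      define p' q' :: "real^'n" where "p' = (\<Sum>i\<in>Basis. max (p \<bullet> i) (a \<bullet> i) *\<^sub>R i)"
        and "q' = (\<Sum>i\<in>Basis. min (q \<bullet> i) (b \<bullet> i) *\<^sub>R i)"
      have i: "box p q \<inter> box a b = box p' q'" unfolding box_Int_box p'_def q'_def ..
      have "cbox p' q' \<subseteq> cbox a b" by (auto simp: mem_box p'_def q'_def)
      then have "cbox p' q' \<subseteq> \<Omega>" using that by simp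
      from integral_box_eq_0[OF d zero this]
      show "(LINT x:box p q|lborel. indicator (box a b) x * d x) = 0"
        unfolding set_lebesgue_integral_def eq i by simp
    qed (use integrable_on_box[OF d] integral_box_eq_0[OF d zero that] in auto)
    then show ?thesis by eventually_elim (auto simp: indicator_def)
  qed
  obtain \<D> where \<D>: "countable \<D>" "\<D> \<subseteq> Pow \<Omega>" "\<And>X. X \<in> \<D> \<Longrightarrow> \<exists>a b. X = cbox a b" "\<Union>\<D> = \<Omega>"
    using open_countable_Union_open_cbox[OF \<open>open \<Omega>\<close>] by metis
  have "AE x in lborel. x \<in> X \<longrightarrow> d x = 0" if X: "X \<in> \<D>" for X
  proof -
    obtain a b where ab: "X = cbox a b" using \<D>(3)[OF X] by blast
    have "cbox a b \<subseteq> \<Omega>" using \<D>(2) X ab by auto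
    \<comment> \<open>The cover consists of closed boxes, the bumps detect open ones; the faces form
      a null set.\<close>
    moreover have "AE x in lborel. x \<notin> cbox a b - box a b"
      using negligible_frontier_interval[of a b]
      by (intro AE_not_in) (simp add: negligible_iff_null_sets null_sets_completion_iff)
    ultimately show ?thesis using box0[of a b] unfolding ab by (auto elim!: AE_mp)
  qed
  then have "AE x in lborel. \<forall>X\<in>\<D>. x \<in> X \<longrightarrow> d x = 0"
    by (subst AE_ball_countable[OF \<D>(1)]) blast
  then show ?thesis using \<D>(4) by (auto elim!: AE_mp)
qed


section \<open>Weak gradients\<close>

lemma test_function_has_derivative:
  assumes "\<phi> \<in> test_functions \<Omega>"
  shows "(\<phi> has_derivative frechet_derivative \<phi> (at x)) (at x)"
proof -
  have "Ck_on 1 UNIV \<phi>" using assms by (auto simp: test_functions_def smooth_on_def)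
  then have "\<phi> differentiable (at x)" by simp
  then show ?thesis by (simp add: frechet_derivative_works)
qed

lemma test_function_continuous:
  assumes "\<phi> \<in> test_functions \<Omega>" shows "continuous_on A \<phi>"
  using has_derivative_continuous[OF test_function_has_derivative[OF assms]]
  by (intro continuous_at_imp_continuous_on) auto

lemma partial_deriv_continuous:
  assumes "\<phi> \<in> test_functions \<Omega>" shows "continuous_on A (partial_deriv i \<phi>)"
proof -
  have "Ck_on (Suc 0) UNIV \<phi>" using assms unfolding test_functions_def smooth_on_def by blast
  then have "continuous_on UNIV (partial_deriv i \<phi>)"
    unfolding partial_deriv_def by simp
  then show ?thesis by (rule continuous_on_subset) simp
qed

text \<open>The complement of K is open and \<phi> is constantly 0 on it, so one K serves \<phi> and
  all its derivatives.\<close>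

lemma test_function_support:
  fixes \<phi> :: "real^'n::finite \<Rightarrow> real"
  assumes "\<phi> \<in> test_functions \<Omega>"
  obtains K where "compact K" "K \<subseteq> \<Omega>" "\<And>x. x \<notin> K \<Longrightarrow> \<phi> x = 0"
    "\<And>x i. x \<notin> K \<Longrightarrow> partial_deriv i \<phi> x = 0"
proof -
  obtain K where K: "compact K" "K \<subseteq> \<Omega>" "\<And>x. x \<notin> K \<Longrightarrow> \<phi> x = 0"
    using assms by (auto simp: test_functions_def)
  have "partial_deriv i \<phi> x = 0" if "x \<notin> K" for x i
  proof -
    have "open (- K)" "x \<in> - K" using K that by (auto intro: compact_imp_closed)
    then have "(\<phi> has_derivative (\<lambda>_. 0)) (at x)"
      by (rule has_derivative_transform_within_open[OF has_derivative_const[of 0]]) (use K in auto)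
    then have "frechet_derivative \<phi> (at x) = (\<lambda>_. 0)" by (rule frechet_derivative_at[symmetric])
    then show ?thesis by (simp add: partial_deriv_def)
  qed
  with K show thesis by (rule that)
qed

lemma sq_integrable_compact_support:
  fixes f :: "'a::euclidean_space \<Rightarrow> real"
  assumes "compact K" "continuous_on UNIV f" "\<And>x. x \<notin> K \<Longrightarrow> f x = 0"
  shows "sq_integrable f"
proof -
  have "continuous_on K (\<lambda>x. (f x)\<^sup>2)"
    using assms by (intro continuous_intros continuous_on_subset[OF assms(2)]) auto
  from borel_integrable_compact[OF assms(1) this]
  have "integrable lborel (\<lambda>x. indicator K x *\<^sub>R (f x)\<^sup>2)" .
  also have "(\<lambda>x. indicator K x *\<^sub>R (f x)\<^sup>2) = (\<lambda>x. (f x)\<^sup>2)"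
    using assms(3) by (auto simp: indicator_def fun_eq_iff)
  finally show ?thesis
    using borel_measurable_continuous_onI[OF assms(2)] by (simp add: sq_integrable_def)
qed

lemma sq_integrable_test_function:
  fixes \<phi> :: "real^'n::finite \<Rightarrow> real"
  assumes "\<phi> \<in> test_functions \<Omega>"
  shows "sq_integrable \<phi>" "sq_integrable (partial_deriv i \<phi>)"
  using test_function_support[OF assms] sq_integrable_compact_support
    test_function_continuous[OF assms] partial_deriv_continuous[OF assms] by metis+

section \<open>Linearity and uniqueness of weak gradients\<close>

lemma L2_on_add: "u \<in> L2_on \<Omega> \<Longrightarrow> v \<in> L2_on \<Omega> \<Longrightarrow> u + v \<in> L2_on \<Omega>"
  using fun_of_add[of u v] unfolding L2_on_def by auto

lemma L2_on_scaleR: "u \<in> L2_on \<Omega> \<Longrightarrow> c *\<^sub>R u \<in> L2_on \<Omega>"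
  using fun_of_scaleR[of c u] unfolding L2_on_def by auto

lemma set_integral_fun_of_add:
  assumes [measurable]: "\<Omega> \<in> sets borel" and \<psi>: "sq_integrable \<psi>"
  shows "(LINT x:\<Omega>|lborel. fun_of (u + v) x * \<psi> x)
    = (LINT x:\<Omega>|lborel. fun_of u x * \<psi> x) + (LINT x:\<Omega>|lborel. fun_of v x * \<psi> x)"
proof -
  have [measurable]: "\<psi> \<in> borel_measurable borel" using \<psi> by (simp add: sq_integrable_def)
  have "(LINT x:\<Omega>|lborel. fun_of (u + v) x * \<psi> x)
      = (LINT x:\<Omega>|lborel. fun_of u x * \<psi> x + fun_of v x * \<psi> x)"
    unfolding set_lebesgue_integral_def using fun_of_add[of u v]
    by (intro integral_cong_AE) (auto simp: algebra_simps)
  also have "\<dots> = (LINT x:\<Omega>|lborel. fun_of u x * \<psi> x) + (LINT x:\<Omega>|lborel. fun_of v x * \<psi> x)"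
    by (intro set_integral_add)
      (auto simp: set_integrable_def intro!: integrable_mult_indicator sq_integrable_mult \<psi>
        simp del: real_scaleR_def)
  finally show ?thesis .
qed

lemma set_integral_fun_of_scaleR:
  assumes [measurable]: "\<Omega> \<in> sets borel" and \<psi>: "sq_integrable \<psi>"
  shows "(LINT x:\<Omega>|lborel. fun_of (c *\<^sub>R u) x * \<psi> x) = c * (LINT x:\<Omega>|lborel. fun_of u x * \<psi> x)"
proof -
  have [measurable]: "\<psi> \<in> borel_measurable borel" using \<psi> by (simp add: sq_integrable_def)
  have "(LINT x:\<Omega>|lborel. fun_of (c *\<^sub>R u) x * \<psi> x) = (LINT x:\<Omega>|lborel. c * (fun_of u x * \<psi> x))"
    unfolding set_lebesgue_integral_def using fun_of_scaleR[of c u]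
    by (intro integral_cong_AE) (auto simp: algebra_simps)
  then show ?thesis by simp
qed

lemma is_weak_grad_add:
  assumes "\<Omega> \<in> sets borel" "is_weak_grad \<Omega> u g" "is_weak_grad \<Omega> v k"
  shows "is_weak_grad \<Omega> (u + v) (g + k)"
  using assms unfolding is_weak_grad_def
  by (auto simp: L2_on_add set_integral_fun_of_add sq_integrable_test_function)

lemma is_weak_grad_scaleR:
  assumes "\<Omega> \<in> sets borel" "is_weak_grad \<Omega> u g"
  shows "is_weak_grad \<Omega> (c *\<^sub>R u) (c *\<^sub>R g)"
  using assms unfolding is_weak_grad_def
  by (auto simp: L2_on_scaleR set_integral_fun_of_scaleR sq_integrable_test_function)

text \<open>The difference is a weak gradient of 0. Inside \<Omega> it vanishes by the fundamental
  lemma, outside because weak gradients are extended by zero.\<close>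

lemma is_weak_grad_unique:
  fixes g k :: "'n::finite vfield"
  assumes \<Omega>: "open \<Omega>" and g: "is_weak_grad \<Omega> u g" and k: "is_weak_grad \<Omega> u k"
  shows "g = k"
proof -
  have B: "\<Omega> \<in> sets borel" using \<Omega> by simp
  let ?d = "g - k"
  have d: "is_weak_grad \<Omega> 0 ?d"
    using is_weak_grad_add[OF B g is_weak_grad_scaleR[OF B k, of "-1"]] by simp
  have "?d $ i = 0" for i
  proof (rule L2_eqI)
    have "AE x in lborel. x \<in> \<Omega> \<longrightarrow> fun_of (?d $ i) x = 0"
    proof (rule fundamental_lemma_of_variations[OF \<Omega>])
      fix \<phi> :: "real^'n \<Rightarrow> real" assume \<phi>: "\<phi> \<in> test_functions \<Omega>"
      have "(LINT x:\<Omega>|lborel. fun_of 0 x * partial_deriv i \<phi> x) = 0"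
        using set_integral_fun_of_scaleR[OF B sq_integrable_test_function(2)[OF \<phi>], of 0 0] by simp
      then show "(LINT x:\<Omega>|lborel. fun_of (?d $ i) x * \<phi> x) = 0"
        using d \<phi> by (auto simp: is_weak_grad_def)
    qed auto
    moreover have "AE x in lborel. x \<notin> \<Omega> \<longrightarrow> fun_of (?d $ i) x = 0"
      using d by (auto simp: is_weak_grad_def L2_on_def)
    ultimately show "AE x in lborel. fun_of (?d $ i) x = fun_of 0 x"
      using fun_of_zero by eventually_elim auto
  qed
  then have "?d = 0" by (simp add: vec_eq_iff)
  then show ?thesis by simp
qed

lemma grad_eqI: "open \<Omega> \<Longrightarrow> is_weak_grad \<Omega> u g \<Longrightarrow> grad \<Omega> u = g"
  unfolding grad_def by (rule the_equality) (auto intro: is_weak_grad_unique)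

lemma is_weak_grad_grad: "open \<Omega> \<Longrightarrow> u \<in> H1 \<Omega> \<Longrightarrow> is_weak_grad \<Omega> u (grad \<Omega> u)"
  by (auto simp: H1_def grad_eqI)

lemma grad_add:
  assumes "open \<Omega>" "u \<in> H1 \<Omega>" "v \<in> H1 \<Omega>"
  shows "grad \<Omega> (u + v) = grad \<Omega> u + grad \<Omega> v"
  using assms by (intro grad_eqI is_weak_grad_add is_weak_grad_grad) auto

lemma grad_scaleR:
  assumes "open \<Omega>" "u \<in> H1 \<Omega>"
  shows "grad \<Omega> (c *\<^sub>R u) = c *\<^sub>R grad \<Omega> u"
  using assms by (intro grad_eqI is_weak_grad_scaleR is_weak_grad_grad) auto

lemma H10_imp_H1: "u \<in> H10 \<Omega> \<Longrightarrow> u \<in> H1 \<Omega>"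
  by (simp add: H10_def)


section \<open>Ladyzhenskaya's inequality\<close>

lemma nn_integral_lborel_pair:
  fixes F :: "'a::euclidean_space \<times> 'b::euclidean_space \<Rightarrow> ennreal"
  assumes "F \<in> borel_measurable borel"
  shows "(\<integral>\<^sup>+p. F p \<partial>lborel) = (\<integral>\<^sup>+x. \<integral>\<^sup>+y. F (x, y) \<partial>lborel \<partial>lborel)"
    and "(\<integral>\<^sup>+p. F p \<partial>lborel) = (\<integral>\<^sup>+y. \<integral>\<^sup>+x. F (x, y) \<partial>lborel \<partial>lborel)"
proof -
  have F: "F \<in> borel_measurable (lborel \<Otimes>\<^sub>M lborel)" using assms by (simp add: lborel_prod)
  show "(\<integral>\<^sup>+p. F p \<partial>lborel) = (\<integral>\<^sup>+x. \<integral>\<^sup>+y. F (x, y) \<partial>lborel \<partial>lborel)"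
    unfolding lborel.nn_integral_fst[OF F] lborel_prod ..
  show "(\<integral>\<^sup>+p. F p \<partial>lborel) = (\<integral>\<^sup>+y. \<integral>\<^sup>+x. F (x, y) \<partial>lborel \<partial>lborel)"
    unfolding lborel_pair.nn_integral_snd[OF F] lborel_prod ..
qed

text \<open>The first bound depends on y alone and the second on x alone. Hence
  \<open>(P p)\<^sup>2\<close> lies below a product in separate variables, whose integral factors by
  Tonelli.\<close>

lemma slices_bound_2d:
  fixes P h1 h2 :: "real \<times> real \<Rightarrow> ennreal"
  assumes [measurable]: "h1 \<in> borel_measurable borel" "h2 \<in> borel_measurable borel"
    and 1: "\<And>x y. P (x, y) \<le> (\<integral>\<^sup>+t. h1 (t, y) \<partial>lborel)"
    and 2: "\<And>x y. P (x, y) \<le> (\<integral>\<^sup>+t. h2 (x, t) \<partial>lborel)"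
  shows "(\<integral>\<^sup>+p. (P p)\<^sup>2 \<partial>lborel) \<le> (\<integral>\<^sup>+p. h1 p \<partial>lborel) * (\<integral>\<^sup>+p. h2 p \<partial>lborel)"
proof -
  have [measurable]: "h1 \<in> borel_measurable (lborel \<Otimes>\<^sub>M lborel)" "h2 \<in> borel_measurable (lborel \<Otimes>\<^sub>M lborel)"
    by (simp_all add: lborel_prod)
  define A where "A y = (\<integral>\<^sup>+t. h1 (t, y) \<partial>lborel)" for y
  define B where "B x = (\<integral>\<^sup>+t. h2 (x, t) \<partial>lborel)" for x
  have [measurable]: "A \<in> borel_measurable lborel" "B \<in> borel_measurable lborel"
    unfolding A_def B_def by measurable
  have "(\<integral>\<^sup>+p. (P p)\<^sup>2 \<partial>lborel) \<le> (\<integral>\<^sup>+p. B (fst p) * A (snd p) \<partial>lborel)"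
  proof (rule nn_integral_mono)
    fix p :: "real \<times> real"
    show "(P p)\<^sup>2 \<le> B (fst p) * A (snd p)"
      using mult_mono[OF 2[of "fst p" "snd p"] 1[of "fst p" "snd p"]]
      by (simp add: A_def B_def power2_eq_square)
  qed
  also have "\<dots> = (\<integral>\<^sup>+p. B (fst p) * A (snd p) \<partial>(lborel \<Otimes>\<^sub>M lborel))"
    by (simp add: lborel_prod)
  also have "\<dots> = (\<integral>\<^sup>+x. \<integral>\<^sup>+y. B x * A y \<partial>lborel \<partial>lborel)"
    by (subst lborel.nn_integral_fst[symmetric]) auto
  also have "\<dots> = (\<integral>\<^sup>+x. B x \<partial>lborel) * (\<integral>\<^sup>+y. A y \<partial>lborel)"
    by (simp add: nn_integral_cmult nn_integral_multc)
  also have "(\<integral>\<^sup>+x. B x \<partial>lborel) = (\<integral>\<^sup>+p. h2 p \<partial>lborel)"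
    unfolding B_def by (rule nn_integral_lborel_pair(1)[symmetric]) measurable
  also have "(\<integral>\<^sup>+y. A y \<partial>lborel) = (\<integral>\<^sup>+p. h1 p \<partial>lborel)"
    unfolding A_def by (rule nn_integral_lborel_pair(2)[symmetric]) measurable
  finally show ?thesis by (simp add: mult.commute)
qed

text \<open>Extended nonnegative reals have no signed differences to square, so the larger factor is
  used twice instead.\<close>

lemma ennreal_mult_le_sum_squares: "a * b \<le> a\<^sup>2 + (b::ennreal)\<^sup>2"
proof (cases "a \<le> b")
  case True
  then have "a * b \<le> b * b" by (intro mult_right_mono) auto
  then show ?thesis by (simp add: power2_eq_square add_increasing)
next
  case False
  then have "a * b \<le> a * a" by (intro mult_left_mono) auto
  then show ?thesis by (simp add: power2_eq_square add_increasing2)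
qed

text \<open>The bound by slices: on each slice \<open>z\<close> the planar inequality and Cauchy--Schwarz give
  \<open>\<integral> f\<^sup>4 \<le> 4 (\<integral> f\<^sup>2) (\<integral> d1\<^sup>2 + d2\<^sup>2)\<close>, and \<open>\<integral> f\<^sup>2\<close> over a slice is bounded uniformly
  in \<open>z\<close> through the derivative across the slices.\<close>

lemma slices_bound_3d:
  fixes f d1 d2 d3 :: "real \<times> real \<times> real \<Rightarrow> ennreal"
  assumes [measurable]: "f \<in> borel_measurable borel" "d1 \<in> borel_measurable borel"
      "d2 \<in> borel_measurable borel" "d3 \<in> borel_measurable borel"
    and 1: "\<And>z x y. (f (z, x, y))\<^sup>2 \<le> (\<integral>\<^sup>+t. 2 * f (z, t, y) * d1 (z, t, y) \<partial>lborel)"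
    and 2: "\<And>z x y. (f (z, x, y))\<^sup>2 \<le> (\<integral>\<^sup>+t. 2 * f (z, x, t) * d2 (z, x, t) \<partial>lborel)"
    and 3: "\<And>z x y. (f (z, x, y))\<^sup>2 \<le> (\<integral>\<^sup>+t. 2 * f (t, x, y) * d3 (t, x, y) \<partial>lborel)"
  shows "(\<integral>\<^sup>+p. (f p) ^ 4 \<partial>lborel)
    \<le> 4 * (\<integral>\<^sup>+p. 2 * f p * d3 p \<partial>lborel) * (\<integral>\<^sup>+p. (d1 p)\<^sup>2 + (d2 p)\<^sup>2 \<partial>lborel)"
proof -
  have [measurable]: "f \<in> borel_measurable (lborel \<Otimes>\<^sub>M lborel)" "d1 \<in> borel_measurable (lborel \<Otimes>\<^sub>M lborel)"
     "d2 \<in> borel_measurable (lborel \<Otimes>\<^sub>M lborel)" "d3 \<in> borel_measurable (lborel \<Otimes>\<^sub>M lborel)"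
    by (simp_all add: lborel_prod)
  define S where "S = (\<integral>\<^sup>+p. 2 * f p * d3 p \<partial>lborel)"
  have slice: "(\<integral>\<^sup>+q. (f (z, q))\<^sup>2 \<partial>lborel) \<le> S" for z
  proof -
    have "(\<integral>\<^sup>+q. (f (z, q))\<^sup>2 \<partial>lborel) \<le> (\<integral>\<^sup>+q. \<integral>\<^sup>+t. 2 * f (t, q) * d3 (t, q) \<partial>lborel \<partial>lborel)"
    proof (rule nn_integral_mono)
      fix q :: "real \<times> real"
      show "(f (z, q))\<^sup>2 \<le> (\<integral>\<^sup>+t. 2 * f (t, q) * d3 (t, q) \<partial>lborel)"
        using 3[of z "fst q" "snd q"] by simp
    qed
    also have "\<dots> = S"
      unfolding S_def by (rule nn_integral_lborel_pair(2)[symmetric]) measurable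
    finally show ?thesis .
  qed
  have cs: "(\<integral>\<^sup>+q. 2 * f (z, q) * d (z, q) \<partial>lborel)\<^sup>2 \<le> 4 * S * (\<integral>\<^sup>+q. (d (z, q))\<^sup>2 \<partial>lborel)"
    if [measurable]: "d \<in> borel_measurable borel" for z and d :: "real \<times> real \<times> real \<Rightarrow> ennreal"
  proof -
    have "(\<integral>\<^sup>+q. 2 * f (z, q) * d (z, q) \<partial>lborel)\<^sup>2 = 4 * (\<integral>\<^sup>+q. f (z, q) * d (z, q) \<partial>lborel)\<^sup>2"
      by (simp add: mult.assoc nn_integral_cmult power_mult_distrib)
    also have "\<dots> \<le> 4 * ((\<integral>\<^sup>+q. (f (z, q))\<^sup>2 \<partial>lborel) * (\<integral>\<^sup>+q. (d (z, q))\<^sup>2 \<partial>lborel))"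
      by (intro mult_left_mono Cauchy_Schwarz_nn_integral) auto
    also have "\<dots> \<le> 4 * (S * (\<integral>\<^sup>+q. (d (z, q))\<^sup>2 \<partial>lborel))"
      using slice by (intro mult_left_mono mult_right_mono) auto
    finally show ?thesis by (simp add: mult.assoc)
  qed
  have "(\<integral>\<^sup>+q. (f (z, q)) ^ 4 \<partial>lborel)
      \<le> 4 * S * (\<integral>\<^sup>+q. (d1 (z, q))\<^sup>2 + (d2 (z, q))\<^sup>2 \<partial>lborel)" for z
  proof -
    have "(\<integral>\<^sup>+q. (f (z, q)) ^ 4 \<partial>lborel) = (\<integral>\<^sup>+q. ((f (z, q))\<^sup>2)\<^sup>2 \<partial>lborel)"
      by (simp flip: power_mult)
    also have "\<dots> \<le> (\<integral>\<^sup>+q. 2 * f (z, q) * d1 (z, q) \<partial>lborel) * (\<integral>\<^sup>+q. 2 * f (z, q) * d2 (z, q) \<partial>lborel)"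
      by (rule slices_bound_2d) (auto intro: 1 2)
    also have "\<dots> \<le> (\<integral>\<^sup>+q. 2 * f (z, q) * d1 (z, q) \<partial>lborel)\<^sup>2 + (\<integral>\<^sup>+q. 2 * f (z, q) * d2 (z, q) \<partial>lborel)\<^sup>2"
      by (rule ennreal_mult_le_sum_squares)
    also have "\<dots> \<le> 4 * S * (\<integral>\<^sup>+q. (d1 (z, q))\<^sup>2 \<partial>lborel) + 4 * S * (\<integral>\<^sup>+q. (d2 (z, q))\<^sup>2 \<partial>lborel)"
      by (intro add_mono cs) auto
    also have "\<dots> = 4 * S * (\<integral>\<^sup>+q. (d1 (z, q))\<^sup>2 + (d2 (z, q))\<^sup>2 \<partial>lborel)"
      by (simp add: nn_integral_add distrib_left)
    finally show ?thesis .
  qed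
  then have "(\<integral>\<^sup>+z. \<integral>\<^sup>+q. (f (z, q)) ^ 4 \<partial>lborel \<partial>lborel)
      \<le> (\<integral>\<^sup>+z. 4 * S * (\<integral>\<^sup>+q. (d1 (z, q))\<^sup>2 + (d2 (z, q))\<^sup>2 \<partial>lborel) \<partial>lborel)"
    by (intro nn_integral_mono)
  also have "\<dots> = 4 * S * (\<integral>\<^sup>+z. \<integral>\<^sup>+q. (d1 (z, q))\<^sup>2 + (d2 (z, q))\<^sup>2 \<partial>lborel \<partial>lborel)"
    by (subst nn_integral_cmult) auto
  also have "(\<integral>\<^sup>+z. \<integral>\<^sup>+q. (f (z, q)) ^ 4 \<partial>lborel \<partial>lborel) = (\<integral>\<^sup>+p. (f p) ^ 4 \<partial>lborel)"
    by (rule nn_integral_lborel_pair(1)[symmetric]) measurable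
  also have "(\<integral>\<^sup>+z. \<integral>\<^sup>+q. (d1 (z, q))\<^sup>2 + (d2 (z, q))\<^sup>2 \<partial>lborel \<partial>lborel) = (\<integral>\<^sup>+p. (d1 p)\<^sup>2 + (d2 p)\<^sup>2 \<partial>lborel)"
    by (rule nn_integral_lborel_pair(1)[symmetric]) measurable
  finally show ?thesis unfolding S_def .
qed

text \<open>Integrate (g^2)' = 2 g g' from a point left of the support up to s, then enlarge the
  integral to the whole line.\<close>

lemma square_le_line_integral:
  fixes g g' :: "real \<Rightarrow> real"
  assumes g: "\<And>t. (g has_real_derivative g' t) (at t)" and g': "continuous_on UNIV g'"
    and supp: "\<And>t. \<bar>t\<bar> > R \<Longrightarrow> g t = 0"
  shows "ennreal ((g s)\<^sup>2) \<le> (\<integral>\<^sup>+t. ennreal (2 * \<bar>g t\<bar> * \<bar>g' t\<bar>) \<partial>lborel)"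
proof -
  \<comment> \<open>The \<open>- R - 1\<close> puts a strictly left of the support, so g a = 0; the
    minimum ensures a \<le> s.\<close>
  define a where "a = min s (- R - 1)"
  have a: "a \<le> s" "g a = 0" using supp[of a] by (auto simp: a_def)
  have cg: "continuous_on UNIV g" 
    using DERIV_isCont[OF g] by (intro continuous_at_imp_continuous_on) auto
  let ?h = "\<lambda>t. 2 * g t * g' t"
  have bi: "has_bochner_integral lborel (\<lambda>x. indicator {a..s} x *\<^sub>R ?h x) ((g s)\<^sup>2 - (g a)\<^sup>2)"
  proof (rule has_bochner_integral_FTC_Icc[OF a(1)])
    fix x
    have "((\<lambda>t. (g t)\<^sup>2) has_real_derivative ?h x) (at x)"
      by (auto intro!: derivative_eq_intros g)
    then show "((\<lambda>t. (g t)\<^sup>2) has_vector_derivative ?h x) (at x within {a..s})"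
      by (simp add: has_real_derivative_iff_has_vector_derivative has_vector_derivative_at_within)
  qed (intro continuous_intros continuous_on_subset[OF cg] continuous_on_subset[OF g'] subset_UNIV)
  then have "ennreal ((g s)\<^sup>2) = ennreal (norm (LINT x|lborel. indicator {a..s} x *\<^sub>R ?h x))"
    using a by (simp add: has_bochner_integral_iff)
  also have "\<dots> \<le> (\<integral>\<^sup>+x. ennreal (norm (indicator {a..s} x *\<^sub>R ?h x)) \<partial>lborel)"
    using bi by (intro integral_norm_bound_ennreal) (simp add: has_bochner_integral_iff)
  also have "\<dots> \<le> (\<integral>\<^sup>+t. ennreal (2 * \<bar>g t\<bar> * \<bar>g' t\<bar>) \<partial>lborel)"
    by (intro nn_integral_mono ennreal_leI) (auto simp: abs_mult indicator_def)
  finally show ?thesis .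
qed

lemma test_function_line_bound:
  fixes \<phi> :: "real^'n::finite \<Rightarrow> real"
  assumes \<phi>: "\<phi> \<in> test_functions \<Omega>"
  shows "(ennreal \<bar>\<phi> (y + s *\<^sub>R axis i 1)\<bar>)\<^sup>2
    \<le> (\<integral>\<^sup>+t. 2 * ennreal \<bar>\<phi> (y + t *\<^sub>R axis i 1)\<bar>
          * ennreal \<bar>partial_deriv i \<phi> (y + t *\<^sub>R axis i 1)\<bar> \<partial>lborel)"
proof -
  let ?e = "axis i 1 :: real^'n"
  let ?g = "\<lambda>t. \<phi> (y + t *\<^sub>R ?e)" and ?g' = "\<lambda>t. partial_deriv i \<phi> (y + t *\<^sub>R ?e)"
  obtain K where K: "compact K" "\<And>x. x \<notin> K \<Longrightarrow> \<phi> x = 0"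
    using test_function_support[OF \<phi>] by metis
  obtain R where R: "\<And>x. x \<in> K \<Longrightarrow> norm x \<le> R"
    using compact_imp_bounded[OF K(1)] by (auto simp: bounded_iff)
  have der: "(?g has_real_derivative ?g' t) (at t)" for t
  proof -
    let ?L = "frechet_derivative \<phi> (at (y + t *\<^sub>R ?e))"
    have "((\<lambda>t. y + t *\<^sub>R ?e) has_derivative (\<lambda>h. h *\<^sub>R ?e)) (at t)"
      by (auto intro!: derivative_eq_intros)
    from has_derivative_compose[OF this test_function_has_derivative[OF \<phi>]]
    have "(?g has_derivative (\<lambda>h. ?L (h *\<^sub>R ?e))) (at t)" .
    moreover have "?L (h *\<^sub>R ?e) = ?g' t * h" for h
      using linear_scale[OF has_derivative_linear[OF test_function_has_derivative[OF \<phi>]]]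
      by (simp add: partial_deriv_def mult.commute)
    ultimately show ?thesis by (simp add: has_field_derivative_def)
  qed
  have "continuous_on UNIV ?g'"
    by (rule continuous_on_compose2[OF partial_deriv_continuous[OF \<phi>, of UNIV]])
      (auto intro!: continuous_intros)
  \<comment> \<open>The direction is a unit vector, so beyond distance R + norm y the line has left
    the ball around 0 that contains K.\<close>
  moreover have "?g t = 0" if "\<bar>t\<bar> > R + norm y" for t
  proof (rule K(2), rule notI)
    assume "y + t *\<^sub>R ?e \<in> K"
    then have "norm (y + t *\<^sub>R ?e) \<le> R" by (rule R)
    moreover have "\<bar>t\<bar> = norm ((y + t *\<^sub>R ?e) - y)" by simp
    ultimately show False using that norm_triangle_ineq4[of "y + t *\<^sub>R ?e" y] by linarith
  qed
  ultimately have "ennreal ((?g s)\<^sup>2) \<le> (\<integral>\<^sup>+t. ennreal (2 * \<bar>?g t\<bar> * \<bar>?g' t\<bar>) \<partial>lborel)"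
    by (rule square_le_line_integral[OF der])
  then show ?thesis
    by (simp add: ennreal_mult ennreal_power mult.assoc flip: ennreal_numeral)
qed

text \<open>Tonelli for one coordinate. The offset y accumulates the coordinates already split off,
  so that the equation can be iterated by rewriting.\<close>

lemma nn_integral_PiM_insert_sum:
  fixes F :: "'a::euclidean_space \<Rightarrow> ennreal"
  assumes [measurable]: "F \<in> borel_measurable borel" and I: "finite I" "i \<notin> I"
  shows "(\<integral>\<^sup>+f. F (y + (\<Sum>b\<in>insert i I. f b *\<^sub>R b)) \<partial>(\<Pi>\<^sub>M b\<in>insert i I. lborel))
    = (\<integral>\<^sup>+t. \<integral>\<^sup>+f. F (y + t *\<^sub>R i + (\<Sum>b\<in>I. f b *\<^sub>R b)) \<partial>(\<Pi>\<^sub>M b\<in>I. lborel) \<partial>lborel)"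
proof -
  interpret product_sigma_finite "\<lambda>_::'a. lborel :: real measure" by standard
  have "(\<integral>\<^sup>+f. F (y + (\<Sum>b\<in>insert i I. f b *\<^sub>R b)) \<partial>(\<Pi>\<^sub>M b\<in>insert i I. lborel))
    = (\<integral>\<^sup>+t. \<integral>\<^sup>+f. F (y + (\<Sum>b\<in>insert i I. (f(i := t)) b *\<^sub>R b)) \<partial>(\<Pi>\<^sub>M b\<in>I. lborel) \<partial>lborel)"
    using I by (intro product_nn_integral_insert_rev) auto
  moreover have "(\<Sum>b\<in>insert i I. (f(i := t)) b *\<^sub>R b) = t *\<^sub>R i + (\<Sum>b\<in>I. f b *\<^sub>R b)" for f :: "'a \<Rightarrow> real" and t
    using I by (auto intro!: sum.cong)
  ultimately show ?thesis by (simp only: add.assoc)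
qed

text \<open>The leading 0 is the initial offset y for
  \<open>nn_integral_PiM_insert_sum\<close>.\<close>

lemma nn_integral_lborel_PiM:
  fixes F :: "'a::euclidean_space \<Rightarrow> ennreal"
  assumes [measurable]: "F \<in> borel_measurable borel"
  shows "(\<integral>\<^sup>+x. F x \<partial>lborel) = (\<integral>\<^sup>+f. F (0 + (\<Sum>b\<in>Basis. f b *\<^sub>R b)) \<partial>(\<Pi>\<^sub>M b\<in>Basis. lborel))"
  by (subst lborel_eq) (simp add: nn_integral_distr)

lemma axis_inj: "axis i (1::real) = axis j 1 \<longleftrightarrow> i = j"
  by (simp add: axis_eq_axis)

lemma nn_integral_coords_2:
  fixes F :: "real^'n::finite \<Rightarrow> ennreal"
  assumes [measurable]: "F \<in> borel_measurable borel" and ij: "UNIV = {i, j}" "i \<noteq> j"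
  shows "(\<integral>\<^sup>+x. F x \<partial>lborel) = (\<integral>\<^sup>+p. F (fst p *\<^sub>R axis i 1 + snd p *\<^sub>R axis j 1) \<partial>lborel)"
proof -
  have B: "Basis = {axis i 1, axis j (1::real)}" using ij(1) by (auto simp: Basis_vec_def)
  \<comment> \<open>Once all basis vectors are split off, the product measure over no coordinates is
    left, which is a point mass.\<close>
  have "(\<integral>\<^sup>+x. F x \<partial>lborel)
      = (\<integral>\<^sup>+s. \<integral>\<^sup>+t. F (s *\<^sub>R axis i 1 + t *\<^sub>R axis j 1) \<partial>lborel \<partial>lborel)"
    by (simp only: nn_integral_lborel_PiM[OF assms(1)] B nn_integral_PiM_insert_sum[OF assms(1)]
        finite.intros insert_iff empty_iff axis_inj ij(2) simp_thms)
      (simp add: PiM_empty nn_integral_count_space_finite)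
  also have "\<dots> = (\<integral>\<^sup>+p. F (fst p *\<^sub>R axis i 1 + snd p *\<^sub>R axis j 1) \<partial>lborel)"
    by (subst nn_integral_lborel_pair(1))
      (auto intro!: measurable_compose[OF borel_measurable_continuous_onI assms(1)] continuous_intros)
  finally show ?thesis .
qed

lemma nn_integral_coords_3:
  fixes F :: "real^'n::finite \<Rightarrow> ennreal"
  assumes [measurable]: "F \<in> borel_measurable borel" and ijk: "UNIV = {i, j, k}" "i \<noteq> j" "i \<noteq> k" "j \<noteq> k"
  shows "(\<integral>\<^sup>+x. F x \<partial>lborel) = (\<integral>\<^sup>+p. F (fst p *\<^sub>R axis i 1 + fst (snd p) *\<^sub>R axis j 1
    + snd (snd p) *\<^sub>R axis k 1) \<partial>lborel)"
proof -
  have B: "Basis = {axis i 1, axis j (1::real), axis k 1}" using ijk(1) by (auto simp: Basis_vec_def)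
  have meas: "(\<lambda>p. F (fst p *\<^sub>R axis i 1 + fst (snd p) *\<^sub>R axis j 1
      + snd (snd p) *\<^sub>R axis k 1)) \<in> borel_measurable borel"
    by (auto intro!: measurable_compose[OF borel_measurable_continuous_onI assms(1)] continuous_intros)
  have "(\<integral>\<^sup>+x. F x \<partial>lborel)
      = (\<integral>\<^sup>+r. \<integral>\<^sup>+s. \<integral>\<^sup>+t. F (r *\<^sub>R axis i 1 + s *\<^sub>R axis j 1 + t *\<^sub>R axis k 1) \<partial>lborel \<partial>lborel \<partial>lborel)"
    by (simp only: nn_integral_lborel_PiM[OF assms(1)] B nn_integral_PiM_insert_sum[OF assms(1)]
        finite.intros insert_iff empty_iff axis_inj ijk(2-4) simp_thms)
      (simp add: PiM_empty nn_integral_count_space_finite)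
  also have "\<dots> = (\<integral>\<^sup>+r. \<integral>\<^sup>+q. F (r *\<^sub>R axis i 1 + fst q *\<^sub>R axis j 1 + snd q *\<^sub>R axis k 1) \<partial>lborel \<partial>lborel)"
    by (subst nn_integral_lborel_pair(1))
      (auto intro!: measurable_compose[OF borel_measurable_continuous_onI assms(1)] continuous_intros)
  also have "\<dots> = (\<integral>\<^sup>+p. F (fst p *\<^sub>R axis i 1 + fst (snd p) *\<^sub>R axis j 1
    + snd (snd p) *\<^sub>R axis k 1) \<partial>lborel)"
    using nn_integral_lborel_pair(1)[OF meas] by simp
  finally show ?thesis .
qed

lemma ennreal_am_gm: "2 * ennreal \<bar>a\<bar> * ennreal \<bar>b\<bar> \<le> ennreal (a\<^sup>2 + b\<^sup>2)"
proof -
  have "0 \<le> (\<bar>a\<bar> - \<bar>b\<bar>)\<^sup>2" by simp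
  then have "2 * \<bar>a\<bar> * \<bar>b\<bar> \<le> a\<^sup>2 + b\<^sup>2" by (simp add: power2_diff)
  then have "ennreal (2 * \<bar>a\<bar> * \<bar>b\<bar>) \<le> ennreal (a\<^sup>2 + b\<^sup>2)" by (rule ennreal_leI)
  then show ?thesis by (simp add: ennreal_mult)
qed

text \<open>The slice bounds apply to f^2 along each axis. By the inequality 2 |a| |b| \<le> a^2 +
  b^2 every integral of 2 f d_i is at most N, the squared H^1 norm. The factor 4 is that of
  dimension 3; dimension 2 gives 1.\<close>

lemma ladyzhenskaya:
  fixes \<phi> :: "real^'n::finite \<Rightarrow> real"
  assumes card: "CARD('n) = 2 \<or> CARD('n) = 3" and \<phi>: "\<phi> \<in> test_functions \<Omega>"
  shows "(\<integral>\<^sup>+x. ennreal ((\<phi> x) ^ 4) \<partial>lborel)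
    \<le> 4 * (\<integral>\<^sup>+x. ennreal ((\<phi> x)\<^sup>2 + (\<Sum>i\<in>UNIV. (partial_deriv i \<phi> x)\<^sup>2)) \<partial>lborel)\<^sup>2"
proof -
  define f where "f x = ennreal \<bar>\<phi> x\<bar>" for x
  define d where "d i x = ennreal \<bar>partial_deriv i \<phi> x\<bar>" for i x
  define N where "N = (\<integral>\<^sup>+x. ennreal ((\<phi> x)\<^sup>2 + (\<Sum>i\<in>UNIV. (partial_deriv i \<phi> x)\<^sup>2)) \<partial>lborel)"
  have [measurable]: "\<phi> \<in> borel_measurable borel" "partial_deriv i \<phi> \<in> borel_measurable borel" for i
    using test_function_continuous[OF \<phi>] partial_deriv_continuous[OF \<phi>]
    by (auto intro: borel_measurable_continuous_onI)
  have fm [measurable]: "f \<in> borel_measurable borel" and dm [measurable]: "d i \<in> borel_measurable borel" for i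
    unfolding f_def d_def by measurable
  have line: "(f (y + s *\<^sub>R axis i 1))\<^sup>2
      \<le> (\<integral>\<^sup>+t. 2 * f (y + t *\<^sub>R axis i 1) * d i (y + t *\<^sub>R axis i 1) \<partial>lborel)" for y s i
    unfolding f_def d_def by (rule test_function_line_bound[OF \<phi>])
  have fd: "(\<integral>\<^sup>+x. 2 * f x * d i x \<partial>lborel) \<le> N" for i
    unfolding N_def f_def d_def
    by (intro nn_integral_mono order_trans[OF ennreal_am_gm] ennreal_leI add_left_mono member_le_sum) auto
  have f4: "ennreal ((\<phi> x) ^ 4) = (f x) ^ 4" for x
    by (simp add: f_def ennreal_power)
  from card show ?thesis
  proof
    assume "CARD('n) = 2"
    then obtain i j :: 'n where ij: "UNIV = {i, j}" "i \<noteq> j" by (auto simp: card_2_iff)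
    define T :: "real \<times> real \<Rightarrow> real^'n" where "T p = fst p *\<^sub>R axis i 1 + snd p *\<^sub>R axis j 1" for p
    have [measurable]: "T \<in> borel_measurable borel"
      unfolding T_def by (intro borel_measurable_continuous_onI continuous_intros)
    note coords = nn_integral_coords_2[OF _ ij, folded T_def]
    have "(\<integral>\<^sup>+p. ((f (T p))\<^sup>2)\<^sup>2 \<partial>lborel)
        \<le> (\<integral>\<^sup>+p. 2 * f (T p) * d i (T p) \<partial>lborel) * (\<integral>\<^sup>+p. 2 * f (T p) * d j (T p) \<partial>lborel)"
    proof (rule slices_bound_2d)
      fix x y
      show "(f (T (x, y)))\<^sup>2 \<le> (\<integral>\<^sup>+t. 2 * f (T (t, y)) * d i (T (t, y)) \<partial>lborel)"
        using line[of "y *\<^sub>R axis j 1" x i] by (simp add: T_def add.commute)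
      show "(f (T (x, y)))\<^sup>2 \<le> (\<integral>\<^sup>+t. 2 * f (T (x, t)) * d j (T (x, t)) \<partial>lborel)"
        using line[of "x *\<^sub>R axis i 1" y j] by (simp add: T_def)
    qed measurable
    also have "\<dots> = (\<integral>\<^sup>+x. 2 * f x * d i x \<partial>lborel) * (\<integral>\<^sup>+x. 2 * f x * d j x \<partial>lborel)"
      by (simp add: coords)
    also have "\<dots> \<le> N * N" by (intro mult_mono fd) auto
    also have "\<dots> \<le> 4 * N\<^sup>2"
      using mult_right_mono[of 1 4 "N * N"] by (simp add: power2_eq_square)
    also have "(\<integral>\<^sup>+p. ((f (T p))\<^sup>2)\<^sup>2 \<partial>lborel) = (\<integral>\<^sup>+x. (f x) ^ 4 \<partial>lborel)"
      by (simp add: coords flip: power_mult)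
    finally show ?thesis unfolding f4 N_def .
  next
    assume "CARD('n) = 3"
    then obtain k i j :: 'n where ij: "UNIV = {k, i, j}" "k \<noteq> i" "k \<noteq> j" "i \<noteq> j"
      by (auto simp: card_3_iff)
    define T :: "real \<times> real \<times> real \<Rightarrow> real^'n"
      where "T p = fst p *\<^sub>R axis k 1 + fst (snd p) *\<^sub>R axis i 1 + snd (snd p) *\<^sub>R axis j 1" for p
    have [measurable]: "T \<in> borel_measurable borel"
      unfolding T_def by (intro borel_measurable_continuous_onI continuous_intros)
    note coords = nn_integral_coords_3[OF _ ij, folded T_def]
    have "(\<integral>\<^sup>+p. (f (T p)) ^ 4 \<partial>lborel)
        \<le> 4 * (\<integral>\<^sup>+p. 2 * f (T p) * d k (T p) \<partial>lborel)
            * (\<integral>\<^sup>+p. (d i (T p))\<^sup>2 + (d j (T p))\<^sup>2 \<partial>lborel)"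
    proof (rule slices_bound_3d)
      fix z x y
      show "(f (T (z, x, y)))\<^sup>2 \<le> (\<integral>\<^sup>+t. 2 * f (T (z, t, y)) * d i (T (z, t, y)) \<partial>lborel)"
        using line[of "z *\<^sub>R axis k 1 + y *\<^sub>R axis j 1" x i] by (simp add: T_def add_ac)
      show "(f (T (z, x, y)))\<^sup>2 \<le> (\<integral>\<^sup>+t. 2 * f (T (z, x, t)) * d j (T (z, x, t)) \<partial>lborel)"
        using line[of "z *\<^sub>R axis k 1 + x *\<^sub>R axis i 1" y j] by (simp add: T_def add_ac)
      show "(f (T (z, x, y)))\<^sup>2 \<le> (\<integral>\<^sup>+t. 2 * f (T (t, x, y)) * d k (T (t, x, y)) \<partial>lborel)"
        using line[of "x *\<^sub>R axis i 1 + y *\<^sub>R axis j 1" z k] by (simp add: T_def add_ac)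
    qed measurable
    also have "\<dots> = 4 * (\<integral>\<^sup>+x. 2 * f x * d k x \<partial>lborel) * (\<integral>\<^sup>+x. (d i x)\<^sup>2 + (d j x)\<^sup>2 \<partial>lborel)"
      by (simp add: coords)
    also have "\<dots> \<le> 4 * N * N"
    proof (intro mult_mono fd order_refl)
      show "(\<integral>\<^sup>+x. (d i x)\<^sup>2 + (d j x)\<^sup>2 \<partial>lborel) \<le> N"
        unfolding N_def
      proof (rule nn_integral_mono)
        fix x
        have "(partial_deriv i \<phi> x)\<^sup>2 + (partial_deriv j \<phi> x)\<^sup>2
            = (\<Sum>l\<in>{i, j}. (partial_deriv l \<phi> x)\<^sup>2)" using ij by simp
        also have "\<dots> \<le> (\<Sum>l\<in>UNIV. (partial_deriv l \<phi> x)\<^sup>2)" by (intro sum_mono2) auto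
        finally have "(partial_deriv i \<phi> x)\<^sup>2 + (partial_deriv j \<phi> x)\<^sup>2
            \<le> (\<phi> x)\<^sup>2 + (\<Sum>l\<in>UNIV. (partial_deriv l \<phi> x)\<^sup>2)" by (simp add: add_increasing)
        then have "ennreal ((partial_deriv i \<phi> x)\<^sup>2 + (partial_deriv j \<phi> x)\<^sup>2)
            \<le> ennreal ((\<phi> x)\<^sup>2 + (\<Sum>l\<in>UNIV. (partial_deriv l \<phi> x)\<^sup>2))" by (rule ennreal_leI)
        then show "(d i x)\<^sup>2 + (d j x)\<^sup>2 \<le> ennreal ((\<phi> x)\<^sup>2 + (\<Sum>l\<in>UNIV. (partial_deriv l \<phi> x)\<^sup>2))"
          by (simp add: d_def ennreal_power)
      qed
    qed auto
    also have "(\<integral>\<^sup>+p. (f (T p)) ^ 4 \<partial>lborel) = (\<integral>\<^sup>+x. (f x) ^ 4 \<partial>lborel)"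
      by (simp add: coords)
    finally show ?thesis unfolding f4 N_def by (simp add: power2_eq_square mult.assoc)
  qed
qed

section \<open>Passage from test functions to their closure\<close>

lemma nn_integral_H1_norm_eq:
  fixes \<phi> :: "real^'n::finite \<Rightarrow> real"
  assumes \<phi>: "\<phi> \<in> test_functions \<Omega>"
  shows "(\<integral>\<^sup>+x. ennreal ((\<phi> x)\<^sup>2 + (\<Sum>i\<in>UNIV. (partial_deriv i \<phi> x)\<^sup>2)) \<partial>lborel)
    = ennreal ((norm (class_of \<phi>))\<^sup>2 + (norm ((\<chi> i. class_of (partial_deriv i \<phi>)) :: 'n vfield))\<^sup>2)"
proof -
  have n: "(norm (class_of f))\<^sup>2 = (LINT x|lborel. (f x)\<^sup>2)" if f: "sq_integrable f" for f :: "real^'n \<Rightarrow> real"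
  proof -
    have [measurable]: "f \<in> borel_measurable borel" using f by (simp add: sq_integrable_def)
    show ?thesis
      unfolding norm_L2_sq using fun_of_class_of[OF f]
      by (intro integral_cong_AE) auto
  qed
  note sq = sq_integrable_test_function[OF \<phi>]
  have i: "integrable lborel (\<lambda>x. (\<phi> x)\<^sup>2)" "integrable lborel (\<lambda>x. (partial_deriv i \<phi> x)\<^sup>2)" for i
    using sq by (auto simp: sq_integrable_def)
  have "(norm ((\<chi> i. class_of (partial_deriv i \<phi>)) :: 'n vfield))\<^sup>2
      = (\<Sum>i\<in>UNIV. (norm (class_of (partial_deriv i \<phi>)))\<^sup>2)"
    by (simp add: norm_vec_def L2_set_def sum_nonneg)
  then show ?thesis
    using i by (subst nn_integral_eq_integral) (auto simp: n sq sum_nonneg intro!: Bochner_Integration.integrable_sum)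
qed

text \<open>Approximating test functions have bounded H^1 norms, hence bounded integrals of fourth
  powers. A subsequence converges almost everywhere, and Fatou's lemma carries the bound to
  u.\<close>

lemma H10_fourth_power_integrable:
  fixes u :: "'n::finite sfield"
  assumes card: "CARD('n) = 2 \<or> CARD('n) = 3" and u: "u \<in> H10 \<Omega>"
  shows "integrable lborel (\<lambda>x. (fun_of u x) ^ 4)"
proof -
  have "\<exists>\<phi>\<in>test_functions \<Omega>. norm (u - class_of \<phi>) < 1 / real (Suc n)
      \<and> norm (grad \<Omega> u - (\<chi> i. class_of (partial_deriv i \<phi>))) < 1 / real (Suc n)" for n
    using u by (simp add: H10_def)
  then obtain \<phi> where \<phi>: "\<And>n. \<phi> n \<in> test_functions \<Omega>"
    and 1: "\<And>n. norm (u - class_of (\<phi> n)) < 1 / real (Suc n)"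
    and 2: "\<And>n. norm (grad \<Omega> u - (\<chi> i. class_of (partial_deriv i (\<phi> n)))) < 1 / real (Suc n)"
    by metis
  have sq: "sq_integrable (\<phi> n)" for n using sq_integrable_test_function(1)[OF \<phi>] .
  have [measurable]: "\<phi> n \<in> borel_measurable borel" for n using sq[of n] by (simp add: sq_integrable_def)
  \<comment> \<open>All approximation errors are at most 1, so C bounds the squared H^1 norm of
    every approximant.\<close>
  define C where "C = (norm u + 1)\<^sup>2 + (norm (grad \<Omega> u) + 1)\<^sup>2"
  have bound: "(\<integral>\<^sup>+x. ennreal ((\<phi> n x) ^ 4) \<partial>lborel) \<le> 4 * (ennreal C)\<^sup>2" for n
  proof -
    have le1: "1 / real (Suc n) \<le> 1" by simp
    have "norm (class_of (\<phi> n)) \<le> norm u + 1"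
      using less_le_trans[OF 1[of n] le1] norm_triangle_ineq4[of u "u - class_of (\<phi> n)"] by simp
    moreover have "norm ((\<chi> i. class_of (partial_deriv i (\<phi> n))) :: 'n vfield) \<le> norm (grad \<Omega> u) + 1"
      using less_le_trans[OF 2[of n] le1]
        norm_triangle_ineq4[of "grad \<Omega> u" "grad \<Omega> u - (\<chi> i. class_of (partial_deriv i (\<phi> n)))"] by simp
    ultimately have "(norm (class_of (\<phi> n)))\<^sup>2 + (norm ((\<chi> i. class_of (partial_deriv i (\<phi> n))) :: 'n vfield))\<^sup>2 \<le> C"
      unfolding C_def by (intro add_mono power_mono) auto
    then show ?thesis
      by (intro order_trans[OF ladyzhenskaya[OF card \<phi>]] mult_left_mono power_mono)
        (auto simp: nn_integral_H1_norm_eq[OF \<phi>] simp del: ennreal_plus intro: ennreal_leI)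
  qed
  \<comment> \<open>Squared errors turn L^2 convergence into L^1 convergence, from which an almost
    everywhere convergent subsequence is extracted.\<close>
  define e where "e n x = (fun_of u x - \<phi> n x)\<^sup>2" for n x
  have e_int: "integrable lborel (e n)" for n
    using sq_integrable_add[OF sq_integrable_fun_of sq_integrable_scale[OF sq, of "-1"], of u n]
    by (simp add: sq_integrable_def e_def[abs_def])
  have e_eq: "(LINT x|lborel. norm (e n x)) = (norm (u - class_of (\<phi> n)))\<^sup>2" for n
  proof -
    have "AE x in lborel. norm (e n x) = (fun_of (u - class_of (\<phi> n)) x)\<^sup>2"
      using fun_of_diff[of u "class_of (\<phi> n)"] fun_of_class_of[OF sq, of n]
      by eventually_elim (simp add: e_def)
    then show ?thesis unfolding norm_L2_sq using e_int[of n] by (intro integral_cong_AE) auto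
  qed
  have "(\<lambda>n. LINT x|lborel. norm (e n x)) \<longlonglongrightarrow> 0"
  proof (rule tendsto_sandwich[OF _ _ tendsto_const])
    have "(\<lambda>n. (1 / real (Suc n))\<^sup>2) \<longlonglongrightarrow> 0\<^sup>2" by (intro tendsto_power LIMSEQ_Suc lim_1_over_n)
    then show "(\<lambda>n. (1 / real (Suc n))\<^sup>2) \<longlonglongrightarrow> 0" by simp
    show "\<forall>\<^sub>F n in sequentially. (LINT x|lborel. norm (e n x)) \<le> (1 / real (Suc n))\<^sup>2"
      using 1 by (intro always_eventually allI) (simp only: e_eq, intro power_mono, auto intro: less_imp_le)
  qed (auto simp: e_eq)
  from tendsto_L1_AE_subseq[OF e_int this] obtain r where
    r: "AE x in lborel. (\<lambda>n. e (r n) x) \<longlonglongrightarrow> 0" by blast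
  have lim: "AE x in lborel. ennreal ((fun_of u x) ^ 4) = liminf (\<lambda>n. ennreal ((\<phi> (r n) x) ^ 4))"
    using r
  proof eventually_elim
    case (elim x)
    have "(\<lambda>n. sqrt (e (r n) x)) \<longlonglongrightarrow> sqrt 0" using elim by (rule tendsto_real_sqrt)
    then have "(\<lambda>n. fun_of u x - \<phi> (r n) x) \<longlonglongrightarrow> 0"
      by (simp add: e_def tendsto_rabs_zero_iff)
    from tendsto_diff[OF tendsto_const[of "fun_of u x"] this]
    have "(\<lambda>n. \<phi> (r n) x) \<longlonglongrightarrow> fun_of u x" by simp
    then have "(\<lambda>n. ennreal ((\<phi> (r n) x) ^ 4)) \<longlonglongrightarrow> ennreal ((fun_of u x) ^ 4)"
      by (intro tendsto_ennrealI tendsto_power)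
    then show ?case by (intro lim_imp_Liminf[symmetric]) auto
  qed
  have "(\<integral>\<^sup>+x. ennreal ((fun_of u x) ^ 4) \<partial>lborel) = (\<integral>\<^sup>+x. liminf (\<lambda>n. ennreal ((\<phi> (r n) x) ^ 4)) \<partial>lborel)"
    by (rule nn_integral_cong_AE[OF lim])
  also have "\<dots> \<le> liminf (\<lambda>n. \<integral>\<^sup>+x. ennreal ((\<phi> (r n) x) ^ 4) \<partial>lborel)"
    by (rule nn_integral_liminf) measurable
  also have "\<dots> \<le> liminf (\<lambda>n. 4 * (ennreal C)\<^sup>2)"
    by (intro Liminf_mono always_eventually allI bound)
  also have "\<dots> < \<infinity>" 
    by (simp add: Liminf_const ennreal_mult_less_top power_less_top_ennreal)
  finally show ?thesis by (intro integrableI_bounded) auto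
qed


section \<open>Coupled convection problems in finite dimension\<close>

text \<open>Lax-Milgram in finite dimension for a form that need not be symmetric, by a one-sided
  Gram-Schmidt step: the new vector b is corrected by an element of \<open>span B\<close> so that
  the form vanishes against \<open>span B\<close>, and a multiple of the result adjusts the solution
  found in \<open>span B\<close>.\<close>

lemma positive_form_representation:
  fixes a :: "'v::real_vector \<Rightarrow> 'v \<Rightarrow> real"
  assumes "finite B"
    and add1: "\<And>x y z. \<lbrakk>x \<in> span B; y \<in> span B; z \<in> span B\<rbrakk> \<Longrightarrow> a (x + y) z = a x z + a y z"
    and scale1: "\<And>r x y. \<lbrakk>x \<in> span B; y \<in> span B\<rbrakk> \<Longrightarrow> a (r *\<^sub>R x) y = r * a x y"
    and add2: "\<And>x y z. \<lbrakk>x \<in> span B; y \<in> span B; z \<in> span B\<rbrakk> \<Longrightarrow> a x (y + z) = a x y + a x z"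
    and scale2: "\<And>r x y. \<lbrakk>x \<in> span B; y \<in> span B\<rbrakk> \<Longrightarrow> a x (r *\<^sub>R y) = r * a x y"
    and pos: "\<And>x. \<lbrakk>x \<in> span B; x \<noteq> 0\<rbrakk> \<Longrightarrow> a x x > 0"
    and addl: "\<And>x y. \<lbrakk>x \<in> span B; y \<in> span B\<rbrakk> \<Longrightarrow> l (x + y) = l x + l y"
    and scalel: "\<And>r x. x \<in> span B \<Longrightarrow> l (r *\<^sub>R x) = r * l x"
  shows "\<exists>p\<in>span B. \<forall>v\<in>span B. a p v = l v"
  using assms
proof (induction B arbitrary: l rule: finite_induct)
  case empty
  from empty.prems(2)[of 0 0 0] empty.prems(7)[of 0 0] show ?case by auto
next
  case (insert b B)
  let ?S = "span (insert b B)"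
  have sub: "x \<in> ?S" if "x \<in> span B" for x
    using span_mono[of B "insert b B"] that by auto
  have bS: "b \<in> ?S" by (intro span_base) auto
  note S = insert.prems
  have IH: "\<exists>p\<in>span B. \<forall>v\<in>span B. a p v = m v"
    if "\<And>x y. \<lbrakk>x \<in> span B; y \<in> span B\<rbrakk> \<Longrightarrow> m (x + y) = m x + m y"
      "\<And>r x. x \<in> span B \<Longrightarrow> m (r *\<^sub>R x) = r * m x" for m
  proof (rule insert.IH, goal_cases)
    case (1 x y z) then show ?case using S(1)[of x y z] sub[of x] sub[of y] sub[of z] by auto
  next
    case (2 x y r) then show ?case using S(2)[of x y r] sub[of x] sub[of y] by auto
  next
    case (3 x y z) then show ?case using S(3)[of x y z] sub[of x] sub[of y] sub[of z] by auto
  next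
    case (4 x y r) then show ?case using S(4)[of x y r] sub[of x] sub[of y] by auto
  next
    case (5 x) then show ?case using S(5)[of x] sub[of x] by auto
  qed (use that in auto)
  obtain q0 where q0: "q0 \<in> span B" "\<And>v. v \<in> span B \<Longrightarrow> a q0 v = l v"
    using IH[of l] S(6,7) sub by blast
  have "\<exists>p\<in>span B. \<forall>v\<in>span B. a p v = - a b v"
  proof (rule IH)
    fix x y assume "x \<in> span B" "y \<in> span B"
    then show "- a b (x + y) = - a b x + - a b y"
      using S(3)[of b x y] bS sub[of x] sub[of y] by auto
  next
    fix r x assume "x \<in> span B"
    then show "- a b (r *\<^sub>R x) = r * - a b x" using S(4)[of b x r] bS sub[of x] by auto
  qed
  then obtain q1 where q1: "q1 \<in> span B" "\<And>v. v \<in> span B \<Longrightarrow> a q1 v = - a b v" by blast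
  have q: "q0 \<in> ?S" "q1 \<in> ?S" using q0 q1 sub by auto
  \<comment> \<open>The correction q1 is chosen so that a c v = 0 for all v in
    \<open>span B\<close>.\<close>
  define c where "c = q1 + b"
  have cS: "c \<in> ?S" unfolding c_def using q bS by (intro span_add)
  have c0: "a c v = 0" if "v \<in> span B" for v
    using S(1)[of q1 b v] q1(2)[OF that] q bS that sub by (auto simp: c_def)
  show ?case
  proof (cases "c = 0")
    case True
    then have "b = - q1" by (simp add: c_def eq_neg_iff_add_eq_0 add.commute)
    then have "b \<in> span B" using q1(1) by (simp add: span_neg)
    then have "?S = span B" by (simp add: span_redundant)
    then show ?thesis using q0 by auto
  next
    case False
    have "a c c = a c b"
      using S(3)[of c q1 b] c0[OF q1(1)] cS q bS by (simp add: c_def)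
    with S(5)[OF cS False] have acb: "a c b > 0" by simp
    \<comment> \<open>Adding a multiple of c leaves the equations on \<open>span B\<close> intact;
      this t makes the one for b hold.\<close>
    define t where "t = (l b - a q0 b) / a c b"
    define p where "p = q0 + t *\<^sub>R c"
    have tc: "t *\<^sub>R c \<in> ?S" using cS by (rule span_scale)
    have pS: "p \<in> ?S" unfolding p_def using q tc by (intro span_add)
    have ap: "a p v = a q0 v + t * a c v" if "v \<in> ?S" for v
      using S(1)[of q0 "t *\<^sub>R c" v] S(2)[of c v t] q tc cS that by (simp add: p_def)
    have "a p v = l v" if v: "v \<in> ?S" for v
    proof -
      obtain k where k: "v - k *\<^sub>R b \<in> span B" using v by (auto simp: span_insert)
      let ?w = "v - k *\<^sub>R b"
      have w: "?w \<in> ?S" using k sub by auto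
      have kb: "k *\<^sub>R b \<in> ?S" using bS by (rule span_scale)
      have "a p v = a p ?w + k * a p b"
        using S(3)[of p ?w "k *\<^sub>R b"] S(4)[of p b k] pS w kb bS by simp
      also have "a p ?w = l ?w" using ap[OF w] c0[OF k] q0(2)[OF k] by simp
      also have "a p b = l b" using ap[OF bS] acb by (simp add: t_def)
      also have "l ?w + k * l b = l v"
        using S(6)[of ?w "k *\<^sub>R b"] S(7)[of b k] w kb bS by simp
      finally show ?thesis .
    qed
    then show ?thesis using pS by blast
  qed
qed

text \<open>\<open>D\<close> and \<open>E\<close> stand for the gradients, \<open>c\<close> for the buoyancy coupling
  \<open>(s, v) \<mapsto> Ri (\<langle>0, s\<rangle>\<^sup>T, v)\<close> and \<open>L\<close> for its bound \<open>Ri C\<^sub>P\<^sup>2\<close>.\<close>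

locale coupled_convection =
  fixes V :: "'v::real_vector set" and W :: "'w::real_vector set"
    and D :: "'v \<Rightarrow> 'a::real_inner" and E :: "'w \<Rightarrow> 'b::real_inner"
    and b :: "'v \<Rightarrow> 'v \<Rightarrow> 'v \<Rightarrow> real" and bs :: "'v \<Rightarrow> 'w \<Rightarrow> 'w \<Rightarrow> real"
    and c :: "'w \<Rightarrow> 'v \<Rightarrow> real"
    and \<nu> \<kappa> L M :: real
  assumes fin_V: "fin_dim_subspace V" and fin_W: "fin_dim_subspace W"
    and D_add: "\<lbrakk>u \<in> V; v \<in> V\<rbrakk> \<Longrightarrow> D (u + v) = D u + D v"
    and D_scale: "u \<in> V \<Longrightarrow> D (r *\<^sub>R u) = r *\<^sub>R D u"
    and D_zero: "\<lbrakk>u \<in> V; D u = 0\<rbrakk> \<Longrightarrow> u = 0"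
    and E_add: "\<lbrakk>s \<in> W; t \<in> W\<rbrakk> \<Longrightarrow> E (s + t) = E s + E t"
    and E_scale: "s \<in> W \<Longrightarrow> E (r *\<^sub>R s) = r *\<^sub>R E s"
    and E_zero: "\<lbrakk>s \<in> W; E s = 0\<rbrakk> \<Longrightarrow> s = 0"
    and b_add1: "\<lbrakk>u \<in> V; u' \<in> V; v \<in> V; w \<in> V\<rbrakk> \<Longrightarrow> b (u + u') v w = b u v w + b u' v w"
    and b_add2: "\<lbrakk>u \<in> V; v \<in> V; v' \<in> V; w \<in> V\<rbrakk> \<Longrightarrow> b u (v + v') w = b u v w + b u v' w"
    and b_scale1: "\<lbrakk>u \<in> V; v \<in> V; w \<in> V\<rbrakk> \<Longrightarrow> b (r *\<^sub>R u) v w = r * b u v w"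
    and b_scale2: "\<lbrakk>u \<in> V; v \<in> V; w \<in> V\<rbrakk> \<Longrightarrow> b u (r *\<^sub>R v) w = r * b u v w"
    and b_skew: "b u v w = - b u w v"
    and b_bound: "\<lbrakk>u \<in> V; v \<in> V; w \<in> V\<rbrakk> \<Longrightarrow> b u v w \<le> M * norm (D u) * norm (D v) * norm (D w)"
    and bs_add1: "\<lbrakk>u \<in> V; u' \<in> V; s \<in> W; t \<in> W\<rbrakk> \<Longrightarrow> bs (u + u') s t = bs u s t + bs u' s t"
    and bs_add2: "\<lbrakk>u \<in> V; s \<in> W; s' \<in> W; t \<in> W\<rbrakk> \<Longrightarrow> bs u (s + s') t = bs u s t + bs u s' t"
    and bs_scale1: "\<lbrakk>u \<in> V; s \<in> W; t \<in> W\<rbrakk> \<Longrightarrow> bs (r *\<^sub>R u) s t = r * bs u s t"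
    and bs_scale2: "\<lbrakk>u \<in> V; s \<in> W; t \<in> W\<rbrakk> \<Longrightarrow> bs u (r *\<^sub>R s) t = r * bs u s t"
    and bs_skew: "bs u s t = - bs u t s"
    and bs_bound: "\<lbrakk>u \<in> V; s \<in> W; t \<in> W\<rbrakk> \<Longrightarrow> bs u s t \<le> M * norm (D u) * norm (E s) * norm (E t)"
    and c_add1: "\<lbrakk>s \<in> W; t \<in> W; v \<in> V\<rbrakk> \<Longrightarrow> c (s + t) v = c s v + c t v"
    and c_add2: "\<lbrakk>s \<in> W; v \<in> V; w \<in> V\<rbrakk> \<Longrightarrow> c s (v + w) = c s v + c s w"
    and c_scale1: "\<lbrakk>s \<in> W; v \<in> V\<rbrakk> \<Longrightarrow> c (r *\<^sub>R s) v = r * c s v"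
    and c_scale2: "\<lbrakk>s \<in> W; v \<in> V\<rbrakk> \<Longrightarrow> c s (r *\<^sub>R v) = r * c s v"
    and c_bound: "\<lbrakk>s \<in> W; v \<in> V\<rbrakk> \<Longrightarrow> c s v \<le> L * norm (E s) * norm (D v)"
    and \<nu>_pos: "\<nu> > 0" and \<kappa>_pos: "\<kappa> > 0" and L_nonneg: "L \<ge> 0" and M_pos: "M > 0"
begin

declare SigmaE [rule del] SigmaE2 [rule del] mem_Times_iff [simp]

lemma subspace_V: "subspace V" and subspace_W: "subspace W"
  using fin_V fin_W by (auto simp: fin_dim_subspace_def)

lemmas V_simps [simp] = subspace_0[OF subspace_V] subspace_add[OF subspace_V]
  subspace_scale[OF subspace_V] subspace_diff[OF subspace_V]
lemmas W_simps [simp] = subspace_0[OF subspace_W] subspace_add[OF subspace_W]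
  subspace_scale[OF subspace_W] subspace_diff[OF subspace_W]

lemma b_add3: "\<lbrakk>u \<in> V; v \<in> V; w \<in> V; w' \<in> V\<rbrakk> \<Longrightarrow> b u v (w + w') = b u v w + b u v w'"
  using b_skew b_add2 by (metis minus_add_distrib)

lemma b_scale3: "\<lbrakk>u \<in> V; v \<in> V; w \<in> V\<rbrakk> \<Longrightarrow> b u v (r *\<^sub>R w) = r * b u v w"
  using b_skew b_scale2 by (metis mult_minus_right)

lemma bs_add3: "\<lbrakk>u \<in> V; s \<in> W; t \<in> W; t' \<in> W\<rbrakk> \<Longrightarrow> bs u s (t + t') = bs u s t + bs u s t'"
  using bs_skew bs_add2 by (metis minus_add_distrib)

lemma bs_scale3: "\<lbrakk>u \<in> V; s \<in> W; t \<in> W\<rbrakk> \<Longrightarrow> bs u s (r *\<^sub>R t) = r * bs u s t"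
  using bs_skew bs_scale2 by (metis mult_minus_right)

lemma b_diag [simp]: "b u v v = 0" and bs_diag [simp]: "bs u s s = 0"
  using b_skew[of u v v] bs_skew[of u s s] by auto

lemma b_diff2: "\<lbrakk>u \<in> V; v \<in> V; v' \<in> V; w \<in> V\<rbrakk> \<Longrightarrow> b u (v - v') w = b u v w - b u v' w"
  using b_add2[of u "v - v'" v' w] by simp

lemma bs_diff2: "\<lbrakk>u \<in> V; s \<in> W; s' \<in> W; t \<in> W\<rbrakk> \<Longrightarrow> bs u (s - s') t = bs u s t - bs u s' t"
  using bs_add2[of u "s - s'" s' t] by simp

lemma b_bound_neg:
  assumes "u \<in> V" "v \<in> V" "w \<in> V"
  shows "- b u v w \<le> M * norm (D u) * norm (D v) * norm (D w)"
  using b_bound[OF assms(1,3,2)] b_skew[of u v w] by (simp add: mult_ac)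

lemma bs_bound_neg:
  assumes "u \<in> V" "s \<in> W" "t \<in> W"
  shows "- bs u s t \<le> M * norm (D u) * norm (E s) * norm (E t)"
  using bs_bound[OF assms(1,3,2)] bs_skew[of u s t] by (simp add: mult_ac)

section \<open>The linear problem: a priori bound, superposition, unique solvability\<close>

definition linear_V :: "('v \<Rightarrow> real) \<Rightarrow> bool" where
  "linear_V F \<longleftrightarrow> (\<forall>v\<in>V. \<forall>w\<in>V. F (v + w) = F v + F w) \<and> (\<forall>r. \<forall>v\<in>V. F (r *\<^sub>R v) = r * F v)"

definition linear_W :: "('w \<Rightarrow> real) \<Rightarrow> bool" where
  "linear_W g \<longleftrightarrow> (\<forall>s\<in>W. \<forall>t\<in>W. g (s + t) = g s + g t) \<and> (\<forall>r. \<forall>s\<in>W. g (r *\<^sub>R s) = r * g s)"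

text \<open>The common shape of the problems for \<open>G\<close>, for \<open>G'\<close> and for all
  their differences: u transports, F and g are the data.\<close>

definition solves :: "'v \<Rightarrow> ('v \<Rightarrow> real) \<Rightarrow> ('w \<Rightarrow> real) \<Rightarrow> 'v \<times> 'w \<Rightarrow> bool" where
  "solves u F g p \<longleftrightarrow> p \<in> V \<times> W
     \<and> (\<forall>v\<in>V. b u (fst p) v + \<nu> * (D (fst p) \<bullet> D v) = c (snd p) v + F v)
     \<and> (\<forall>t\<in>W. bs u (snd p) t + \<kappa> * (E (snd p) \<bullet> E t) = g t)"

lemma solves_in [simp]:
  "solves u F g p \<Longrightarrow> fst p \<in> V" "solves u F g p \<Longrightarrow> snd p \<in> W"
  by (auto simp: solves_def)

lemma solves_V:
  "\<lbrakk>solves u F g p; v \<in> V\<rbrakk> \<Longrightarrow> b u (fst p) v + \<nu> * (D (fst p) \<bullet> D v) = c (snd p) v + F v"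
  and solves_W: "\<lbrakk>solves u F g p; t \<in> W\<rbrakk> \<Longrightarrow> bs u (snd p) t + \<kappa> * (E (snd p) \<bullet> E t) = g t"
  unfolding solves_def by blast+

lemma solvesI:
  assumes "p \<in> V \<times> W"
    and "\<And>v. v \<in> V \<Longrightarrow> b u (fst p) v + \<nu> * (D (fst p) \<bullet> D v) = c (snd p) v + F v"
    and "\<And>t. t \<in> W \<Longrightarrow> bs u (snd p) t + \<kappa> * (E (snd p) \<bullet> E t) = g t"
  shows "solves u F g p"
  unfolding solves_def using assms by blast

text \<open>Test with the solution itself: the convective terms vanish by skewness. The temperature
  bound comes first and then enters the velocity bound through the buoyancy term.\<close>

lemma solves_bound:
  assumes u: "u \<in> V" and p: "solves u F g p"
    and F: "\<And>v. v \<in> V \<Longrightarrow> F v \<le> A * norm (D v)" "0 \<le> A"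
    and g: "\<And>t. t \<in> W \<Longrightarrow> g t \<le> B * norm (E t)" "0 \<le> B"
  shows "norm (E (snd p)) \<le> B / \<kappa>" "norm (D (fst p)) \<le> (L * (B / \<kappa>) + A) / \<nu>"
proof -
  \<comment> \<open>One factor x is cancelled from the energy inequality; for x = 0 the claim is the
    sign of a.\<close>
  have cancel: "x \<le> a / k" if "k * x\<^sup>2 \<le> a * x" "0 \<le> x" "0 \<le> a" "0 < k" for a k x :: real
  proof (cases "x = 0")
    case False
    then have "(k * x) * x \<le> a * x" "x > 0" using that by (auto simp: power2_eq_square mult_ac)
    then have "k * x \<le> a" by simp
    then show ?thesis using that by (simp add: pos_le_divide_eq mult.commute)
  qed (use that in auto)
  note in_p = solves_in[OF p]
  have "\<kappa> * (norm (E (snd p)))\<^sup>2 \<le> B * norm (E (snd p))"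
    using solves_W[OF p in_p(2)] g(1)[OF in_p(2)] by (simp add: dot_square_norm)
  then show 1: "norm (E (snd p)) \<le> B / \<kappa>" using g(2) \<kappa>_pos by (intro cancel) auto
  have "\<nu> * (norm (D (fst p)))\<^sup>2 = c (snd p) (fst p) + F (fst p)"
    using solves_V[OF p in_p(1)] by (simp add: dot_square_norm)
  also have "\<dots> \<le> L * norm (E (snd p)) * norm (D (fst p)) + A * norm (D (fst p))"
    using c_bound[OF in_p(2,1)] F(1)[OF in_p(1)] by simp
  also have "\<dots> \<le> (L * (B / \<kappa>) + A) * norm (D (fst p))"
    unfolding distrib_right using 1 L_nonneg by (intro add_mono mult_right_mono mult_left_mono) auto
  finally show "norm (D (fst p)) \<le> (L * (B / \<kappa>) + A) / \<nu>"
    using F(2) g(2) L_nonneg \<nu>_pos \<kappa>_pos by (intro cancel) auto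
qed

lemma solves_add:
  assumes u: "u \<in> V" and p: "solves u F g p" and q: "solves u F' g' q"
  shows "solves u (\<lambda>v. F v + F' v) (\<lambda>t. g t + g' t) (p + q)"
proof (rule solvesI)
  note m = solves_in[OF p] solves_in[OF q]
  show "p + q \<in> V \<times> W" using m by simp
  show "b u (fst (p + q)) v + \<nu> * (D (fst (p + q)) \<bullet> D v) = c (snd (p + q)) v + (F v + F' v)"
    if "v \<in> V" for v
    using solves_V[OF p that] solves_V[OF q that] u m that
    by (simp add: b_add2 c_add1 D_add inner_add_left distrib_left)
  show "bs u (snd (p + q)) t + \<kappa> * (E (snd (p + q)) \<bullet> E t) = g t + g' t" if "t \<in> W" for t
    using solves_W[OF p that] solves_W[OF q that] u m that
    by (simp add: bs_add2 E_add inner_add_left distrib_left)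
qed

lemma solves_scale:
  assumes u: "u \<in> V" and p: "solves u F g p"
  shows "solves u (\<lambda>v. r * F v) (\<lambda>t. r * g t) (r *\<^sub>R p)"
proof (rule solvesI)
  note m = solves_in[OF p]
  show "r *\<^sub>R p \<in> V \<times> W" using m by simp
  show "b u (fst (r *\<^sub>R p)) v + \<nu> * (D (fst (r *\<^sub>R p)) \<bullet> D v) = c (snd (r *\<^sub>R p)) v + r * F v"
    if "v \<in> V" for v
    using arg_cong[OF solves_V[OF p that], of "(*) r"] u m that
    by (simp add: b_scale2 c_scale1 D_scale distrib_left mult.left_commute)
  show "bs u (snd (r *\<^sub>R p)) t + \<kappa> * (E (snd (r *\<^sub>R p)) \<bullet> E t) = r * g t" if "t \<in> W" for t
    using arg_cong[OF solves_W[OF p that], of "(*) r"] u m that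
    by (simp add: bs_scale2 E_scale distrib_left mult.left_commute)
qed

lemma solves_diff:
  assumes "u \<in> V" "solves u F g p" "solves u F' g' q"
  shows "solves u (\<lambda>v. F v - F' v) (\<lambda>t. g t - g' t) (p - q)"
  using solves_add[OF assms(1,2) solves_scale[OF assms(1,3), of "-1"]] by simp

text \<open>The difference of two solutions has zero data, so the a priori bound annihilates its
  gradients.\<close>

lemma solves_unique:
  assumes "u \<in> V" "solves u F g p" "solves u F g q"
  shows "p = q"
proof -
  have s: "solves u (\<lambda>v. F v - F v) (\<lambda>t. g t - g t) (p - q)"
    by (rule solves_diff[OF assms])
  have "norm (E (snd (p - q))) \<le> 0 / \<kappa>" "norm (D (fst (p - q))) \<le> (L * (0 / \<kappa>) + 0) / \<nu>"
    using solves_bound[OF assms(1) s, of 0 0] by simp_all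
  then have "E (snd (p - q)) = 0" "D (fst (p - q)) = 0" by auto
  then have "snd (p - q) = 0" "fst (p - q) = 0"
    using D_zero[OF solves_in(1)[OF s]] E_zero[OF solves_in(2)[OF s]] by auto
  then show ?thesis by (simp add: prod_eq_iff)
qed

lemma solves_ex1:
  assumes u: "u \<in> V" and F: "linear_V F" and g: "linear_W g"
  shows "\<exists>!p. solves u F g p"
proof -
  obtain BV BW where B: "finite BV" "V = span BV" "finite BW" "W = span BW"
    using fin_V fin_W by (auto simp: fin_dim_subspace_def)
  have "\<exists>s\<in>W. \<forall>t\<in>W. bs u s t + \<kappa> * (E s \<bullet> E t) = g t"
  proof (rule positive_form_representation[OF B(3), folded B(4)], goal_cases)
    \<comment> \<open>Positivity: the skew part vanishes on the diagonal and only the diffusion term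
      is left.\<close>
    case (5 x)
    then have "E x \<noteq> 0" using E_zero by blast
    then show ?case using \<kappa>_pos by simp
  qed (use u g in \<open>simp_all add: linear_W_def bs_add2 bs_add3 bs_scale2 bs_scale3 E_add E_scale
      inner_add_left inner_add_right distrib_left mult.left_commute\<close>)
  then obtain s where s: "s \<in> W" "\<And>t. t \<in> W \<Longrightarrow> bs u s t + \<kappa> * (E s \<bullet> E t) = g t"
    by blast
  have "\<exists>v\<in>V. \<forall>w\<in>V. b u v w + \<nu> * (D v \<bullet> D w) = c s w + F w"
  proof (rule positive_form_representation[OF B(1), folded B(2)], goal_cases)
    case (5 x)
    then have "D x \<noteq> 0" using D_zero by blast
    then show ?case using \<nu>_pos by simp
  qed (use u s(1) F in \<open>simp_all add: linear_V_def b_add2 b_add3 b_scale2 b_scale3 D_add D_scale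
      c_add2 c_scale2 inner_add_left inner_add_right distrib_left mult.left_commute\<close>)
  then obtain v where v: "v \<in> V" "\<And>w. w \<in> V \<Longrightarrow> b u v w + \<nu> * (D v \<bullet> D w) = c s w + F w"
    by blast
  have "solves u F g (v, s)" using s v by (intro solvesI) simp_all
  then show ?thesis using solves_unique[OF u] by blast
qed

definition N :: "'v \<times> 'w \<Rightarrow> real" where
  "N p = sqrt (\<nu> * (norm (D (fst p)))\<^sup>2 + \<kappa> * (norm (E (snd p)))\<^sup>2)"

lemma N_nonneg [simp]: "0 \<le> N p"
  using \<nu>_pos \<kappa>_pos by (simp add: N_def)

text \<open>The estimates below measure an increment h by \<open>norm (D (fst h))\<close>; this
  converts them to \<open>N h\<close>.\<close>

lemma N_ge: "sqrt \<nu> * norm (D (fst p)) \<le> N p"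
proof -
  have "sqrt \<nu> * norm (D (fst p)) = sqrt (\<nu> * (norm (D (fst p)))\<^sup>2)"
    by (simp add: real_sqrt_mult)
  also have "\<dots> \<le> N p" unfolding N_def using \<kappa>_pos by (intro real_sqrt_le_mono) simp
  finally show ?thesis .
qed

end

text \<open>\<Phi> and \<Gamma> stand for the dual norms of the data f and \<gamma>, and
  \<open>L_small\<close> for the smallness condition on Ri.\<close>

locale boussinesq = coupled_convection +
  fixes F0 :: "'a \<Rightarrow> real" and g0 :: "'b \<Rightarrow> real" and \<Phi> \<Gamma> :: real
  assumes F0: "linear_V F0" and g0: "linear_W g0"
    and F0_bound: "v \<in> V \<Longrightarrow> F0 v \<le> \<Phi> * norm (D v)" and \<Phi>: "0 \<le> \<Phi>"
    and g0_bound: "t \<in> W \<Longrightarrow> g0 t \<le> \<Gamma> * norm (E t)" and \<Gamma>: "0 \<le> \<Gamma>"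
    and L_small: "L < min \<nu> \<kappa>"
begin

section \<open>The solution operator and its derivative\<close>

definition G where "G p = (THE q. solves (fst p) F0 g0 q)"

text \<open>The terms transported by h involve the known \<open>G p\<close>; on the right-hand side
  they serve as data, which makes this an instance of \<open>solves\<close>.\<close>

definition G' where
  "G' p h = (THE q. solves (fst p) (\<lambda>v. - b (fst h) (fst (G p)) v) (\<lambda>t. - bs (fst h) (snd (G p)) t) q)"

definition K1 where "K1 = (L * (\<Gamma> / \<kappa>) + \<Phi>) / \<nu>"
definition K2 where "K2 = \<Gamma> / \<kappa>"
text \<open>\<open>C1\<close> and \<open>C2\<close> are what \<open>solves_bound\<close> yields per
  unit of H for data of size \<open>M * K1 * H\<close> and \<open>M * K2 * H\<close>. They bound
  \<open>G'\<close> and the increments of \<open>G\<close> alike.\<close>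

definition C2 where "C2 = M * K2 / \<kappa>"
definition C1 where "C1 = (L * C2 + M * K1) / \<nu>"

lemma K_nonneg [simp]: "0 \<le> K1" "0 \<le> K2" "0 \<le> C1" "0 \<le> C2"
  using \<nu>_pos \<kappa>_pos L_nonneg M_pos \<Phi> \<Gamma> by (auto simp: K1_def K2_def C1_def C2_def)

lemma G_solves: "p \<in> V \<times> W \<Longrightarrow> solves (fst p) F0 g0 (G p)"
  unfolding G_def by (rule theI'[OF solves_ex1[OF _ F0 g0]]) simp

lemma G_in [simp]: "p \<in> V \<times> W \<Longrightarrow> fst (G p) \<in> V" "p \<in> V \<times> W \<Longrightarrow> snd (G p) \<in> W"
  using solves_in[OF G_solves] by auto

lemma G'_solves:
  assumes "p \<in> V \<times> W" "h \<in> V \<times> W"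
  shows "solves (fst p) (\<lambda>v. - b (fst h) (fst (G p)) v) (\<lambda>t. - bs (fst h) (snd (G p)) t) (G' p h)"
proof -
  have "fst p \<in> V" "fst h \<in> V" using assms by auto
  then show ?thesis
    unfolding G'_def using G_in[OF assms(1)]
    by (intro theI'[OF solves_ex1])
      (simp_all add: linear_V_def linear_W_def b_add3 b_scale3 bs_add3 bs_scale3)
qed

lemma G'_in [simp]:
  assumes "p \<in> V \<times> W" "h \<in> V \<times> W"
  shows "fst (G' p h) \<in> V" "snd (G' p h) \<in> W"
  using solves_in[OF G'_solves[OF assms]] by auto

lemma G_bound:
  assumes "p \<in> V \<times> W"
  shows "norm (D (fst (G p))) \<le> K1" "norm (E (snd (G p))) \<le> K2"
  using solves_bound[OF _ G_solves[OF assms] F0_bound \<Phi> g0_bound \<Gamma>] assms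
  by (auto simp: K1_def K2_def)

lemma solves_bound_C:
  assumes "u \<in> V" "solves u F g p" "0 \<le> H"
    and "\<And>v. v \<in> V \<Longrightarrow> F v \<le> M * K1 * H * norm (D v)"
    and "\<And>t. t \<in> W \<Longrightarrow> g t \<le> M * K2 * H * norm (E t)"
  shows "norm (D (fst p)) \<le> C1 * H" "norm (E (snd p)) \<le> C2 * H"
  using solves_bound[OF assms(1,2,4) _ assms(5)] assms(3) M_pos
  by (auto simp: C1_def C2_def field_simps)

text \<open>Since \<open>L / \<kappa> < 1\<close>, the velocity component is at most \<open>\<nu>\<^sup>-\<^sup>1 M H (k1 + k2)\<close>; then
  \<open>(k1 + k2)\<^sup>2 \<le> 2 k1\<^sup>2 + 2 k2\<^sup>2\<close>, and the third \<open>k2\<^sup>2\<close> comes from the temperature component.\<close>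

lemma solves_N_bound:
  assumes u: "u \<in> V" and p: "solves u F g p" and nn: "0 \<le> k1" "0 \<le> k2" "0 \<le> H"
    and F: "\<And>v. v \<in> V \<Longrightarrow> F v \<le> M * k1 * H * norm (D v)"
    and g: "\<And>t. t \<in> W \<Longrightarrow> g t \<le> M * k2 * H * norm (E t)"
  shows "N p \<le> \<nu> powr (-1/2) * min \<nu> \<kappa> powr (-1/2) * M * sqrt (2 * k1\<^sup>2 + 3 * k2\<^sup>2) * (sqrt \<nu> * H)"
proof -
  define \<eta> where "\<eta> = min \<nu> \<kappa>"
  have \<eta>: "\<eta> > 0" "\<eta> \<le> \<nu>" "\<eta> \<le> \<kappa>" "L < \<eta>"
    using \<nu>_pos \<kappa>_pos L_small by (auto simp: \<eta>_def)
  have E: "norm (E (snd p)) \<le> M * k2 * H / \<kappa>"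
    and D: "norm (D (fst p)) \<le> (L * (M * k2 * H / \<kappa>) + M * k1 * H) / \<nu>"
    using solves_bound[OF u p F _ g] nn M_pos by auto
  have "L * (M * k2 * H / \<kappa>) = L / \<kappa> * (M * k2 * H)" by simp
  also have "\<dots> \<le> 1 * (M * k2 * H)"
    using \<eta> nn M_pos \<kappa>_pos by (intro mult_right_mono) auto
  finally have "norm (D (fst p)) \<le> (M * H) * (k1 + k2) / \<nu>"
    by (intro order_trans[OF D] divide_right_mono) (use \<nu>_pos in \<open>auto simp: algebra_simps\<close>)
  then have "(norm (D (fst p)))\<^sup>2 \<le> ((M * H) * (k1 + k2) / \<nu>)\<^sup>2" by (intro power_mono) auto
  then have "\<nu> * (norm (D (fst p)))\<^sup>2 \<le> \<nu> * ((M * H) * (k1 + k2) / \<nu>)\<^sup>2"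
    using \<nu>_pos by (intro mult_left_mono) auto
  also have "\<dots> = (M * H)\<^sup>2 * ((k1 + k2)\<^sup>2 / \<nu>)"
    using \<nu>_pos by (simp add: power2_eq_square field_simps)
  also have "\<dots> \<le> (M * H)\<^sup>2 * ((2 * k1\<^sup>2 + 2 * k2\<^sup>2) / \<eta>)"
  proof (intro mult_left_mono frac_le)
    have "0 \<le> (k1 - k2)\<^sup>2" by simp
    then show "(k1 + k2)\<^sup>2 \<le> 2 * k1\<^sup>2 + 2 * k2\<^sup>2" by (simp add: power2_eq_square algebra_simps)
  qed (use \<eta> in auto)
  finally have 1: "\<nu> * (norm (D (fst p)))\<^sup>2 \<le> (M * H)\<^sup>2 * ((2 * k1\<^sup>2 + 2 * k2\<^sup>2) / \<eta>)" .
  have "\<kappa> * (norm (E (snd p)))\<^sup>2 \<le> \<kappa> * (M * k2 * H / \<kappa>)\<^sup>2"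
    using E \<kappa>_pos by (intro mult_left_mono power_mono) auto
  also have "\<dots> = (M * H)\<^sup>2 * (k2\<^sup>2 / \<kappa>)"
    using \<kappa>_pos by (simp add: power2_eq_square field_simps)
  also have "\<dots> \<le> (M * H)\<^sup>2 * (k2\<^sup>2 / \<eta>)"
    using \<eta> by (intro mult_left_mono frac_le) auto
  finally have 2: "\<kappa> * (norm (E (snd p)))\<^sup>2 \<le> (M * H)\<^sup>2 * (k2\<^sup>2 / \<eta>)" .
  have "\<nu> * (norm (D (fst p)))\<^sup>2 + \<kappa> * (norm (E (snd p)))\<^sup>2
      \<le> (M * H)\<^sup>2 * ((2 * k1\<^sup>2 + 3 * k2\<^sup>2) / \<eta>)"
    using add_mono[OF 1 2] by (simp add: algebra_simps add_divide_distrib)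
  then have "N p \<le> sqrt ((M * H)\<^sup>2 * ((2 * k1\<^sup>2 + 3 * k2\<^sup>2) / \<eta>))"
    unfolding N_def by (rule real_sqrt_le_mono)
  also have "\<dots> = M * H * sqrt (2 * k1\<^sup>2 + 3 * k2\<^sup>2) / sqrt \<eta>"
    using nn M_pos by (simp add: real_sqrt_mult real_sqrt_divide)
  \<comment> \<open>The factors \<open>\<nu> powr (-1/2)\<close> and \<open>sqrt \<nu>\<close>
    cancel; they are inserted so that \<open>N_ge\<close> can absorb
    \<open>sqrt \<nu> * H\<close>.\<close>
  also have "\<dots> = \<nu> powr (-1/2) * \<eta> powr (-1/2) * M * sqrt (2 * k1\<^sup>2 + 3 * k2\<^sup>2) * (sqrt \<nu> * H)"
    using \<nu>_pos \<eta> by (simp add: powr_minus_divide powr_half_sqrt field_simps)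
  finally show ?thesis unfolding \<eta>_def .
qed

lemma trilinear_mono:
  assumes "x \<le> X" "0 \<le> h" "0 \<le> y"
  shows "M * h * x * y \<le> M * X * h * y"
proof -
  have "M * h * x * y = x * (M * h * y)" by simp
  also have "\<dots> \<le> X * (M * h * y)" using assms M_pos by (intro mult_right_mono) auto
  finally show ?thesis by (simp add: mult_ac)
qed

lemma b_le:
  assumes "h \<in> V" "x \<in> V" "v \<in> V" "norm (D x) \<le> X"
  shows "- b h x v \<le> M * X * norm (D h) * norm (D v)"
  using b_bound_neg[OF assms(1-3)] trilinear_mono[OF assms(4), of "norm (D h)" "norm (D v)"] by simp

lemma bs_le:
  assumes "h \<in> V" "x \<in> W" "t \<in> W" "norm (E x) \<le> X"
  shows "- bs h x t \<le> M * X * norm (D h) * norm (E t)"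
  using bs_bound_neg[OF assms(1-3)] trilinear_mono[OF assms(4), of "norm (D h)" "norm (E t)"] by simp

lemma G'_bound:
  assumes "p \<in> V \<times> W" "h \<in> V \<times> W"
  shows "norm (D (fst (G' p h))) \<le> C1 * norm (D (fst h))"
    "norm (E (snd (G' p h))) \<le> C2 * norm (D (fst h))"
  using assms G_bound[OF assms(1)]
  by (auto intro!: solves_bound_C[OF _ G'_solves[OF assms]] b_le bs_le)

text \<open>The data of the derivative problem contain \<open>G p\<close>, whose gradients are at
  most \<open>K1\<close> and \<open>K2\<close>; these become k1 and k2 in
  \<open>solves_N_bound\<close>.\<close>

lemma G'_N_bound:
  assumes "p \<in> V \<times> W" "h \<in> V \<times> W"
  shows "N (G' p h)
    \<le> \<nu> powr (-1/2) * min \<nu> \<kappa> powr (-1/2) * M * sqrt (2 * K1\<^sup>2 + 3 * K2\<^sup>2) * N h"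
proof -
  have "N (G' p h) \<le> \<nu> powr (-1/2) * min \<nu> \<kappa> powr (-1/2) * M * sqrt (2 * K1\<^sup>2 + 3 * K2\<^sup>2)
      * (sqrt \<nu> * norm (D (fst h)))"
    using assms G_bound[OF assms(1)]
    by (intro solves_N_bound[OF _ G'_solves[OF assms]]) (auto intro!: b_le bs_le)
  also have "\<dots> \<le> \<nu> powr (-1/2) * min \<nu> \<kappa> powr (-1/2) * M * sqrt (2 * K1\<^sup>2 + 3 * K2\<^sup>2) * N h"
    using N_ge M_pos by (intro mult_left_mono) auto
  finally show ?thesis .
qed

text \<open>Linearity in the transporting velocity: a change of u is paid for in the data. This
  makes problems with different velocities comparable.\<close>

lemma solves_shift:
  assumes "u \<in> V" "h \<in> V" "solves u F g q"
  shows "solves (u + h) (\<lambda>v. b h (fst q) v + F v) (\<lambda>t. bs h (snd q) t + g t) q"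
proof (rule solvesI)
  note m = solves_in[OF assms(3)]
  show "q \<in> V \<times> W" using m by simp
  show "b (u + h) (fst q) v + \<nu> * (D (fst q) \<bullet> D v) = c (snd q) v + (b h (fst q) v + F v)"
    if "v \<in> V" for v
    using solves_V[OF assms(3) that] assms m that by (simp add: b_add1)
  show "bs (u + h) (snd q) t + \<kappa> * (E (snd q) \<bullet> E t) = bs h (snd q) t + g t" if "t \<in> W" for t
    using solves_W[OF assms(3) that] assms m that by (simp add: bs_add1)
qed

lemma solves_cong:
  assumes "solves u F g p" "\<And>v. v \<in> V \<Longrightarrow> F v = F' v" "\<And>t. t \<in> W \<Longrightarrow> g t = g' t"
  shows "solves u F' g' p"
proof (rule solvesI)
  show "p \<in> V \<times> W" using solves_in[OF assms(1)] by simp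
qed (simp_all only: solves_V[OF assms(1)] solves_W[OF assms(1)] assms(2,3))

text \<open>Shift the problem for \<open>G p\<close> to the velocity of \<open>p + h\<close> and
  subtract: \<open>F0\<close> and \<open>g0\<close> cancel and only the shift terms remain.\<close>

lemma G_diff_solves:
  assumes "p \<in> V \<times> W" "h \<in> V \<times> W"
  shows "solves (fst p + fst h) (\<lambda>v. - b (fst h) (fst (G p)) v) (\<lambda>t. - bs (fst h) (snd (G p)) t)
    (G (p + h) - G p)"
proof -
  have u: "fst p \<in> V" "fst h \<in> V" and ph: "p + h \<in> V \<times> W" using assms by simp_all
  have "solves (fst p + fst h) F0 g0 (G (p + h))" using G_solves[OF ph] by simp
  from solves_diff[OF V_simps(2)[OF u] this solves_shift[OF u G_solves[OF assms(1)]]]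
  show ?thesis by (rule solves_cong) simp_all
qed

lemma G_diff_bound:
  assumes "p \<in> V \<times> W" "h \<in> V \<times> W"
  shows "norm (D (fst (G (p + h) - G p))) \<le> C1 * norm (D (fst h))"
    "norm (E (snd (G (p + h) - G p))) \<le> C2 * norm (D (fst h))"
proof -
  have u: "fst p + fst h \<in> V" "fst h \<in> V" using assms by simp_all
  show "norm (D (fst (G (p + h) - G p))) \<le> C1 * norm (D (fst h))"
    "norm (E (snd (G (p + h) - G p))) \<le> C2 * norm (D (fst h))"
    using u G_bound[OF assms(1)] G_in[OF assms(1)]
    by (intro solves_bound_C[OF _ G_diff_solves[OF assms]] b_le bs_le; simp)+
qed

text \<open>Shifting the problem for the increment of \<open>G\<close> back by -h produces the data
  of \<open>G' p h\<close> plus terms in h and the increment. The former cancel; the latter are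
  quadratic in h.\<close>

lemma remainder_solves:
  assumes "p \<in> V \<times> W" "h \<in> V \<times> W"
  shows "solves (fst p) (\<lambda>v. - b (fst h) (fst (G (p + h) - G p)) v)
    (\<lambda>t. - bs (fst h) (snd (G (p + h) - G p)) t) (G (p + h) - G p - G' p h)"
proof -
  let ?e = "G (p + h) - G p"
  have u: "fst p \<in> V" "fst h \<in> V" and ph: "p + h \<in> V \<times> W" using assms by auto
  have n: "-1 *\<^sub>R fst h \<in> V" using u by (intro V_simps)
  have e: "fst ?e \<in> V" "snd ?e \<in> W" using G_in[OF ph] G_in[OF assms(1)] by simp_all
  have "solves (fst p + fst h + -1 *\<^sub>R fst h)
      (\<lambda>v. b (-1 *\<^sub>R fst h) (fst ?e) v + - b (fst h) (fst (G p)) v)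
      (\<lambda>t. bs (-1 *\<^sub>R fst h) (snd ?e) t + - bs (fst h) (snd (G p)) t) ?e"
    by (rule solves_shift[OF _ n G_diff_solves[OF assms]]) (use u in simp)
  then have "solves (fst p)
      (\<lambda>v. b (-1 *\<^sub>R fst h) (fst ?e) v + - b (fst h) (fst (G p)) v)
      (\<lambda>t. bs (-1 *\<^sub>R fst h) (snd ?e) t + - bs (fst h) (snd (G p)) t) ?e"
    by simp
  from solves_diff[OF u(1) this G'_solves[OF assms]] show ?thesis
    by (rule solves_cong) 
      (use b_scale1[OF u(2) e(1), of _ "-1"] bs_scale1[OF u(2) e(2), of _ "-1"] in simp_all)
qed

text \<open>The constant of \<open>solves_N_bound\<close> with \<open>C1\<close> and
  \<open>C2\<close> as k1 and k2. The final division supplies the second \<open>sqrt \<nu>\<close>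
  for a bound bilinear in two increments.\<close>

definition C3 where
  "C3 = \<nu> powr (-1/2) * min \<nu> \<kappa> powr (-1/2) * M * sqrt (2 * C1\<^sup>2 + 3 * C2\<^sup>2) / sqrt \<nu>"

lemma C3_nonneg [simp]: "0 \<le> C3"
  using M_pos \<nu>_pos by (simp add: C3_def)

lemma C3_bound:
  assumes u: "u \<in> V" and p: "solves u F g p" and nn: "0 \<le> d" "0 \<le> H"
    and F: "\<And>v. v \<in> V \<Longrightarrow> F v \<le> M * (C1 * d) * H * norm (D v)"
    and g: "\<And>t. t \<in> W \<Longrightarrow> g t \<le> M * (C2 * d) * H * norm (E t)"
  shows "N p \<le> C3 * (sqrt \<nu> * d) * (sqrt \<nu> * H)"
proof -
  have "N p \<le> \<nu> powr (-1/2) * min \<nu> \<kappa> powr (-1/2) * M * sqrt (2 * (C1 * d)\<^sup>2 + 3 * (C2 * d)\<^sup>2) * (sqrt \<nu> * H)"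
    using nn by (intro solves_N_bound[OF u p]) (auto intro: F g)
  also have "2 * (C1 * d)\<^sup>2 + 3 * (C2 * d)\<^sup>2 = (2 * C1\<^sup>2 + 3 * C2\<^sup>2) * d\<^sup>2"
    by (simp add: power_mult_distrib algebra_simps)
  also have "sqrt \<dots> = sqrt (2 * C1\<^sup>2 + 3 * C2\<^sup>2) * d"
    using nn by (simp add: real_sqrt_mult)
  finally show ?thesis using \<nu>_pos by (simp add: C3_def mult_ac)
qed

lemma remainder_bound:
  assumes "p \<in> V \<times> W" "h \<in> V \<times> W"
  shows "N (G (p + h) - G p - G' p h) \<le> C3 * N h * N h"
proof -
  have ph: "p + h \<in> V \<times> W" using assms by auto
  let ?d = "norm (D (fst h))"
  have "N (G (p + h) - G p - G' p h) \<le> C3 * (sqrt \<nu> * ?d) * (sqrt \<nu> * ?d)"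
    using assms ph G_diff_bound[OF assms] G_in[OF ph] G_in[OF assms(1)]
    by (intro C3_bound[OF _ remainder_solves[OF assms]]) (auto intro!: b_le bs_le)
  also have "\<dots> \<le> C3 * N h * N h"
    using N_ge \<nu>_pos by (intro mult_mono mult_nonneg_nonneg order_refl) auto
  finally show ?thesis .
qed

text \<open>Two data terms of equal size arise, one from the change of \<open>G\<close> at the base
  point and one from the change of transporting velocity, hence the factor 2.\<close>

lemma G'_lipschitz:
  assumes "p \<in> V \<times> W" "q \<in> V \<times> W" "h \<in> V \<times> W"
  shows "N (G' (p + h) q - G' p q) \<le> 2 * C3 * N h * N q"
proof -
  have u: "fst p \<in> V" "fst h \<in> V" "fst q \<in> V" and ph: "p + h \<in> V \<times> W" using assms by simp_all
  let ?e = "G (p + h) - G p"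
  have e: "fst ?e \<in> V" "snd ?e \<in> W" using G_in[OF ph] G_in[OF assms(1)] by auto
  have q': "solves (fst p + fst h) (\<lambda>v. - b (fst q) (fst (G (p + h))) v)
      (\<lambda>t. - bs (fst q) (snd (G (p + h))) t) (G' (p + h) q)"
    using G'_solves[OF ph assms(2)] by simp
  have 1: "solves (fst p + fst h)
    (\<lambda>v. - b (fst q) (fst ?e) v - b (fst h) (fst (G' p q)) v)
    (\<lambda>t. - bs (fst q) (snd ?e) t - bs (fst h) (snd (G' p q)) t) (G' (p + h) q - G' p q)"
    by (rule solves_cong[OF solves_diff[OF _ q' solves_shift[OF u(1,2) G'_solves[OF assms(1,2)]]]])
      (use u ph assms G_in[OF ph] G_in[OF assms(1)] in \<open>simp_all add: b_diff2 bs_diff2\<close>)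
  let ?d = "norm (D (fst h))" and ?r = "norm (D (fst q))"
  have "N (G' (p + h) q - G' p q) \<le> C3 * (sqrt \<nu> * (2 * ?d)) * (sqrt \<nu> * ?r)"
  proof (rule C3_bound[OF _ 1])
    fix v assume v: "v \<in> V"
    have "- b (fst q) (fst ?e) v \<le> M * (C1 * ?d) * ?r * norm (D v)"
      using u v e G_diff_bound[OF assms(1,3)] by (intro b_le) auto
    moreover have "- b (fst h) (fst (G' p q)) v \<le> M * (C1 * ?r) * ?d * norm (D v)"
      using u v assms G'_bound[OF assms(1,2)] by (intro b_le) auto
    ultimately show "- b (fst q) (fst ?e) v - b (fst h) (fst (G' p q)) v
        \<le> M * (C1 * (2 * ?d)) * ?r * norm (D v)"
      by (simp add: algebra_simps)
  next
    fix v assume v: "v \<in> W"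
    have "- bs (fst q) (snd ?e) v \<le> M * (C2 * ?d) * ?r * norm (E v)"
      using u v e G_diff_bound[OF assms(1,3)] by (intro bs_le) auto
    moreover have "- bs (fst h) (snd (G' p q)) v \<le> M * (C2 * ?r) * ?d * norm (E v)"
      using u v assms G'_bound[OF assms(1,2)] by (intro bs_le) auto
    ultimately show "- bs (fst q) (snd ?e) v - bs (fst h) (snd (G' p q)) v
        \<le> M * (C2 * (2 * ?d)) * ?r * norm (E v)"
      by (simp add: algebra_simps)
  qed (use u in auto)
  also have "\<dots> = 2 * C3 * (sqrt \<nu> * ?d) * (sqrt \<nu> * ?r)" by simp
  also have "\<dots> \<le> 2 * C3 * N h * N q"
    using N_ge \<nu>_pos by (intro mult_mono mult_nonneg_nonneg order_refl) auto
  finally show ?thesis .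
qed

lemma G_has_frechet_derivative:
  assumes p: "p \<in> V \<times> W"
  shows "has_frechet_derivative_on N (V \<times> W) G (G' p) p"
  unfolding has_frechet_derivative_on_def
proof (intro conjI ballI allI impI)
  have u: "fst p \<in> V" using p by auto
  fix h assume h: "h \<in> V \<times> W"
  show "G' p h \<in> V \<times> W" using G'_in[OF p h] by (simp add: mem_Times_iff)
  fix r
  \<comment> \<open>Linearity of \<open>G' p\<close> comes from uniqueness: the multiple, and below
    the sum, solves the problem that defines the other side.\<close>
  have "solves (fst p) (\<lambda>v. - b (fst (r *\<^sub>R h)) (fst (G p)) v) (\<lambda>t. - bs (fst (r *\<^sub>R h)) (snd (G p)) t)
      (r *\<^sub>R G' p h)"
    by (rule solves_cong[OF solves_scale[OF u G'_solves[OF p h]]])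
      (use h p in \<open>auto simp: b_scale1 bs_scale1\<close>)
  moreover have "r *\<^sub>R h \<in> V \<times> W" using h by auto
  ultimately show "G' p (r *\<^sub>R h) = r *\<^sub>R G' p h"
    using solves_unique[OF u G'_solves[OF p]] by blast
next
  have u: "fst p \<in> V" using p by auto
  fix h k assume h: "h \<in> V \<times> W" and k: "k \<in> V \<times> W"
  have "solves (fst p) (\<lambda>v. - b (fst (h + k)) (fst (G p)) v) (\<lambda>t. - bs (fst (h + k)) (snd (G p)) t)
      (G' p h + G' p k)"
    by (rule solves_cong[OF solves_add[OF u G'_solves[OF p h] G'_solves[OF p k]]])
      (use h k p in \<open>auto simp: b_add1 bs_add1\<close>)
  moreover have "h + k \<in> V \<times> W" using h k by auto
  ultimately show "G' p (h + k) = G' p h + G' p k"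
    using solves_unique[OF u G'_solves[OF p]] by blast
next
  show "\<exists>C. \<forall>h\<in>V \<times> W. N (G' p h) \<le> C * N h"
    using G'_N_bound[OF p] by blast
next
  fix \<epsilon> :: real assume \<epsilon>: "\<epsilon> > 0"
  show "\<exists>\<delta>>0. \<forall>h\<in>V \<times> W. N h < \<delta> \<longrightarrow> N (G (p + h) - G p - G' p h) \<le> \<epsilon> * N h"
  proof (intro exI conjI ballI impI)
    \<comment> \<open>The remainder is at most \<open>C3 * N h * N h\<close>; the added 1 keeps the
      denominator positive when \<open>C3\<close> is 0.\<close>
    show "\<epsilon> / (C3 + 1) > 0" using \<epsilon> by (simp add: add_nonneg_pos)
    fix h assume h: "h \<in> V \<times> W" "N h < \<epsilon> / (C3 + 1)"
    have "C3 * N h \<le> (C3 + 1) * N h" by (intro mult_right_mono) auto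
    also have "\<dots> \<le> \<epsilon>"
      using h(2) by (simp add: add_nonneg_pos pos_less_divide_eq mult.commute less_imp_le)
    finally have "C3 * N h * N h \<le> \<epsilon> * N h" by (intro mult_right_mono) auto
    then show "N (G (p + h) - G p - G' p h) \<le> \<epsilon> * N h"
      using remainder_bound[OF p h(1)] by linarith
  qed
qed

end


section \<open>The Boussinesq forms\<close>

definition conv_integrand :: "'n::finite point set \<Rightarrow> 'n vfield \<Rightarrow> 'n sfield \<Rightarrow> 'n sfield \<Rightarrow> 'n point \<Rightarrow> real" where
  "conv_integrand \<Omega> v \<phi> \<psi> x = (\<Sum>j\<in>UNIV. fun_of (v $ j) x * fun_of (grad \<Omega> \<phi> $ j) x) * fun_of \<psi> x"

lemma conv_integrand_measurable [measurable]: "conv_integrand \<Omega> v \<phi> \<psi> \<in> borel_measurable borel"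
  unfolding conv_integrand_def[abs_def] using fun_of_measurable by simp

lemma conv_form_eq: "conv_form \<Omega> v \<phi> \<psi> = (LINT x:\<Omega>|lborel. conv_integrand \<Omega> v \<phi> \<psi> x)"
  by (simp add: conv_form_def conv_integrand_def)

section \<open>Dual norms and the pairings they control\<close>

lemma H10_vec_nth: "v \<in> H10_vec \<Omega> \<Longrightarrow> v $ i \<in> H10 \<Omega>"
  by (simp add: H10_vec_def)

text \<open>The real supremum that defines the dual norm dominates its members only if the set is
  bounded above.\<close>

lemma Hm1_quotient_bdd_above:
  assumes l: "l \<in> Hm1 \<Omega>"
  shows "bdd_above ((\<lambda>w. l w / norm (grad \<Omega> w)) ` H10 \<Omega>)"
proof -
  obtain C where C: "\<And>u. u \<in> H10 \<Omega> \<Longrightarrow> \<bar>l u\<bar> \<le> C * norm (grad \<Omega> u)"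
    using l unfolding Hm1_def by blast
  show ?thesis
  proof (rule bdd_aboveI2)
    fix u assume "u \<in> H10 \<Omega>"
    then have "l u \<le> C * norm (grad \<Omega> u)" using C[of u] by simp
    \<comment> \<open>The C from \<open>Hm1\<close> may be negative if every gradient is 0.\<close>
    also have "\<dots> \<le> max C 0 * norm (grad \<Omega> u)" by (intro mult_right_mono) auto
    finally show "l u / norm (grad \<Omega> u) \<le> max C 0"
      by (cases "grad \<Omega> u = 0") (auto simp: pos_divide_le_eq)
  qed
qed

text \<open>Where the gradient vanishes the quotient is 0 by convention and carries no information;
  there membership in \<open>Hm1\<close> forces l w = 0.\<close>

lemma Hm1_norm_bound:
  assumes l: "l \<in> Hm1 \<Omega>" and w: "w \<in> H10 \<Omega>"
  shows "l w \<le> Hm1_norm \<Omega> l * norm (grad \<Omega> w)"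
proof (cases "grad \<Omega> w = 0")
  case True
  obtain C where "\<And>u. u \<in> H10 \<Omega> \<Longrightarrow> \<bar>l u\<bar> \<le> C * norm (grad \<Omega> u)"
    using l unfolding Hm1_def by blast
  from this[OF w] True show ?thesis by simp
next
  case False
  have "l w / norm (grad \<Omega> w) \<le> Hm1_norm \<Omega> l"
    unfolding Hm1_norm_def by (rule cSUP_upper[OF w Hm1_quotient_bdd_above[OF l]])
  then show ?thesis using False by (simp add: pos_divide_le_eq)
qed

lemma norm_grad_nth_le: "norm (grad \<Omega> (v $ i)) \<le> norm (vgrad \<Omega> v)"
  using Finite_Cartesian_Product.norm_nth_le[of "vgrad \<Omega> v" i] by (simp add: vgrad_def)

text \<open>A crude constant, the sum of the componentwise ones, whose purpose is to make the
  supremum in \<open>Hm1_vec_norm\<close> meaningful.\<close>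

lemma Hm1_vec_bounded:
  assumes f: "f \<in> Hm1_vec \<Omega>"
  obtains C where "0 \<le> C" "\<And>v. v \<in> H10_vec \<Omega> \<Longrightarrow> vpair f v \<le> C * norm (vgrad \<Omega> v)"
proof -
  have "\<forall>i. \<exists>C. \<forall>u\<in>H10 \<Omega>. \<bar>(f $ i) u\<bar> \<le> C * norm (grad \<Omega> u)"
    using f by (auto simp: Hm1_vec_def Hm1_def)
  then obtain C where C: "\<And>i u. u \<in> H10 \<Omega> \<Longrightarrow> \<bar>(f $ i) u\<bar> \<le> C i * norm (grad \<Omega> u)" by metis
  have "vpair f v \<le> (\<Sum>i\<in>UNIV. max (C i) 0) * norm (vgrad \<Omega> v)" if v: "v \<in> H10_vec \<Omega>" for v
    unfolding vpair_def sum_distrib_right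
  proof (rule sum_mono)
    fix i
    have "(f $ i) (v $ i) \<le> C i * norm (grad \<Omega> (v $ i))" using C[OF H10_vec_nth[OF v], of i i] by simp
    also have "\<dots> \<le> max (C i) 0 * norm (vgrad \<Omega> v)"
      by (intro mult_mono norm_grad_nth_le) auto
    finally show "(f $ i) (v $ i) \<le> max (C i) 0 * norm (vgrad \<Omega> v)" .
  qed
  then show thesis by (intro that[of "\<Sum>i\<in>UNIV. max (C i) 0"]) (auto intro: sum_nonneg)
qed

lemma Hm1_vec_quotient_bdd_above:
  assumes f: "f \<in> Hm1_vec \<Omega>"
  shows "bdd_above ((\<lambda>v. vpair f v / norm (vgrad \<Omega> v)) ` H10_vec \<Omega>)"
proof -
  obtain C where C: "0 \<le> C" "\<And>v. v \<in> H10_vec \<Omega> \<Longrightarrow> vpair f v \<le> C * norm (vgrad \<Omega> v)"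
    using Hm1_vec_bounded[OF f] by blast
  show ?thesis
  proof (rule bdd_aboveI2)
    fix u assume "u \<in> H10_vec \<Omega>"
    then show "vpair f u / norm (vgrad \<Omega> u) \<le> C"
      using C by (cases "vgrad \<Omega> u = 0") (auto simp: pos_divide_le_eq)
  qed
qed

lemma Hm1_vec_norm_bound:
  assumes f: "f \<in> Hm1_vec \<Omega>" and w: "w \<in> H10_vec \<Omega>"
  shows "vpair f w \<le> Hm1_vec_norm \<Omega> f * norm (vgrad \<Omega> w)"
proof (cases "vgrad \<Omega> w = 0")
  case True
  obtain C where "\<And>v. v \<in> H10_vec \<Omega> \<Longrightarrow> vpair f v \<le> C * norm (vgrad \<Omega> v)"
    using Hm1_vec_bounded[OF f] by blast
  from this[OF w] True show ?thesis by simp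
next
  case False
  have "vpair f w / norm (vgrad \<Omega> w) \<le> Hm1_vec_norm \<Omega> f"
    unfolding Hm1_vec_norm_def by (rule cSUP_upper[OF w Hm1_vec_quotient_bdd_above[OF f]])
  then show ?thesis using False by (simp add: pos_divide_le_eq)
qed

text \<open>Both factors are in L^4, and (a b)^2 \<le> a^4 + b^4.\<close>

lemma H10_product_sq_integrable:
  fixes u v :: "'n::finite sfield"
  assumes card: "CARD('n) = 2 \<or> CARD('n) = 3" and "u \<in> H10 \<Omega>" "v \<in> H10 \<Omega>"
  shows "sq_integrable (\<lambda>x. fun_of u x * fun_of v x)"
proof -
  have "integrable lborel (\<lambda>x. (fun_of u x * fun_of v x)\<^sup>2)"
  proof (rule Bochner_Integration.integrable_bound)
    show "integrable lborel (\<lambda>x. (fun_of u x) ^ 4 + (fun_of v x) ^ 4)"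
      using H10_fourth_power_integrable[OF card] assms by auto
    have "(a * b)\<^sup>2 \<le> a ^ 4 + b ^ 4" for a b :: real
    proof -
      have "0 \<le> (a\<^sup>2 - b\<^sup>2)\<^sup>2" "0 \<le> (a * b)\<^sup>2" by simp_all
      moreover have "(a\<^sup>2 - b\<^sup>2)\<^sup>2 = a ^ 4 + b ^ 4 - 2 * (a * b)\<^sup>2" by algebra
      ultimately show ?thesis by linarith
    qed
    then show "AE x in lborel. norm ((fun_of u x * fun_of v x)\<^sup>2) \<le> norm ((fun_of u x) ^ 4 + (fun_of v x) ^ 4)"
      by (intro AE_I2) simp
  qed measurable
  moreover have "(\<lambda>x. fun_of u x * fun_of v x) \<in> borel_measurable lborel" by measurable
  ultimately show ?thesis by (simp add: sq_integrable_def)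
qed

section \<open>Homogeneity of the forms; the discretely divergence-free space\<close>

context
  fixes \<Omega> :: "'n::finite point set"
  assumes \<Omega>: "open \<Omega>"
begin

lemma set_integral_eq_add:
  assumes "AE x in lborel. F x = G x + H x"
    and [measurable]: "F \<in> borel_measurable borel"
    and "set_integrable lborel \<Omega> G" "set_integrable lborel \<Omega> H"
    and [measurable]: "G \<in> borel_measurable borel" "H \<in> borel_measurable borel"
  shows "(LINT x:\<Omega>|lborel. F x) = (LINT x:\<Omega>|lborel. G x) + (LINT x:\<Omega>|lborel. (H x :: real))"
proof -
  have [measurable]: "\<Omega> \<in> sets borel" using \<Omega> by simp
  have "(LINT x:\<Omega>|lborel. F x) = (LINT x:\<Omega>|lborel. G x + H x)"
    unfolding set_lebesgue_integral_def using assms(1) by (intro integral_cong_AE) auto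
  then show ?thesis using assms by simp
qed

text \<open>Scaling commutes with the integral even for non-integrable functions, whose integral is
  0; additivity is where integrability matters.\<close>

lemma set_integral_eq_scale:
  assumes "AE x in lborel. F x = c * G x"
    and [measurable]: "F \<in> borel_measurable borel" "G \<in> borel_measurable borel"
  shows "(LINT x:\<Omega>|lborel. F x) = c * (LINT x:\<Omega>|lborel. (G x :: real))"
proof -
  have [measurable]: "\<Omega> \<in> sets borel" using \<Omega> by simp
  have "(LINT x:\<Omega>|lborel. F x) = (LINT x:\<Omega>|lborel. c * G x)"
    unfolding set_lebesgue_integral_def using assms(1) by (intro integral_cong_AE) auto
  then show ?thesis by simp
qed

lemma conv_form_scale1: "conv_form \<Omega> (c *\<^sub>R u) \<phi> \<psi> = c * conv_form \<Omega> u \<phi> \<psi>"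
  unfolding conv_form_eq
proof (rule set_integral_eq_scale)
  have "AE x in lborel. \<forall>j. fun_of ((c *\<^sub>R u) $ j) x = c * fun_of (u $ j) x"
    by (intro eventually_all_finite) (use fun_of_scaleR in simp)
  then show "AE x in lborel. conv_integrand \<Omega> (c *\<^sub>R u) \<phi> \<psi> x = c * conv_integrand \<Omega> u \<phi> \<psi> x"
    by eventually_elim (simp only: conv_integrand_def sum_distrib_left sum_distrib_right mult.assoc)
qed auto

lemma conv_form_scale2:
  assumes "\<phi> \<in> H10 \<Omega>"
  shows "conv_form \<Omega> u (c *\<^sub>R \<phi>) \<psi> = c * conv_form \<Omega> u \<phi> \<psi>"
  unfolding conv_form_eq
proof (rule set_integral_eq_scale)
  have g: "grad \<Omega> (c *\<^sub>R \<phi>) = c *\<^sub>R grad \<Omega> \<phi>"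
    using assms by (intro grad_scaleR[OF \<Omega>] H10_imp_H1)
  have "AE x in lborel. \<forall>j. fun_of (grad \<Omega> (c *\<^sub>R \<phi>) $ j) x = c * fun_of (grad \<Omega> \<phi> $ j) x"
    unfolding g by (intro eventually_all_finite) (use fun_of_scaleR in simp)
  then show "AE x in lborel. conv_integrand \<Omega> u (c *\<^sub>R \<phi>) \<psi> x = c * conv_integrand \<Omega> u \<phi> \<psi> x"
    by eventually_elim
      (simp only: conv_integrand_def sum_distrib_left sum_distrib_right mult.assoc mult.left_commute)
qed auto

lemma conv_form_scale3: "conv_form \<Omega> u \<phi> (c *\<^sub>R \<psi>) = c * conv_form \<Omega> u \<phi> \<psi>"
  unfolding conv_form_eq
proof (rule set_integral_eq_scale)
  show "AE x in lborel. conv_integrand \<Omega> u \<phi> (c *\<^sub>R \<psi>) x = c * conv_integrand \<Omega> u \<phi> \<psi> x"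
    using fun_of_scaleR[of c \<psi>] by eventually_elim (simp only: conv_integrand_def mult.left_commute)
qed auto

lemma bstar_form_scale1: "bstar_form \<Omega> (c *\<^sub>R u) \<phi> \<psi> = c * bstar_form \<Omega> u \<phi> \<psi>"
  by (simp add: bstar_form_def conv_form_scale1 conv_form_scale2 conv_form_scale3 algebra_simps)

lemma bstar_form_scale2:
  assumes "\<phi> \<in> H10 \<Omega>"
  shows "bstar_form \<Omega> u (c *\<^sub>R \<phi>) \<psi> = c * bstar_form \<Omega> u \<phi> \<psi>"
  using assms by (simp add: bstar_form_def conv_form_scale1 conv_form_scale2 conv_form_scale3 algebra_simps)

lemma vgrad_add:
  assumes "u \<in> H10_vec \<Omega>" "v \<in> H10_vec \<Omega>"
  shows "vgrad \<Omega> (u + v) = vgrad \<Omega> u + vgrad \<Omega> v"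
  using assms by (simp add: vgrad_def vec_eq_iff grad_add[OF \<Omega>] H10_imp_H1 H10_vec_nth)

lemma vgrad_scaleR:
  assumes "u \<in> H10_vec \<Omega>"
  shows "vgrad \<Omega> (c *\<^sub>R u) = c *\<^sub>R vgrad \<Omega> u"
  using assms by (simp add: vgrad_def vec_eq_iff grad_scaleR[OF \<Omega>] H10_imp_H1 H10_vec_nth)

lemma divergence_add:
  assumes "u \<in> H10_vec \<Omega>" "v \<in> H10_vec \<Omega>"
  shows "divergence \<Omega> (u + v) = divergence \<Omega> u + divergence \<Omega> v"
  using assms by (simp add: divergence_def grad_add[OF \<Omega>] H10_imp_H1 H10_vec_nth sum.distrib)

lemma divergence_scaleR:
  assumes "u \<in> H10_vec \<Omega>"
  shows "divergence \<Omega> (c *\<^sub>R u) = c *\<^sub>R divergence \<Omega> u"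
  using assms by (simp add: divergence_def grad_scaleR[OF \<Omega>] H10_imp_H1 H10_vec_nth scaleR_sum_right)

lemma subspace_disc_div_free:
  assumes X: "subspace X" "X \<subseteq> H10_vec \<Omega>"
  shows "subspace (disc_div_free \<Omega> X Q)"
proof (rule subspaceI)
  have 0: "(0::'n vfield) \<in> X" using X by (simp add: subspace_0)
  then have "divergence \<Omega> (0 *\<^sub>R 0 :: 'n vfield) = 0 *\<^sub>R divergence \<Omega> 0"
    using X(2) by (intro divergence_scaleR) auto
  then show "0 \<in> disc_div_free \<Omega> X Q" using 0 by (simp add: disc_div_free_def)
next
  fix u v assume "u \<in> disc_div_free \<Omega> X Q" "v \<in> disc_div_free \<Omega> X Q"
  moreover from this have "divergence \<Omega> (u + v) = divergence \<Omega> u + divergence \<Omega> v"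
    using X(2) by (intro divergence_add) (auto simp: disc_div_free_def)
  ultimately show "u + v \<in> disc_div_free \<Omega> X Q"
    using X(1) by (auto simp: disc_div_free_def subspace_add inner_add_left)
next
  fix c u assume "u \<in> disc_div_free \<Omega> X Q"
  moreover from this have "divergence \<Omega> (c *\<^sub>R u) = c *\<^sub>R divergence \<Omega> u"
    using X(2) by (intro divergence_scaleR) (auto simp: disc_div_free_def)
  ultimately show "c *\<^sub>R u \<in> disc_div_free \<Omega> X Q"
    using X(1) by (auto simp: disc_div_free_def subspace_scale)
qed

text \<open>The zero function contributes the quotient 0 to the supremum.\<close>

lemma Hm1_norm_nonneg:
  assumes l: "l \<in> Hm1 \<Omega>" and 0: "0 \<in> H10 \<Omega>"
  shows "0 \<le> Hm1_norm \<Omega> l"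
proof -
  have "grad \<Omega> 0 = 0" using grad_scaleR[OF \<Omega> H10_imp_H1[OF 0], of 0] by simp
  then show ?thesis
    using cSUP_upper[OF 0 Hm1_quotient_bdd_above[OF l]] by (simp add: Hm1_norm_def)
qed

lemma Hm1_vec_norm_nonneg:
  assumes f: "f \<in> Hm1_vec \<Omega>" and 0: "0 \<in> H10_vec \<Omega>"
  shows "0 \<le> Hm1_vec_norm \<Omega> f"
proof -
  have "vgrad \<Omega> 0 = 0" using vgrad_scaleR[OF 0, of 0] by simp
  then show ?thesis
    using cSUP_upper[OF 0 Hm1_vec_quotient_bdd_above[OF f]] by (simp add: Hm1_vec_norm_def)
qed

end

section \<open>Integrability and additivity of the forms\<close>

context
  fixes \<Omega> :: "'n::finite point set"
  assumes card: "CARD('n) = 2 \<or> CARD('n) = 3" and \<Omega>: "open \<Omega>"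
begin

text \<open>Regrouped, each summand is a component of the gradient, in L^2, times a product of two
  functions in \<open>H10\<close>, in L^2 by the L^4 bound.\<close>

lemma conv_integrand_integrable:
  assumes "v \<in> H10_vec \<Omega>" "\<psi> \<in> H10 \<Omega>"
  shows "integrable lborel (conv_integrand \<Omega> v \<phi> \<psi>)"
proof -
  have "integrable lborel (\<lambda>x. \<Sum>j\<in>UNIV. fun_of (grad \<Omega> \<phi> $ j) x * (fun_of (v $ j) x * fun_of \<psi> x))"
    using assms
    by (intro Bochner_Integration.integrable_sum sq_integrable_mult H10_product_sq_integrable[OF card])
      (auto simp: H10_vec_def)
  also have "(\<lambda>x. \<Sum>j\<in>UNIV. fun_of (grad \<Omega> \<phi> $ j) x * (fun_of (v $ j) x * fun_of \<psi> x))
      = conv_integrand \<Omega> v \<phi> \<psi>"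
    by (simp add: conv_integrand_def fun_eq_iff sum_distrib_right mult_ac sum_distrib_left)
  finally show ?thesis .
qed

lemma conv_integrand_set_integrable:
  assumes "v \<in> H10_vec \<Omega>" "\<psi> \<in> H10 \<Omega>"
  shows "set_integrable lborel \<Omega> (conv_integrand \<Omega> v \<phi> \<psi>)"
  unfolding set_integrable_def using conv_integrand_integrable[OF assms] \<Omega>
  by (intro integrable_mult_indicator) auto

lemma conv_form_add1:
  assumes "u \<in> H10_vec \<Omega>" "v \<in> H10_vec \<Omega>" "\<psi> \<in> H10 \<Omega>"
  shows "conv_form \<Omega> (u + v) \<phi> \<psi> = conv_form \<Omega> u \<phi> \<psi> + conv_form \<Omega> v \<phi> \<psi>"
  unfolding conv_form_eq
proof (rule set_integral_eq_add[OF \<Omega>])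
  have "AE x in lborel. \<forall>j. fun_of ((u + v) $ j) x = fun_of (u $ j) x + fun_of (v $ j) x"
    by (intro eventually_all_finite) (use fun_of_add in simp)
  then show "AE x in lborel. conv_integrand \<Omega> (u + v) \<phi> \<psi> x = conv_integrand \<Omega> u \<phi> \<psi> x + conv_integrand \<Omega> v \<phi> \<psi> x"
    by eventually_elim (simp only: conv_integrand_def distrib_right sum.distrib)
qed (use assms conv_integrand_set_integrable in auto)

lemma conv_form_add2:
  assumes "u \<in> H10_vec \<Omega>" "\<phi> \<in> H10 \<Omega>" "\<phi>' \<in> H10 \<Omega>" "\<psi> \<in> H10 \<Omega>"
  shows "conv_form \<Omega> u (\<phi> + \<phi>') \<psi> = conv_form \<Omega> u \<phi> \<psi> + conv_form \<Omega> u \<phi>' \<psi>"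
  unfolding conv_form_eq
proof (rule set_integral_eq_add[OF \<Omega>])
  have g: "grad \<Omega> (\<phi> + \<phi>') = grad \<Omega> \<phi> + grad \<Omega> \<phi>'"
    using assms by (intro grad_add[OF \<Omega>] H10_imp_H1)
  have "AE x in lborel. \<forall>j. fun_of (grad \<Omega> (\<phi> + \<phi>') $ j) x = fun_of (grad \<Omega> \<phi> $ j) x + fun_of (grad \<Omega> \<phi>' $ j) x"
    unfolding g by (intro eventually_all_finite) (use fun_of_add in simp)
  then show "AE x in lborel. conv_integrand \<Omega> u (\<phi> + \<phi>') \<psi> x = conv_integrand \<Omega> u \<phi> \<psi> x + conv_integrand \<Omega> u \<phi>' \<psi> x"
    by eventually_elim (simp only: conv_integrand_def distrib_left distrib_right sum.distrib)
qed (use assms conv_integrand_set_integrable in auto)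

lemma conv_form_add3:
  assumes "u \<in> H10_vec \<Omega>" "\<psi> \<in> H10 \<Omega>" "\<psi>' \<in> H10 \<Omega>"
  shows "conv_form \<Omega> u \<phi> (\<psi> + \<psi>') = conv_form \<Omega> u \<phi> \<psi> + conv_form \<Omega> u \<phi> \<psi>'"
  unfolding conv_form_eq
proof (rule set_integral_eq_add[OF \<Omega>])
  show "AE x in lborel. conv_integrand \<Omega> u \<phi> (\<psi> + \<psi>') x = conv_integrand \<Omega> u \<phi> \<psi> x + conv_integrand \<Omega> u \<phi> \<psi>' x"
    using fun_of_add[of \<psi> \<psi>'] by eventually_elim (simp only: conv_integrand_def distrib_left)
qed (use assms conv_integrand_set_integrable in auto)

text \<open>Exchanging sum and integral requires each summand to be integrable; afterwards the
  scalar rules cover the vector form.\<close>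

lemma vconv_form_eq:
  assumes "u \<in> H10_vec \<Omega>" "w \<in> H10_vec \<Omega>"
  shows "vconv_form \<Omega> u v w = (\<Sum>i\<in>UNIV. conv_form \<Omega> u (v $ i) (w $ i))"
proof -
  have "set_integrable lborel \<Omega> (conv_integrand \<Omega> u (v $ i) (w $ i))" for i
    using assms by (intro conv_integrand_set_integrable) (auto simp: H10_vec_def)
  then show ?thesis
    unfolding vconv_form_def conv_form_eq conv_integrand_def[symmetric]
    by (simp only: set_lebesgue_integral_def set_integrable_def scaleR_sum_right)
      (rule Bochner_Integration.integral_sum)
qed

lemmas conv_simps = conv_form_add1 conv_form_add2 conv_form_add3 conv_form_scale1[OF \<Omega>]
  conv_form_scale2[OF \<Omega>] conv_form_scale3[OF \<Omega>] H10_vec_nth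

text \<open>Membership of the sum is a hypothesis here; in the application it holds because
  \<open>Vh\<close> is a subspace of \<open>H10_vec \<Omega>\<close>.\<close>

lemma b_form_add1:
  assumes "u \<in> H10_vec \<Omega>" "u' \<in> H10_vec \<Omega>" "u + u' \<in> H10_vec \<Omega>" "v \<in> H10_vec \<Omega>" "w \<in> H10_vec \<Omega>"
  shows "b_form \<Omega> (u + u') v w = b_form \<Omega> u v w + b_form \<Omega> u' v w"
  using assms by (simp add: b_form_def vconv_form_eq conv_simps sum.distrib algebra_simps)

lemma b_form_add2:
  assumes "u \<in> H10_vec \<Omega>" "v \<in> H10_vec \<Omega>" "v' \<in> H10_vec \<Omega>" "v + v' \<in> H10_vec \<Omega>" "w \<in> H10_vec \<Omega>"
  shows "b_form \<Omega> u (v + v') w = b_form \<Omega> u v w + b_form \<Omega> u v' w"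
  using assms by (simp add: b_form_def vconv_form_eq conv_simps sum.distrib algebra_simps)

lemma b_form_scale1:
  assumes "u \<in> H10_vec \<Omega>" "c *\<^sub>R u \<in> H10_vec \<Omega>" "v \<in> H10_vec \<Omega>" "w \<in> H10_vec \<Omega>"
  shows "b_form \<Omega> (c *\<^sub>R u) v w = c * b_form \<Omega> u v w"
  using assms by (simp add: b_form_def vconv_form_eq conv_simps algebra_simps flip: sum_distrib_left)

lemma b_form_scale2:
  assumes "u \<in> H10_vec \<Omega>" "v \<in> H10_vec \<Omega>" "c *\<^sub>R v \<in> H10_vec \<Omega>" "w \<in> H10_vec \<Omega>"
  shows "b_form \<Omega> u (c *\<^sub>R v) w = c * b_form \<Omega> u v w"
  using assms by (simp add: b_form_def vconv_form_eq conv_simps algebra_simps flip: sum_distrib_left)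

lemma bstar_form_add1:
  assumes "u \<in> H10_vec \<Omega>" "u' \<in> H10_vec \<Omega>" "\<phi> \<in> H10 \<Omega>" "\<psi> \<in> H10 \<Omega>"
  shows "bstar_form \<Omega> (u + u') \<phi> \<psi> = bstar_form \<Omega> u \<phi> \<psi> + bstar_form \<Omega> u' \<phi> \<psi>"
  using assms by (simp add: bstar_form_def conv_simps algebra_simps)

lemma bstar_form_add2:
  assumes "u \<in> H10_vec \<Omega>" "\<phi> \<in> H10 \<Omega>" "\<phi>' \<in> H10 \<Omega>" "\<psi> \<in> H10 \<Omega>"
  shows "bstar_form \<Omega> u (\<phi> + \<phi>') \<psi> = bstar_form \<Omega> u \<phi> \<psi> + bstar_form \<Omega> u \<phi>' \<psi>"
  using assms by (simp add: bstar_form_def conv_simps algebra_simps)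

end

lemma last_comp_add: "last_comp (s + t) = last_comp s + last_comp t"
  and last_comp_scaleR: "last_comp (r *\<^sub>R s) = r *\<^sub>R last_comp s"
  by (simp_all add: last_comp_def axis_def vec_eq_iff)

lemma last_comp_inner_le: "last_comp s \<bullet> v \<le> norm s * norm v"
proof -
  have "last_comp s \<bullet> v = s \<bullet> v $ Max UNIV" by (simp add: last_comp_def inner_axis')
  also have "\<dots> \<le> norm s * norm (v $ Max UNIV)" by (rule norm_cauchy_schwarz)
  also have "\<dots> \<le> norm s * norm v"
    by (intro mult_left_mono Finite_Cartesian_Product.norm_nth_le) simp
  finally show ?thesis .
qed

text \<open>A maximal independent subset of T lies in the span of a finite set and is therefore
  finite.\<close>

lemma fin_dim_subspace_subset:
  assumes S: "fin_dim_subspace S" and T: "subspace T" "T \<subseteq> S"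
  shows "fin_dim_subspace T"
proof -
  obtain A where A: "finite A" "S = span A" using S by (auto simp: fin_dim_subspace_def)
  obtain B where B: "B \<subseteq> T" "independent B" "T \<subseteq> span B"
    using maximal_independent_subset by blast
  have "finite B" using independent_span_bound[OF A(1) B(2)] B(1) T(2) A(2) by auto
  moreover have "T = span B" using B span_minimal[OF B(1) T(1)] by auto
  ultimately show ?thesis by (auto simp: fin_dim_subspace_def)
qed


section \<open>Differentiability of the solution operator\<close>

theorem lemma3p6:
  fixes \<Omega> :: "'n::{finite,linorder} point set"
    and \<nu> \<kappa> Ri CP M \<eta> K1 K2 :: real
    and f :: "'n vfunctional" and \<gamma> :: "'n functional"
    and Xh Vh :: "'n vfield set" and Qh Wh :: "'n sfield set"
    and G :: "'n vfield \<times> 'n sfield \<Rightarrow> 'n vfield \<times> 'n sfield"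
    and G' :: "'n vfield \<times> 'n sfield \<Rightarrow> 'n vfield \<times> 'n sfield \<Rightarrow>
               'n vfield \<times> 'n sfield"
  assumes "CARD('n) = 2 \<or> CARD('n) = 3"
    and "admissible_domain \<Omega>"
    and "CP > 0"
    and "\<forall>v\<in>H10_vec \<Omega>. norm v \<le> CP * norm (vgrad \<Omega> v)"
    and "\<forall>w\<in>H10 \<Omega>. norm w \<le> CP * norm (grad \<Omega> w)"
    and "M > 0"
    and "\<forall>u\<in>H10_vec \<Omega>. \<forall>v\<in>H10_vec \<Omega>. \<forall>w\<in>H10_vec \<Omega>.
           b_form \<Omega> u v w \<le> M * norm (vgrad \<Omega> u) * norm (vgrad \<Omega> v) * norm (vgrad \<Omega> w)"
    and "\<forall>v\<in>H10_vec \<Omega>. \<forall>\<phi>\<in>H10 \<Omega>. \<forall>\<psi>\<in>H10 \<Omega>.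
           bstar_form \<Omega> v \<phi> \<psi> \<le> M * norm (vgrad \<Omega> v) * norm (grad \<Omega> \<phi>) * norm (grad \<Omega> \<psi>)"
    and "fin_dim_subspace Xh" "Xh \<subseteq> H10_vec \<Omega>"
    and "fin_dim_subspace Qh" "Qh \<subseteq> L2_mean_zero \<Omega>"
    and "fin_dim_subspace Wh" "Wh \<subseteq> H10 \<Omega>"
    and "discrete_inf_sup \<Omega> Xh Qh"
    and "Vh = disc_div_free \<Omega> Xh Qh"
    and "\<nu> > 0" "\<kappa> > 0" "Ri > 0"
    and "\<eta> = min \<nu> \<kappa>"
    and "f \<in> Hm1_vec \<Omega>" "\<gamma> \<in> Hm1 \<Omega>"
    and "K1 = Ri * CP\<^sup>2 * inverse \<nu> * inverse \<kappa> * Hm1_norm \<Omega> \<gamma> + inverse \<nu> * Hm1_vec_norm \<Omega> f"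
    and "K2 = inverse \<kappa> * Hm1_norm \<Omega> \<gamma>"
    and "G = bouss_G \<Omega> \<nu> \<kappa> Ri f \<gamma> Vh Wh"
    and "G' = bouss_G' \<Omega> \<nu> \<kappa> Ri f \<gamma> Vh Wh"
    and "(inverse \<eta>)\<^sup>2 * M * (2 * (Ri * CP\<^sup>2 * inverse \<kappa> * Hm1_norm \<Omega> \<gamma> + Hm1_vec_norm \<Omega> f)
           + (inverse \<kappa>)\<^sup>2 * M * (Hm1_norm \<Omega> \<gamma>)\<^sup>2) < 1"
    and "inverse \<eta> * Ri * CP\<^sup>2 < 1"
  shows "(\<forall>p\<in>Vh \<times> Wh. G p \<in> Vh \<times> Wh)
    \<and> (\<forall>p\<in>Vh \<times> Wh. has_frechet_derivative_on (B_norm \<Omega> \<nu> \<kappa>) (Vh \<times> Wh) G (G' p) p)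
    \<and> (\<exists>CG'. \<forall>p\<in>Vh \<times> Wh. \<forall>q\<in>Vh \<times> Wh. \<forall>h\<in>Vh \<times> Wh.
         B_norm \<Omega> \<nu> \<kappa> (G' p h)
           \<le> \<nu> powr (-1/2) * \<eta> powr (-1/2) * M * sqrt (2 * K1\<^sup>2 + 3 * K2\<^sup>2) * B_norm \<Omega> \<nu> \<kappa> h
       \<and> B_norm \<Omega> \<nu> \<kappa> (G' (p + h) q - G' p q)
           \<le> CG' * B_norm \<Omega> \<nu> \<kappa> h * B_norm \<Omega> \<nu> \<kappa> q)"
proof -
  note card = assms(1) and CP = assms(3) and poincare_V = assms(4) and poincare_W = assms(5)
  have \<Omega>: "open \<Omega>" using assms(2) by (simp add: admissible_domain_def)
  have X: "subspace Xh" and W: "subspace Wh"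
    using assms(9,13) by (auto simp: fin_dim_subspace_def)
  have V: "subspace Vh" unfolding assms(16)
    by (rule subspace_disc_div_free[OF \<Omega> X assms(10)])
  have fin_V: "fin_dim_subspace Vh"
    using fin_dim_subspace_subset[OF assms(9) V] assms(16) by (auto simp: disc_div_free_def)
  have V10: "v \<in> H10_vec \<Omega>" if "v \<in> Vh" for v
    using that assms(10,16) by (auto simp: disc_div_free_def)
  have W10: "s \<in> H10 \<Omega>" if "s \<in> Wh" for s using that assms(14) by auto
  note VW [simp] = V10 W10 subspace_add[OF V] subspace_scale[OF V] subspace_add[OF W] subspace_scale[OF W]
  have 0: "0 \<in> H10 \<Omega>" "0 \<in> H10_vec \<Omega>" using V10 W10 subspace_0[OF V] subspace_0[OF W] by auto
  interpret A: coupled_convection Vh Wh "vgrad \<Omega>" "grad \<Omega>" "b_form \<Omega>" "bstar_form \<Omega>"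
    "\<lambda>s v. Ri * (last_comp s \<bullet> v)" \<nu> \<kappa> "Ri * CP\<^sup>2" M
  proof (unfold_locales, goal_cases)
    \<comment> \<open>Poincare's inequality: a field with zero gradient is zero.\<close>
    case 5
    then show ?case using poincare_V[rule_format, OF V10] by fastforce
  next
    case 8
    then show ?case using poincare_W[rule_format, OF W10] by fastforce
  next
    case (13 u v w)
    show ?case by (simp add: b_form_def field_simps)
  next
    case (19 u s t)
    show ?case by (simp add: bstar_form_def field_simps)
  next
    case (25 s v)
    have "Ri * (last_comp s \<bullet> v) \<le> Ri * (norm s * norm v)"
      using assms(19) by (intro mult_left_mono last_comp_inner_le) auto
    \<comment> \<open>One Poincare constant for each factor gives L =
      \<open>Ri * CP\<^sup>2\<close>.\<close>
    also have "\<dots> \<le> Ri * ((CP * norm (grad \<Omega> s)) * (CP * norm (vgrad \<Omega> v)))"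
      using assms(19) CP 25 poincare_V poincare_W by (intro mult_left_mono mult_mono) auto
    finally show ?case by (simp add: power2_eq_square mult_ac)
  qed (use fin_V assms(6-8,13,17-19) in \<open>simp_all add: vgrad_add[OF \<Omega>] vgrad_scaleR[OF \<Omega>]
      grad_add[OF \<Omega>] grad_scaleR[OF \<Omega>] H10_imp_H1 b_form_add1[OF card \<Omega>] b_form_add2[OF card \<Omega>]
      b_form_scale1[OF card \<Omega>] b_form_scale2[OF card \<Omega>] bstar_form_add1[OF card \<Omega>]
      bstar_form_add2[OF card \<Omega>] bstar_form_scale1[OF \<Omega>] bstar_form_scale2[OF \<Omega>]
      last_comp_add last_comp_scaleR inner_add_left inner_add_right distrib_left\<close>)
  interpret B: boussinesq Vh Wh "vgrad \<Omega>" "grad \<Omega>" "b_form \<Omega>" "bstar_form \<Omega>"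
    "\<lambda>s v. Ri * (last_comp s \<bullet> v)" \<nu> \<kappa> "Ri * CP\<^sup>2" M "vpair f" \<gamma>
    "Hm1_vec_norm \<Omega> f" "Hm1_norm \<Omega> \<gamma>"
  proof (unfold_locales, goal_cases)
    case 1
    have add: "(f $ i) (v $ i + w $ i) = (f $ i) (v $ i) + (f $ i) (w $ i)"
      and scale: "(f $ i) (r *\<^sub>R (v $ i)) = r * (f $ i) (v $ i)" if "v \<in> Vh" "w \<in> Vh" for i v w r
      using assms(21) V10[OF that(1)] V10[OF that(2)] by (auto simp: Hm1_vec_def Hm1_def H10_vec_def)
    show ?case
      unfolding A.linear_V_def by (simp add: vpair_def add scale sum.distrib sum_distrib_left)
  next
    case 2
    then show ?case using assms(22) W10 by (auto simp: A.linear_W_def Hm1_def)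
  next
    case 7
    \<comment> \<open>The second smallness condition multiplied by \<eta>.\<close>
    have "Ri * CP\<^sup>2 < \<eta>" using assms(17,18,20,28) by (simp add: field_simps)
    then show ?case using assms(20) by simp
  qed (use assms(21,22) 0 in \<open>auto intro: Hm1_vec_norm_bound Hm1_norm_bound
      Hm1_vec_norm_nonneg[OF \<Omega>] Hm1_norm_nonneg[OF \<Omega>]\<close>)
  \<comment> \<open>The operators are defined with both equations under a joint quantifier. Both
    spaces contain 0, so it splits into the separate quantifiers of \<open>solves\<close>.\<close>
  have ball_pair: "(\<forall>v\<in>Vh. \<forall>s\<in>Wh. P v \<and> Q s) \<longleftrightarrow> (\<forall>v\<in>Vh. P v) \<and> (\<forall>s\<in>Wh. Q s)"
    for P Q using subspace_0[OF V] subspace_0[OF W] by blast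
  have G_eq: "G = B.G"
    unfolding assms(25) bouss_G_def B.G_def A.solves_def ball_pair by (simp add: fun_eq_iff)
  \<comment> \<open>This takes the term transported by h to the right-hand side, as in the locale's
    \<open>G'\<close>.\<close>
  have move: "x + y + z = w \<longleftrightarrow> y + z = w + - x" "x + y + z = 0 \<longleftrightarrow> y + z = - x" for x y z w :: real
    by linarith+
  have G'_eq: "G' = B.G'"
    unfolding assms(26) bouss_G'_def assms(25)[symmetric] G_eq B.G'_def A.solves_def ball_pair move
    by (simp add: fun_eq_iff Let_def)
  have N_eq: "B_norm \<Omega> \<nu> \<kappa> = A.N"
    by (simp add: B_norm_def A.N_def fun_eq_iff)
  have K: "K1 = B.K1" "K2 = B.K2"
    unfolding assms(23,24) B.K1_def B.K2_def by (simp_all add: divide_inverse algebra_simps)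
  show ?thesis
    unfolding G_eq G'_eq N_eq K assms(20)
  proof (intro conjI ballI exI[of _ "2 * B.C3"])
    fix p assume p: "p \<in> Vh \<times> Wh"
    show "B.G p \<in> Vh \<times> Wh" using B.G_in[OF p] by (simp only: mem_Times_iff simp_thms)
    show "has_frechet_derivative_on A.N (Vh \<times> Wh) B.G (B.G' p) p"
      by (rule B.G_has_frechet_derivative[OF p])
    fix q h assume q: "q \<in> Vh \<times> Wh" and h: "h \<in> Vh \<times> Wh"
    show "A.N (B.G' p h) \<le> \<nu> powr (-1/2) * min \<nu> \<kappa> powr (-1/2) * M
        * sqrt (2 * B.K1\<^sup>2 + 3 * B.K2\<^sup>2) * A.N h"
      by (rule B.G'_N_bound[OF p h])
    show "A.N (B.G' (p + h) q - B.G' p q) \<le> 2 * B.C3 * A.N h * A.N q"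
      by (rule B.G'_lipschitz[OF p q h])
  qed
qed

end
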